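(* Let $g_0$ be the round metric of curvature one on $\mathbb S^3$. For any $q>1$ and any positive integer $k$, the equation $$-\Delta_{g_0}u+\lambda u=\lambda u^q$$ on $(\mathbb S^3,g_0)$ has at least $k$ different positive torus-invariant solutions if $\lambda\in\left(\frac{4k(k+1)}{q-1},\frac{4(k+1)(k+2)}{q-1}\right]$.
   Context: $\Delta_{g_0}$ is the Laplace–Beltrami operator, with the sign convention that $-\Delta_{g_0}$ is nonnegative. Torus-invariant means invariant under the natural isometric cohomogeneity one action of $\mathbb S^1\times\mathbb S^1$ on $\mathbb S^3\subset\mathbb C^2$, $(e^{i\theta_1},e^{i\theta_2})\cdot(z_1,z_2)=(e^{i\theta_1}z_1,e^{i\theta_2}z_2)$. *)

theory Defs
  imports "HOL-Analysis.Analysis"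
begin

text \<open>
  Riemannian calculus on the unit sphere \<open>sphere 0 1\<close> of a Euclidean space, with the metric induced
  from the ambient inner product, i.e. the round metric of curvature one.  The tangent space at
  \<open>x\<close> is the orthogonal complement of \<open>x\<close>.  A derivative within the sphere is determined
  only on tangent vectors, so it is made unique by requiring that it vanish on the normal direction \<open>x\<close>.
\<close>

definition tangent_proj :: "'a::euclidean_space \<Rightarrow> 'a \<Rightarrow> 'a" where
  "tangent_proj x v = v - (v \<bullet> x) *\<^sub>R x"

definition sphere_grad :: "('a::euclidean_space \<Rightarrow> real) \<Rightarrow> 'a \<Rightarrow> 'a" where
  "sphere_grad u x =
     (THE w. w \<bullet> x = 0 \<and> (u has_derivative (\<lambda>h. w \<bullet> h)) (at x within sphere 0 1))"

definition sphere_deriv ::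
  "('a::euclidean_space \<Rightarrow> 'a) \<Rightarrow> 'a \<Rightarrow> 'a \<Rightarrow> 'a" where
  "sphere_deriv X x = (THE L. (X has_derivative L) (at x within sphere 0 1) \<and> L x = 0)"

text \<open>
  Since the metric is induced from the flat ambient space, the Levi-Civita connection is the tangential
  part of the ambient derivative of a tangent field.
\<close>

definition sphere_cov_deriv ::
  "('a::euclidean_space \<Rightarrow> 'a) \<Rightarrow> 'a \<Rightarrow> 'a \<Rightarrow> 'a" where
  "sphere_cov_deriv X x v = tangent_proj x (sphere_deriv X x v)"

text \<open>
  The divergence is the trace of \<open>v \<mapsto> \<nabla>\<^sub>v X\<close> on the tangent space.  It is computed
  as the trace over the ambient space of this map precomposed with the tangential projection.
\<close>

definition sphere_div :: "('a::euclidean_space \<Rightarrow> 'a) \<Rightarrow> 'a \<Rightarrow> real" where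
  "sphere_div X x = (\<Sum>b\<in>Basis. sphere_cov_deriv X x (tangent_proj x b) \<bullet> b)"

definition sphere_laplacian :: "('a::euclidean_space \<Rightarrow> real) \<Rightarrow> 'a \<Rightarrow> real" where
  "sphere_laplacian u = sphere_div (sphere_grad u)"

definition C2_on_open :: "('a::euclidean_space \<Rightarrow> real) \<Rightarrow> 'a set \<Rightarrow> bool" where
  "C2_on_open f W \<longleftrightarrow> open W \<and>
     (\<exists>(f' :: 'a \<Rightarrow> 'a \<Rightarrow>\<^sub>L real) (f'' :: 'a \<Rightarrow> 'a \<Rightarrow>\<^sub>L 'a \<Rightarrow>\<^sub>L real).
        (\<forall>x\<in>W. (f has_derivative blinfun_apply (f' x)) (at x)) \<and>
        (\<forall>x\<in>W. (f' has_derivative blinfun_apply (f'' x)) (at x)) \<and>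
        continuous_on W f'')"

definition C2_on_sphere :: "('a::euclidean_space \<Rightarrow> real) \<Rightarrow> bool" where
  "C2_on_sphere u \<longleftrightarrow>
     (\<exists>W f. sphere 0 1 \<subseteq> W \<and> C2_on_open f W \<and> (\<forall>x\<in>sphere 0 1. f x = u x))"

abbreviation S3 :: "(complex \<times> complex) set" where
  "S3 \<equiv> sphere 0 1"

definition torus_invariant :: "(complex \<times> complex \<Rightarrow> real) \<Rightarrow> bool" where
  "torus_invariant u \<longleftrightarrow>
     (\<forall>\<theta>1 \<theta>2 z1 z2. (z1, z2) \<in> S3 \<longrightarrow> u (cis \<theta>1 * z1, cis \<theta>2 * z2) = u (z1, z2))"

text \<open>
  Only the values of \<open>u\<close> on \<open>S3\<close> matter below.  The real power \<open>powr\<close> is the usual one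
  because solutions are required to be positive.
\<close>

definition positive_solution :: "real \<Rightarrow> real \<Rightarrow> (complex \<times> complex \<Rightarrow> real) \<Rightarrow> bool" where
  "positive_solution q lam u \<longleftrightarrow>
     C2_on_sphere u \<and>
     (\<forall>x\<in>S3. u x > 0) \<and>
     (\<forall>x\<in>S3. - sphere_laplacian u x + lam * u x = lam * (u x powr q))"


text \<open>The following facts show that the definite descriptions above are well-defined.\<close>

lemma sphere_derivative_unique_tangent:
  fixes f :: "'a::euclidean_space \<Rightarrow> 'b::real_normed_vector"
  assumes x: "norm x = 1" and v: "v \<bullet> x = 0"
    and L: "(f has_derivative L) (at x within sphere 0 1)"
    and M: "(f has_derivative M) (at x within sphere 0 1)"
  shows "L v = M v"
proof -
  interpret L: bounded_linear L using L by (rule has_derivative_bounded_linear)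
  interpret M: bounded_linear M using M by (rule has_derivative_bounded_linear)
  show ?thesis
  proof (cases "v = 0")
    case True
    then show ?thesis by (simp add: L.zero M.zero)
  next
    case False
    define w where "w = v /\<^sub>R norm v"
    have w: "w \<bullet> x = 0" "w \<bullet> w = 1" and vw: "v = norm v *\<^sub>R w"
      using False v by (auto simp: w_def dot_square_norm power2_eq_square)
    define g where "g t = cos t *\<^sub>R x + sin t *\<^sub>R w" for t :: real
    have xx: "x \<bullet> x = 1" using x by (simp add: dot_square_norm)
    have "g t \<bullet> g t = 1" for t
      using w xx by (simp add: g_def inner_add_left inner_add_right inner_commute
          flip: power2_eq_square)
    then have gS: "range g \<subseteq> sphere 0 1"
      by (auto simp: norm_eq_sqrt_inner)
    have gd: "(g has_derivative (\<lambda>t. t *\<^sub>R w)) (at 0)"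
      unfolding g_def by (auto intro!: derivative_eq_intros)
    have g0: "g 0 = x" by (simp add: g_def)
    have "((f \<circ> g) has_derivative (K \<circ> (\<lambda>t. t *\<^sub>R w))) (at 0)"
      if "(f has_derivative K) (at x within sphere 0 1)" for K
    proof -
      have "(f has_derivative K) (at (g 0) within range g)"
        using has_derivative_subset[OF that gS] by (simp add: g0)
      then show ?thesis using diff_chain_within[of g "\<lambda>t. t *\<^sub>R w" 0 UNIV f K] gd by simp
    qed
    then have "L \<circ> (\<lambda>t. t *\<^sub>R w) = M \<circ> (\<lambda>t. t *\<^sub>R w)"
      using L M has_derivative_unique by blast
    then have "L w = M w" by (metis comp_apply scaleR_one)
    then show ?thesis using vw by (metis L.scaleR M.scaleR)
  qed
qed

lemma sphere_grad_eq:
  assumes x: "norm x = 1" and w: "w \<bullet> x = 0"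
    and d: "(u has_derivative (\<lambda>h. w \<bullet> h)) (at x within sphere 0 1)"
  shows "sphere_grad u x = w"
  unfolding sphere_grad_def
proof (rule the_equality)
  fix w' assume w': "w' \<bullet> x = 0 \<and> (u has_derivative (\<lambda>h. w' \<bullet> h)) (at x within sphere 0 1)"
  have "(w' - w) \<bullet> x = 0" using w w' by (simp add: inner_diff_left)
  then have "w' \<bullet> (w' - w) = w \<bullet> (w' - w)"
    using sphere_derivative_unique_tangent x w' d by blast
  then have "(w' - w) \<bullet> (w' - w) = 0" by (simp add: inner_diff_left)
  then show "w' = w" by simp
qed (use assms in auto)

lemma tangent_proj_orthogonal: "norm x = 1 \<Longrightarrow> tangent_proj x v \<bullet> x = 0"
  by (simp add: tangent_proj_def inner_diff_left dot_square_norm)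

lemma sphere_deriv_eq:
  assumes x: "norm x = 1" and d: "(X has_derivative L) (at x within sphere 0 1)" and L: "L x = 0"
  shows "sphere_deriv X x = L"
  unfolding sphere_deriv_def
proof (rule the_equality)
  fix M assume M: "(X has_derivative M) (at x within sphere 0 1) \<and> M x = 0"
  interpret L: bounded_linear L using d by (rule has_derivative_bounded_linear)
  interpret M: bounded_linear M using M has_derivative_bounded_linear by blast
  have "M v = L v" for v
  proof -
    have "M (tangent_proj x v) = L (tangent_proj x v)"
      using sphere_derivative_unique_tangent x tangent_proj_orthogonal d M by blast
    then show ?thesis
      using M L by (simp add: tangent_proj_def M.diff L.diff M.scaleR L.scaleR)
  qed
  then show "M = L" by blast
qed (use assms in auto)

lemma tangent_proj_inner: "norm x = 1 \<Longrightarrow> tangent_proj x v \<bullet> w = tangent_proj x v \<bullet> tangent_proj x w"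
  by (simp add: tangent_proj_def inner_diff_left inner_diff_right dot_square_norm inner_commute algebra_simps)

text \<open>
  Existence of the objects described, in terms of an extension \<open>f\<close> to a neighbourhood with gradient
  \<open>G\<close>, and the linear functions as first nontrivial spherical harmonics, which fix the sign convention.
\<close>

lemma sphere_laplacian_eq:
  fixes u f :: "'a::euclidean_space \<Rightarrow> real"
  assumes x: "norm x = 1" and W: "open W" "sphere 0 1 \<subseteq> W"
    and u: "\<And>y. norm y = 1 \<Longrightarrow> u y = f y"
    and G: "\<And>y. y \<in> W \<Longrightarrow> (f has_derivative (\<lambda>h. G y \<bullet> h)) (at y)"
    and H: "(G has_derivative H) (at x)"
  shows "sphere_laplacian u x =
    (\<Sum>b\<in>Basis. H (tangent_proj x b) \<bullet> tangent_proj x b) - (real DIM('a) - 1) * (G x \<bullet> x)"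
proof -
  have P1: "((\<lambda>y. (1::real)) has_derivative (\<lambda>h. 0)) (at y within sphere 0 1)" for y::'a by simp
  have nn: "((\<lambda>z. (z \<bullet> z)) has_derivative (\<lambda>h. 2 * (y \<bullet> h))) (at y within sphere 0 1)" for y::'a
    by (auto intro!: derivative_eq_intros simp: inner_commute)
  have n0: "((\<lambda>z. (z \<bullet> z)) has_derivative (\<lambda>h. 0)) (at y within sphere 0 1)" if "norm y = 1" for y::'a
    by (rule has_derivative_transform[OF _ _ P1]) (use that in \<open>auto simp: dot_square_norm\<close>)
  have grad: "sphere_grad u y = tangent_proj y (G y)" if y: "norm y = 1" for y
  proof (rule sphere_grad_eq[OF y tangent_proj_orthogonal[OF y]])
    have "((\<lambda>z. f z - (G y \<bullet> y / 2) * (z \<bullet> z)) has_derivative (\<lambda>h. G y \<bullet> h - (G y \<bullet> y / 2) * (2 * (y \<bullet> h))))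
       (at y within sphere 0 1)"
      by (intro derivative_intros nn has_derivative_at_withinI[OF G]) (use y W in auto)
    then have "((\<lambda>z. f z - (G y \<bullet> y / 2) * (z \<bullet> z) + (G y \<bullet> y / 2) * (z \<bullet> z)) has_derivative 
      (\<lambda>h. (G y \<bullet> h - (G y \<bullet> y / 2) * (2 * (y \<bullet> h))) + (G y \<bullet> y / 2) * 0))
       (at y within sphere 0 1)"
      by (intro has_derivative_add has_derivative_mult_right n0[OF y])
    then have "(f has_derivative (\<lambda>h. tangent_proj y (G y) \<bullet> h)) (at y within sphere 0 1)"
      by (simp add: tangent_proj_def inner_diff_left)
    then show "(u has_derivative (\<lambda>h. tangent_proj y (G y) \<bullet> h)) (at y within sphere 0 1)"
      by (rule has_derivative_transform[rotated 2]) (use y u in auto)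
  qed
  define L where "L v = H v - (G x \<bullet> v + H v \<bullet> x) *\<^sub>R x - (G x \<bullet> x) *\<^sub>R v" for v
  define M where "M v = L (tangent_proj x v)" for v
  have bH: "bounded_linear H" using H by (rule has_derivative_bounded_linear)
  interpret H: bounded_linear H by (rule bH)
  have dL: "((\<lambda>y. tangent_proj y (G y)) has_derivative L) (at x within sphere 0 1)"
    unfolding tangent_proj_def
    by (auto intro!: derivative_eq_intros has_derivative_at_withinI[OF H] simp: L_def fun_eq_iff algebra_simps)
  have n0x: "((\<lambda>z. (z \<bullet> z) *\<^sub>R (L x /\<^sub>R 2)) has_derivative (\<lambda>h. 0)) (at x within sphere 0 1)"
    using has_derivative_scaleR_left[OF n0[OF x], of "L x /\<^sub>R 2"] by simp
  have nnx: "((\<lambda>z. (z \<bullet> z) *\<^sub>R (L x /\<^sub>R 2)) has_derivative (\<lambda>h. (x \<bullet> h) *\<^sub>R L x)) (at x within sphere 0 1)"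
    using has_derivative_scaleR_left[OF nn[of x], of "L x /\<^sub>R 2"] by simp
  have "((\<lambda>y. tangent_proj y (G y) - (y \<bullet> y) *\<^sub>R (L x /\<^sub>R 2) + (y \<bullet> y) *\<^sub>R (L x /\<^sub>R 2)) has_derivative 
      (\<lambda>h. L h - (x \<bullet> h) *\<^sub>R L x + 0)) (at x within sphere 0 1)"
    by (intro has_derivative_add has_derivative_diff dL nnx n0x)
  moreover have "L h - (x \<bullet> h) *\<^sub>R L x + 0 = M h" for h
    by (simp add: M_def L_def tangent_proj_def H.diff H.scaleR algebra_simps inner_commute)
  ultimately have "((\<lambda>y. tangent_proj y (G y)) has_derivative M) (at x within sphere 0 1)" by simp
  then have "(sphere_grad u has_derivative M) (at x within sphere 0 1)"
    by (rule has_derivative_transform[rotated 2]) (use grad x in auto)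
  moreover have "M x = 0" using x by (simp add: M_def L_def tangent_proj_def dot_square_norm)
  ultimately have dM: "sphere_deriv (sphere_grad u) x = M" by (rule sphere_deriv_eq[OF x])
  let ?P = "tangent_proj x"
  have PP: "?P (?P v) = ?P v" for v
    using x by (simp add: tangent_proj_def dot_square_norm inner_diff_left)
  have Px: "?P v \<bullet> x = 0" "x \<bullet> ?P v = 0" for v
    using tangent_proj_orthogonal[OF x, of v] by (simp_all add: inner_commute)
  have trm: "?P (M (?P b)) \<bullet> b = H (?P b) \<bullet> ?P b - (G x \<bullet> x) * (?P b \<bullet> ?P b)" for b
    by (subst tangent_proj_inner[OF x])
       (use x in \<open>simp add: M_def PP L_def tangent_proj_def[of x "_ - _"] inner_diff_left inner_diff_right inner_add_left  Px dot_square_norm\<close>)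
  have "(\<Sum>b\<in>Basis. ?P b \<bullet> ?P b) = (\<Sum>b\<in>Basis. 1 - (x \<bullet> b) * (x \<bullet> b))"
  proof (rule sum.cong[OF refl])
    fix b :: 'a assume "b \<in> Basis"
    then have "?P b \<bullet> b = 1 - (x \<bullet> b) * (x \<bullet> b)"
      by (simp add: tangent_proj_def inner_diff_left inner_commute[of b x])
    then show "?P b \<bullet> ?P b = 1 - (x \<bullet> b) * (x \<bullet> b)"
      using tangent_proj_inner[OF x, of b b] by simp
  qed
  also have "\<dots> = real DIM('a) - 1"
    using x euclidean_inner[of x x] by (simp add: sum_subtractf dot_square_norm)
  finally have "(\<Sum>b\<in>Basis. ?P b \<bullet> ?P b) = real DIM('a) - 1" .
  then show ?thesis
    unfolding sphere_laplacian_def sphere_div_def sphere_cov_deriv_def dM trm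
    by (simp add: sum_subtractf mult.commute flip: sum_distrib_left)
qed

lemma sphere_laplacian_linear_S3:
  fixes a x :: "complex \<times> complex"
  assumes "norm x = 1"
  shows "sphere_laplacian (\<lambda>y. a \<bullet> y) x = - 3 * (a \<bullet> x)"
  using sphere_laplacian_eq[OF assms, of UNIV "\<lambda>y. a \<bullet> y" "\<lambda>y. a \<bullet> y" "\<lambda>_. a" "\<lambda>_. 0"]
  by (simp add: has_derivative_inner_right bounded_linear_imp_has_derivative bounded_linear_inner_right)

end

theory Submission
  imports Defs "HOL-Real_Asymp.Real_Asymp"
begin

text \<open>
  A torus-invariant function on \<open>S3\<close> depends only on \<open>s = |z2|\<^sup>2\<close>, and on such functions
  the Laplacian is \<open>4 (s (1 - s) g')'\<close>.  In the stereographic variable \<open>y = s / (1 - s)\<close>, with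
  \<open>v(y) = g(s)\<close> and \<open>P = y v'\<close>, the equation becomes the system \<open>v' = P / y\<close>,
  \<open>P' = - \<Lambda> (v\<^sup>q - v) / (1 + y)\<^sup>2\<close> with \<open>\<Lambda> = lam / 4\<close>.  The circles \<open>z2 = 0\<close> and
  \<open>z1 = 0\<close> are the ends \<open>y = 0\<close> and \<open>y = \<infinity>\<close>.  In the time \<open>ln y\<close> the derivative of \<open>v\<close> is
  \<open>P\<close>, and the reflection \<open>y \<mapsto> 1 / y\<close> exchanges the ends, so a solution is smooth on the sphere
  exactly when \<open>P\<close> vanishes at both ends.

  For every \<open>a\<close> there is one solution \<open>v a\<close> that is regular at \<open>y = 0\<close> with value \<open>a\<close>
  (\<open>singular_ivp_family\<close>).  It remains to find many \<open>a \<in> (0, 1)\<close> for which \<open>P a\<close> tends to \<open>0\<close> at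
  infinity.  They are detected by the number of crossings of the constant solution \<open>1\<close>.
  Since the weight \<open>(1 + y)\<^sup>-\<^sup>2\<close> beats the logarithmic growth of solutions, two
  crossings are separated by a fixed distance in the variable \<open>1 / sqrt y\<close>
  (\<open>crossings_separated\<close>), and every crossing is transversal.  Consequently, as \<open>a\<close> varies, a crossing can only appear or
  disappear at infinity, one at a time, and only at a value \<open>a\<close> where \<open>P a \<rightarrow> 0\<close>: if
  \<open>P a\<close> has a nonzero limit, then \<open>v a\<close> runs off logarithmically and so do its neighbours
  (\<open>crosses_open\<close>, \<open>crosses_jump_le_one\<close>, \<open>crosses_locally_constant\<close>).

  For small \<open>a\<close> there is at most one crossing, because a convexity argument makes the speed \<open>P\<close> at the first
  crossing much larger than anything the weight can take away afterwards (\<open>small_data_cross_once\<close>).  For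
  \<open>a\<close> near \<open>1\<close> there are at least \<open>k\<close> crossings by Sturm comparison, since the
  linearisation at \<open>1\<close> has the coefficient \<open>\<Lambda> (q - 1) > k (k + 1)\<close>
  (\<open>near_one_crosses\<close>).  Hence for each \<open>j = 2, \<dots>, k\<close> there is an \<open>a\<close> with
  \<open>P a \<rightarrow> 0\<close> and exactly \<open>j - 1\<close> crossings (\<open>exists_regular_at_jump\<close>).  These \<open>k - 1\<close> solutions
  are positive up to both ends (\<open>regular_imp_pos\<close>, \<open>regular_imp_limit\<close>) and of class C2 on the sphere
  (\<open>singular_profile_is_C2\<close>); they start below \<open>1\<close> at \<open>z2 = 0\<close>, so together with the constant
  \<open>1\<close> they are \<open>k\<close> different solutions.

  To have global solutions for every \<open>a\<close>, the nonlinearity is set to zero for \<open>v \<le> 0\<close> and frozen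
  above a slowly growing barrier that no solution with \<open>a \<le> 1\<close> ever exceeds.
\<close>

section \<open>The singular initial value problem\<close>

text \<open>
  The mean value of \<open>g\<close> over \<open>[0, y]\<close>, written over the unit interval, makes sense and
  is continuous up to \<open>y = 0\<close>.  This form removes the singularity of \<open>(y w')' = - \<phi>\<close>.
\<close>

lemma integral_unit_dilation:
  fixes g :: "real \<Rightarrow> real"
  assumes g: "continuous_on {0..} g" and y: "0 \<le> y"
  shows "y * integral {0..1} (\<lambda>\<tau>. g (\<tau> * y)) = integral {0..y} g"
proof (cases "y = 0")
  case False
  then have y: "0 < y" using y by simp
  have "g integrable_on {0..y}"
    by (rule integrable_continuous_real) (use continuous_on_subset[OF g] in auto)
  then have "(g has_integral integral {0..y} g) (cbox 0 y)"
    by (simp add: has_integral_integral)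
  from has_integral_affinity[OF this, of y 0]
  have "((\<lambda>x. g (y * x)) has_integral (integral {0..y} g / y)) ((\<lambda>x. x / y) ` {0..y})"
    using y by simp
  moreover have "(\<lambda>x. x / y) ` {0..y} = {0..1}"
  proof -
    have "x \<in> (\<lambda>x. x / y) ` {0..y}" if "x \<in> {0..1}" for x
      using that y by (intro image_eqI[of _ _ "x * y"]) (auto simp: mult_left_le_one_le)
    then show ?thesis using y by auto
  qed
  ultimately have "integral {0..1} (\<lambda>\<tau>. g (y * \<tau>)) = integral {0..y} g / y"
    by (simp add: integral_unique)
  then show ?thesis using y by (simp add: mult.commute)
qed simp

lemma continuous_on_indefinite_integral_atLeast:
  fixes g :: "real \<Rightarrow> real"
  assumes "\<And>y. g integrable_on {0..y}"
  shows "continuous_on {0..} (\<lambda>y. integral {0..y} g)"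
  unfolding continuous_on_eq_continuous_within
proof
  fix x :: real assume x: "x \<in> {0..}"
  have "continuous_on {0..x+1} (\<lambda>y. integral {0..y} g)"
    by (rule indefinite_integral_continuous_1) (rule assms)
  moreover have "at x within {0..} = at x within {0..x+1}"
    by (rule at_within_nhd[of x "{..<x+1}"]) auto
  ultimately show "continuous (at x within {0..}) (\<lambda>y. integral {0..y} g)"
    using x by (auto simp: continuous_on_eq_continuous_within)
qed

text \<open>
  Integrating \<open>(y w')' = - \<phi>(y, w)\<close> twice from the singular point \<open>y = 0\<close> gives
  \<open>w(y) = a - \<integral>\<^sub>0\<^sup>y m(r) dr\<close>, where \<open>m(r)\<close> is the mean of \<open>\<phi>(\<cdot>, w)\<close> over
  \<open>[0, r]\<close>.  In the supremum norm weighted by \<open>exp (- 2 K y)\<close> the right-hand side is a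
  contraction with factor \<open>1/2\<close>.  A change of \<open>a\<close> moves the operator by \<open>|a - b|\<close>, hence
  the fixed point by at most \<open>2 |a - b|\<close> in the same norm.
\<close>

lemma singular_ivp_family:
  fixes \<phi> :: "real \<Rightarrow> real \<Rightarrow> real" and K :: real
  assumes K: "0 < K"
    and cont: "continuous_on ({0..} \<times> UNIV) (\<lambda>(s, v). \<phi> s v)"
    and bnd: "\<And>s v. 0 \<le> s \<Longrightarrow> \<bar>\<phi> s v\<bar> \<le> K"
    and lip: "\<And>s v v'. 0 \<le> s \<Longrightarrow> \<bar>\<phi> s v - \<phi> s v'\<bar> \<le> K * \<bar>v - v'\<bar>"
  obtains v :: "real \<Rightarrow> real \<Rightarrow> real" where
    "\<And>a. continuous_on {0..} (v a)"
    "\<And>a y. 0 \<le> y \<Longrightarrow>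
       v a y = a - integral {0..y} (\<lambda>r. integral {0..1} (\<lambda>\<tau>. \<phi> (\<tau> * r) (v a (\<tau> * r))))"
    "\<And>a b y. 0 \<le> y \<Longrightarrow> \<bar>v a y - v b y\<bar> \<le> 2 * \<bar>a - b\<bar> * exp (2 * K * y)"
    "\<And>a y. (\<And>s. 0 \<le> s \<Longrightarrow> \<phi> s a = 0) \<Longrightarrow> 0 \<le> y \<Longrightarrow> v a y = a"
proof -
  \<comment> \<open>The fixed point is sought for \<open>u(y) = exp (- A y) w(y)\<close>, extended by a constant to negative \<open>y\<close>.  \<open>E\<close> undoes the rescaling and \<open>M\<close> is the mean.\<close>
  define A where "A = 2 * K"
  have A: "0 < A" using K by (simp add: A_def)
  define E where "E u s = exp (A * s) * apply_bcontfun u s" for u :: "real \<Rightarrow>\<^sub>C real" and s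
  define M where "M u r = integral {0..1} (\<lambda>\<tau>. \<phi> (\<tau> * r) (E u (\<tau> * r)))" for u r
  define T where "T a u y = exp (- A * max y 0) * (a - integral {0..max y 0} (M u))" for a u y
  have contE: "continuous_on S (\<lambda>x. E u (f x))" if "continuous_on S f" for S u and f :: "'z::topological_space \<Rightarrow> real"
    unfolding E_def
    by (intro continuous_intros that continuous_on_compose2[OF continuous_on_apply_bcontfun[of UNIV u] that]) auto
  have cont2: "continuous_on S (\<lambda>x. \<phi> (f x) (g x))" if "continuous_on S f" "continuous_on S g" "\<And>x. x \<in> S \<Longrightarrow> 0 \<le> f x"
    for S and f g :: "'z::topological_space \<Rightarrow> real"
    using continuous_on_compose2[OF cont continuous_on_Pair[OF that(1,2)]] that(3) by auto
  have intM: "(\<lambda>\<tau>. \<phi> (\<tau> * r) (E u (\<tau> * r))) integrable_on {0..1}" if "0 \<le> r" for u r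
    by (rule integrable_continuous_real) (intro cont2 contE continuous_intros, use that in auto)
  have contM: "continuous_on {0..} (M u)" for u
  proof -
    have "continuous_on ({0..} \<times> cbox 0 1) (\<lambda>(r, \<tau>). \<phi> (\<tau> * r) (E u (\<tau> * r)))"
      unfolding case_prod_beta by (intro cont2 contE continuous_intros) auto
    from integral_continuous_on_param[OF this] show ?thesis
      unfolding M_def by simp
  qed
  have intMy: "M u integrable_on {0..y}" for u y
    by (rule integrable_continuous_real) (rule continuous_on_subset[OF contM], auto)
  have bndM: "\<bar>M u r\<bar> \<le> K" if "0 \<le> r" for u r
  proof -
    have "norm (integral (cbox 0 1) (\<lambda>\<tau>. \<phi> (\<tau> * r) (E u (\<tau> * r)))) \<le> integral (cbox 0 (1::real)) (\<lambda>_. K)"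
      using intM[OF that, of u] that bnd by (intro integral_norm_bound_integral) auto
    then show ?thesis unfolding M_def by simp
  qed
  have bndI: "\<bar>integral {0..y} (M u)\<bar> \<le> K * y" if "0 \<le> y" for u y
  proof -
    have "norm (integral {0..y} (M u)) \<le> integral {0..y} (\<lambda>_. K)"
      using bndM intMy by (intro integral_norm_bound_integral) auto
    then show ?thesis using that by (simp add: mult.commute)
  qed
  have Tb: "T a u \<in> bcontfun" for a u
  proof (rule bcontfun_normI)
    have "continuous_on {0..} (\<lambda>y. integral {0..y} (M u))"
      by (rule continuous_on_indefinite_integral_atLeast) (rule intMy)
    then show "continuous_on UNIV (T a u)"
      unfolding T_def by (intro continuous_intros continuous_on_compose2[of "{0..}" "\<lambda>y. integral {0..y} (M u)" UNIV "\<lambda>y. max y 0"]) auto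
    show "norm (T a u y) \<le> \<bar>a\<bar> + 1" for y
    proof -
      define z where "z = max y 0"
      have z: "0 \<le> z" by (simp add: z_def)
      have "\<bar>a - integral {0..z} (M u)\<bar> \<le> \<bar>a\<bar> + K * z" using bndI[OF z, of u] by linarith
      also have "\<dots> \<le> (\<bar>a\<bar> + 1) * exp (A * z)"
      proof -
        have "1 + A * z \<le> exp (A * z)" by (rule exp_ge_add_one_self)
        moreover have "0 \<le> K * z" using K z by simp
        moreover have "\<bar>a\<bar> * 1 \<le> \<bar>a\<bar> * exp (A * z)" using A z by (intro mult_left_mono) auto
        ultimately show ?thesis unfolding A_def distrib_right by linarith
      qed
      finally show ?thesis
        unfolding T_def z_def[symmetric] by (simp add: abs_mult exp_minus field_simps)
    qed
  qed
  define TT where "TT a u = Bcontfun (T a u)" for a u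
  have TT: "apply_bcontfun (TT a u) = T a u" for a u
    unfolding TT_def using Tb by (simp add: Bcontfun_inverse)
  have MM: "\<bar>M u r - M u' r\<bar> \<le> K * dist u u' * exp (A * r)" if r: "0 \<le> r" for u u' r
  proof -
    have "norm (integral (cbox 0 1) (\<lambda>\<tau>. \<phi> (\<tau> * r) (E u (\<tau> * r)) - \<phi> (\<tau> * r) (E u' (\<tau> * r))))
        \<le> integral (cbox 0 (1::real)) (\<lambda>_. K * dist u u' * exp (A * r))"
    proof (rule integral_norm_bound_integral)
      show "(\<lambda>\<tau>. \<phi> (\<tau> * r) (E u (\<tau> * r)) - \<phi> (\<tau> * r) (E u' (\<tau> * r))) integrable_on cbox 0 1"
        using intM[OF r] by (auto intro: integrable_diff)
      fix \<tau> :: real assume "\<tau> \<in> cbox 0 1"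
      then have t: "0 \<le> \<tau> * r" "\<tau> * r \<le> r" using r by (auto simp: mult_left_le_one_le)
      have "norm (\<phi> (\<tau> * r) (E u (\<tau> * r)) - \<phi> (\<tau> * r) (E u' (\<tau> * r))) \<le> K * \<bar>E u (\<tau> * r) - E u' (\<tau> * r)\<bar>"
        using lip[OF t(1)] by simp
      also have "\<bar>E u (\<tau> * r) - E u' (\<tau> * r)\<bar> = exp (A * (\<tau> * r)) * dist (u (\<tau> * r)) (u' (\<tau> * r))"
        by (simp add: E_def dist_real_def abs_mult flip: right_diff_distrib)
      also have "\<dots> \<le> exp (A * r) * dist u u'"
        using t A dist_bounded by (intro mult_mono) auto
      finally show "norm (\<phi> (\<tau> * r) (E u (\<tau> * r)) - \<phi> (\<tau> * r) (E u' (\<tau> * r))) \<le> K * dist u u' * exp (A * r)"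
        using K by (simp add: mult.commute mult.left_commute)
    qed auto
    then show ?thesis unfolding M_def
      using integral_diff[OF intM[OF r] intM[OF r]] by simp
  qed
  have contr: "dist (TT a u) (TT a u') \<le> 1/2 * dist u u'" for a u u'
  proof (rule dist_bound)
    fix y :: real
    define z where "z = max y 0"
    have z: "0 \<le> z" by (simp add: z_def)
    have e: "((\<lambda>r. K * dist u u' * exp (A * r)) has_integral (K * dist u u' * exp (A * z) / A - K * dist u u' * exp (A * 0) / A)) {0..z}"
      using z A by (intro fundamental_theorem_of_calculus)
        (auto intro!: derivative_eq_intros simp: field_simps simp flip: has_real_derivative_iff_has_vector_derivative)
    have "norm (integral {0..z} (\<lambda>r. M u r - M u' r)) \<le> integral {0..z} (\<lambda>r. K * dist u u' * exp (A * r))"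
      using MM intMy e by (intro integral_norm_bound_integral) (auto intro: integrable_diff has_integral_integrable)
    also have "\<dots> \<le> 1/2 * dist u u' * exp (A * z)"
      using integral_unique[OF e] K zero_le_dist[of u u'] by (simp add: A_def field_simps del: zero_le_dist)
    finally have "\<bar>integral {0..z} (M u) - integral {0..z} (M u')\<bar> \<le> 1/2 * dist u u' * exp (A * z)"
      using integral_diff[OF intMy intMy] by simp
    moreover have "dist (TT a u y) (TT a u' y) = exp (- A * z) * \<bar>integral {0..z} (M u) - integral {0..z} (M u')\<bar>"
      unfolding TT T_def z_def[symmetric] dist_real_def by (simp add: abs_mult abs_minus_commute flip: right_diff_distrib)
    ultimately have "dist (TT a u y) (TT a u' y) \<le> exp (- A * z) * (1/2 * dist u u' * exp (A * z))"
      by (simp add: mult_left_mono)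
    also have "\<dots> = 1/2 * dist u u'" by (simp add: exp_minus field_simps)
    finally show "dist (TT a u y) (TT a u' y) \<le> 1/2 * dist u u'" .
  qed
  have "\<exists>!u. TT a u = u" for a
    by (rule banach_fix_type[of "1/2"]) (use contr in auto)
  then obtain U where U: "\<And>a. TT a (U a) = U a" and Uu: "\<And>a u. TT a u = u \<Longrightarrow> u = U a"
    by metis
  have UE: "E (U a) y = a - integral {0..y} (M (U a))" if "0 \<le> y" for a y
  proof -
    have "U a y = exp (- A * y) * (a - integral {0..y} (M (U a)))"
      using fun_cong[OF TT, of a "U a" y] that by (simp add: U T_def)
    then show ?thesis by (simp add: E_def exp_minus)
  qed
  have dU: "dist (U a) (U b) \<le> 2 * \<bar>a - b\<bar>" for a b
  proof -
    have "dist (TT a (U b)) (TT b (U b)) \<le> \<bar>a - b\<bar>"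
    proof (rule dist_bound)
      fix y :: real
      have "dist (TT a (U b) y) (TT b (U b) y) = exp (- A * max y 0) * \<bar>a - b\<bar>"
        unfolding TT T_def dist_real_def by (simp add: abs_mult flip: right_diff_distrib)
      also have "\<dots> \<le> 1 * \<bar>a - b\<bar>" using A by (intro mult_right_mono) auto
      finally show "dist (TT a (U b) y) (TT b (U b) y) \<le> \<bar>a - b\<bar>" by simp
    qed
    then show ?thesis
      using contr[of a "U a" "U b"] dist_triangle[of "TT a (U a)" "TT b (U b)" "TT a (U b)"] by (simp add: U)
  qed
  show ?thesis
  proof (rule that[of "\<lambda>a. E (U a)"])
    show "continuous_on {0..} (E (U a))" for a by (intro contE continuous_intros)
    show "E (U a) y = a - integral {0..y} (\<lambda>r. integral {0..1} (\<lambda>\<tau>. \<phi> (\<tau> * r) (E (U a) (\<tau> * r))))" if "0 \<le> y" for a y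
      using UE[OF that, of a] unfolding M_def .
    show "\<bar>E (U a) y - E (U b) y\<bar> \<le> 2 * \<bar>a - b\<bar> * exp (2 * K * y)" if "0 \<le> y" for a b y
    proof -
      have "\<bar>E (U a) y - E (U b) y\<bar> = exp (A * y) * dist (U a y) (U b y)"
        by (simp add: E_def dist_real_def abs_mult flip: right_diff_distrib)
      also have "\<dots> \<le> exp (A * y) * (2 * \<bar>a - b\<bar>)"
        using order_trans[OF dist_bounded dU] by (intro mult_left_mono) auto
      finally show ?thesis by (simp add: A_def mult.commute)
    qed
    show "E (U a) y = a" if 0: "\<And>s. 0 \<le> s \<Longrightarrow> \<phi> s a = 0" and y: "0 \<le> y" for a y
    proof -
      define e where "e s = exp (- A * max s 0) * a" for s
      have eb: "e \<in> bcontfun"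
        by (rule bcontfun_normI[where b = "\<bar>a\<bar>"])
           (use A in \<open>auto simp: e_def abs_mult intro!: continuous_intros mult_left_le_one_le\<close>)
      define u where "u = Bcontfun e"
      have u: "apply_bcontfun u = e" unfolding u_def using eb by (simp add: Bcontfun_inverse)
      have Eu: "E u s = a" if "0 \<le> s" for s
        using that by (simp add: E_def u e_def exp_minus)
      have "M u r = 0" if "0 \<le> r" for r
      proof -
        have "M u r = integral {0..1} (\<lambda>_::real. 0::real)"
          unfolding M_def using that by (intro Henstock_Kurzweil_Integration.integral_cong) (simp add: Eu 0)
        then show ?thesis by simp
      qed
      then have "integral {0..z} (M u) = integral {0..z} (\<lambda>_. 0)" for z
        by (intro Henstock_Kurzweil_Integration.integral_cong) auto
      then have "TT a u = u" by (intro bcontfun_eqI) (simp add: TT T_def u e_def)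
      then have "u = U a" by (rule Uu)
      then show ?thesis using Eu[OF y] by simp
    qed
  qed
qed

lemma singular_ivp_first_order_system:
  fixes \<phi> :: "real \<Rightarrow> real \<Rightarrow> real" and w :: "real \<Rightarrow> real"
  assumes cont: "continuous_on ({0..} \<times> UNIV) (\<lambda>(s, v). \<phi> s v)"
    and w: "continuous_on {0..} w"
    and eq: "\<And>y. 0 \<le> y \<Longrightarrow>
       w y = a - integral {0..y} (\<lambda>r. integral {0..1} (\<lambda>\<tau>. \<phi> (\<tau> * r) (w (\<tau> * r))))"
    and P: "\<And>y. P y = - integral {0..y} (\<lambda>s. \<phi> s (w s))"
  shows "0 < y \<Longrightarrow> (w has_real_derivative P y / y) (at y)"
    and "0 < y \<Longrightarrow> (P has_real_derivative - \<phi> y (w y)) (at y)"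
    and "continuous_on {0..} P"
proof -
  have cg: "continuous_on {0..} (\<lambda>s. \<phi> s (w s))"
    using continuous_on_compose2[OF cont continuous_on_Pair[OF continuous_on_id w]] by auto
  have cont2: "continuous_on S (\<lambda>x. \<phi> (f x) (w (f x)))" if "continuous_on S f" "\<And>x. x \<in> S \<Longrightarrow> 0 \<le> f x"
    for S and f :: "'z::topological_space \<Rightarrow> real"
    using continuous_on_compose2[OF cg that(1)] that(2) by auto
  define m where "m r = integral {0..1} (\<lambda>\<tau>. \<phi> (\<tau> * r) (w (\<tau> * r)))" for r
  have cm: "continuous_on {0..} m"
  proof -
    have "continuous_on ({0..} \<times> cbox 0 1) (\<lambda>(r, \<tau>). \<phi> (\<tau> * r) (w (\<tau> * r)))"
      unfolding case_prod_beta by (intro cont2 continuous_intros) auto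
    from integral_continuous_on_param[OF this] show ?thesis
      unfolding m_def by simp
  qed
  have deriv: "((\<lambda>y. integral {0..y} g) has_real_derivative g y) (at y)" if "continuous_on {0..} g" "0 < y" for g :: "real \<Rightarrow> real" and y
  proof -
    have "((\<lambda>y. integral {0..y} g) has_real_derivative g y) (at y within {0..y+1})"
      by (rule integral_has_real_derivative) (use that in \<open>auto intro: continuous_on_subset\<close>)
    moreover have "at y within {0..y+1} = at y" using that by (intro at_within_interior) auto
    ultimately show ?thesis by simp
  qed
  show "(w has_real_derivative P y / y) (at y)" if y: "0 < y"
  proof -
    have "((\<lambda>y. a - integral {0..y} m) has_real_derivative 0 - m y) (at y)"
      by (intro derivative_intros deriv cm y)
    moreover have "0 - m y = P y / y"
      using integral_unit_dilation[OF cg, of y] y by (simp add: P m_def field_simps)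
    ultimately have "((\<lambda>y. a - integral {0..y} m) has_real_derivative P y / y) (at y)" by simp
    then show ?thesis
      by (rule has_field_derivative_transform_within_open[of _ _ _ "{0<..}"])
         (use y eq in \<open>auto simp: m_def[abs_def]\<close>)
  qed
  show "(P has_real_derivative - \<phi> y (w y)) (at y)" if y: "0 < y"
    unfolding P[abs_def] by (intro derivative_intros deriv cg y)
  show "continuous_on {0..} P"
    unfolding P[abs_def]
    by (intro continuous_intros continuous_on_indefinite_integral_atLeast integrable_continuous_real)
      (rule continuous_on_subset[OF cg], auto)
qed

section \<open>Linear estimates in logarithmic time\<close>

lemma abs_increment_le:
  fixes f g :: "real \<Rightarrow> real"
  assumes "a \<le> b" "continuous_on {a..b} f" "continuous_on {a..b} g"
    and "\<And>x. a < x \<Longrightarrow> x < b \<Longrightarrow> (f has_real_derivative f' x) (at x)"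
    and "\<And>x. a < x \<Longrightarrow> x < b \<Longrightarrow> (g has_real_derivative g' x) (at x)"
    and "\<And>x. a < x \<Longrightarrow> x < b \<Longrightarrow> \<bar>f' x\<bar> \<le> g' x"
  shows "\<bar>f b - f a\<bar> \<le> g b - g a"
proof (cases "a = b")
  case False
  then show ?thesis
    using differentiable_bound_general[of a b f g f' g'] assms
    by (simp add: has_real_derivative_iff_has_vector_derivative)
qed simp

lemma abs_increment_le_closed:
  fixes f g :: "real \<Rightarrow> real"
  assumes ab: "a \<le> b"
    and f: "\<And>x. x \<in> {a..b} \<Longrightarrow> (f has_real_derivative f' x) (at x)"
    and g: "\<And>x. x \<in> {a..b} \<Longrightarrow> (g has_real_derivative g' x) (at x)"
    and le: "\<And>x. x \<in> {a..b} \<Longrightarrow> \<bar>f' x\<bar> \<le> g' x"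
  shows "\<bar>f b - f a\<bar> \<le> g b - g a"
proof (rule abs_increment_le[OF ab, where f' = f' and g' = g'])
  show "continuous_on {a..b} f" by (intro continuous_at_imp_continuous_on ballI DERIV_isCont[OF f])
  show "continuous_on {a..b} g" by (intro continuous_at_imp_continuous_on ballI DERIV_isCont[OF g])
qed (use f g le in auto)

text \<open>
  Uniqueness away from \<open>y = 0\<close>: \<open>Q = d\<^sup>2 + e\<^sup>2\<close> satisfies \<open>|Q'| \<le> c Q\<close>, so
  \<open>Q exp (- c y)\<close> decreases and \<open>Q exp (c y)\<close> increases.
\<close>

lemma linear_ode_zero_data_imp_zero:
  fixes d e e' :: "real \<Rightarrow> real"
  assumes "0 < \<alpha>" "0 \<le> K"
    and d: "\<And>y. y \<in> {\<alpha>..\<beta>} \<Longrightarrow> (d has_real_derivative e y / y) (at y)"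
    and e: "\<And>y. y \<in> {\<alpha>..\<beta>} \<Longrightarrow> (e has_real_derivative e' y) (at y)"
    and e': "\<And>y. y \<in> {\<alpha>..\<beta>} \<Longrightarrow> \<bar>e' y\<bar> \<le> K * \<bar>d y\<bar>"
    and x: "x \<in> {\<alpha>..\<beta>}" "d x = 0" "e x = 0"
    and y: "y \<in> {\<alpha>..\<beta>}"
  shows "d y = 0 \<and> e y = 0"
proof -
  define c where "c = 1 / \<alpha> + K"
  define Q where "Q s = (d s)\<^sup>2 + (e s)\<^sup>2" for s
  define Q' where "Q' s = 2 * d s * (e s / s) + 2 * e s * e' s" for s
  have Q: "(Q has_real_derivative Q' s) (at s)" if "s \<in> {\<alpha>..\<beta>}" for s
    unfolding Q_def Q'_def by (auto intro!: derivative_eq_intros d e that)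
  have Q': "\<bar>Q' s\<bar> \<le> c * Q s" if s: "s \<in> {\<alpha>..\<beta>}" for s
  proof -
    have "\<bar>e s / s\<bar> \<le> \<bar>e s\<bar> / \<alpha>"
      using s \<open>0 < \<alpha>\<close> by (simp add: abs_div frac_le)
    then have 1: "\<bar>d s\<bar> * \<bar>e s / s\<bar> \<le> \<bar>d s\<bar> * (\<bar>e s\<bar> / \<alpha>)" by (rule mult_left_mono) simp
    have 2: "\<bar>e s\<bar> * \<bar>e' s\<bar> \<le> \<bar>e s\<bar> * (K * \<bar>d s\<bar>)" using e'[OF s] by (rule mult_left_mono) simp
    have "\<bar>Q' s\<bar> \<le> 2 * (\<bar>d s\<bar> * \<bar>e s / s\<bar>) + 2 * (\<bar>e s\<bar> * \<bar>e' s\<bar>)"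
      unfolding Q'_def by (rule order_trans[OF abs_triangle_ineq]) (simp add: abs_mult)
    also have "\<dots> \<le> 2 * (\<bar>d s\<bar> * (\<bar>e s\<bar> / \<alpha>)) + 2 * (\<bar>e s\<bar> * (K * \<bar>d s\<bar>))"
      using 1 2 by linarith
    also have "\<dots> = c * (2 * \<bar>d s\<bar> * \<bar>e s\<bar>)" by (simp add: c_def algebra_simps)
    also have "\<dots> \<le> c * Q s"
      using sum_squares_bound[of "\<bar>d s\<bar>" "\<bar>e s\<bar>"] assms(1,2) unfolding Q_def c_def
      by (intro mult_left_mono) auto
    finally show ?thesis .
  qed
  have Qx: "Q x = 0" using x by (simp add: Q_def)
  have "Q y \<le> 0"
  proof (cases "x \<le> y")
    case True
    have "Q y * exp (- c * y) \<le> Q x * exp (- c * x)"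
    proof (rule DERIV_nonpos_imp_nonincreasing[OF True, where f = "\<lambda>s. Q s * exp (- c * s)"])
      fix s assume "x \<le> s" "s \<le> y"
      then have s: "s \<in> {\<alpha>..\<beta>}" using x y by auto
      have "((\<lambda>s. Q s * exp (- c * s)) has_real_derivative (Q' s - c * Q s) * exp (- c * s)) (at s)"
        by (auto intro!: derivative_eq_intros Q[OF s] simp: algebra_simps)
      moreover have "(Q' s - c * Q s) * exp (- c * s) \<le> 0"
        using Q'[OF s] by (intro mult_nonpos_nonneg) auto
      ultimately show "\<exists>z. ((\<lambda>s. Q s * exp (- c * s)) has_real_derivative z) (at s) \<and> z \<le> 0" by blast
    qed
    then show ?thesis by (simp add: Qx mult_le_0_iff)
  next
    case False
    then have "y \<le> x" by simp
    have "Q y * exp (c * y) \<le> Q x * exp (c * x)"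
    proof (rule DERIV_nonneg_imp_nondecreasing[OF \<open>y \<le> x\<close>, where f = "\<lambda>s. Q s * exp (c * s)"])
      fix s assume "y \<le> s" "s \<le> x"
      then have s: "s \<in> {\<alpha>..\<beta>}" using x y by auto
      have "((\<lambda>s. Q s * exp (c * s)) has_real_derivative (Q' s + c * Q s) * exp (c * s)) (at s)"
        by (auto intro!: derivative_eq_intros Q[OF s] simp: algebra_simps)
      moreover have "(Q' s + c * Q s) * exp (c * s) \<ge> 0"
        using Q'[OF s] by (intro mult_nonneg_nonneg) auto
      ultimately show "\<exists>z. ((\<lambda>s. Q s * exp (c * s)) has_real_derivative z) (at s) \<and> 0 \<le> z" by blast
    qed
    then show ?thesis by (simp add: Qx mult_le_0_iff)
  qed
  then show ?thesis unfolding Q_def by (simp add: sum_power2_le_zero_iff)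
qed

lemma weight_antiderivative:
  assumes "0 < (c::real) + r"
  shows "((\<lambda>r. - 2 * K / sqrt (c + r)) has_real_derivative K / ((c + r) * sqrt (c + r))) (at r)"
proof -
  have s: "0 < sqrt (c + r)" "sqrt (c + r) * sqrt (c + r) = c + r" using assms by auto
  have alg: "- 2 * K * (- (inverse S * (inverse S / 2) * inverse S)) = K / (S * S * S)" for S :: real
    by (simp add: divide_simps)
  have "((\<lambda>r. - 2 * K * inverse (sqrt (c + r))) has_real_derivative
      - 2 * K * (- (inverse (sqrt (c + r)) * (inverse (sqrt (c + r)) / 2) * inverse (sqrt (c + r))))) (at r)"
    using assms s by (auto intro!: derivative_eq_intros)
  then show ?thesis unfolding alg s(2) by (simp only: divide_inverse)
qed

text \<open>
  The weight \<open>K (1 + y)\<^sup>-\<^sup>3\<^sup>/\<^sup>2\<close> is integrable, and its tail \<open>2 K / sqrt y\<close> is still integrable with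
  respect to \<open>dy / y\<close>.  So a source that is at most \<open>M\<close> times the weight changes \<open>p\<close> by \<open>O(M / sqrt a)\<close>
  after time \<open>a\<close>, and then \<open>w\<close> by the same order.
\<close>

lemma double_tail_bound:
  fixes w p p' :: "real \<Rightarrow> real"
  assumes K: "0 \<le> K" and M: "0 \<le> M" and ab: "0 < a" "a \<le> b"
    and w: "\<And>y. y \<in> {a..b} \<Longrightarrow> (w has_real_derivative p y / y) (at y)"
    and p: "\<And>y. y \<in> {a..b} \<Longrightarrow> (p has_real_derivative p' y) (at y)"
    and p': "\<And>y. y \<in> {a..b} \<Longrightarrow> \<bar>p' y\<bar> \<le> M * (K / ((1 + y) * sqrt (1 + y)))"
  shows "\<bar>p b - p a\<bar> \<le> M * (2 * K / sqrt a)"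
    and "\<bar>w b - w a\<bar> \<le> (M * 4 * K + 2 * \<bar>p b\<bar> * sqrt b) * (1 / sqrt a - 1 / sqrt b)"
proof -
  have 1: "\<bar>p b - p r\<bar> \<le> M * (2 * K / sqrt r)" if r: "r \<in> {a..b}" for r
  proof -
    have "\<bar>p b - p r\<bar> \<le> M * (- 2 * K / sqrt (1 + b)) - M * (- 2 * K / sqrt (1 + r))"
    proof (rule abs_increment_le_closed)
      fix x assume "x \<in> {r..b}"
      then have x: "x \<in> {a..b}" "0 < 1 + x" using r ab by auto
      show "(p has_real_derivative p' x) (at x)" by (rule p[OF x(1)])
      show "((\<lambda>b. M * (- 2 * K / sqrt (1 + b))) has_real_derivative M * (K / ((1 + x) * sqrt (1 + x)))) (at x)"
        by (rule DERIV_cmult[OF weight_antiderivative[OF x(2)]])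
      show "\<bar>p' x\<bar> \<le> M * (K / ((1 + x) * sqrt (1 + x)))" by (rule p'[OF x(1)])
    qed (use r in auto)
    also have "\<dots> = M * (2 * K / sqrt (1 + r)) - M * (2 * K / sqrt (1 + b))" by (simp add: algebra_simps)
    also have "\<dots> \<le> M * (2 * K / sqrt (1 + r))" using K M ab by simp
    also have "\<dots> \<le> M * (2 * K / sqrt r)" using K M ab r by (intro mult_left_mono divide_left_mono) auto
    finally show ?thesis .
  qed
  then show "\<bar>p b - p a\<bar> \<le> M * (2 * K / sqrt a)" using ab by auto
  define L where "L = M * 2 * K + \<bar>p b\<bar> * sqrt b"
  have 2: "\<bar>p r / r\<bar> \<le> L / ((0 + r) * sqrt (0 + r))" if r: "r \<in> {a..b}" for r
  proof -
    have "\<bar>p r\<bar> \<le> \<bar>p b\<bar> + M * (2 * K / sqrt r)" using 1[OF r] by linarith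
    also have "\<bar>p b\<bar> \<le> \<bar>p b\<bar> * sqrt b / sqrt r"
    proof -
      have "\<bar>p b\<bar> * sqrt r \<le> \<bar>p b\<bar> * sqrt b" using r by (intro mult_left_mono) auto
      then show ?thesis using r ab by (simp add: field_simps)
    qed
    finally have "\<bar>p r\<bar> \<le> L / sqrt r" by (simp add: L_def add_divide_distrib)
    then have "\<bar>p r\<bar> / r \<le> L / sqrt r / r" using r ab by (intro divide_right_mono) auto
    then show ?thesis using r ab by (simp add: mult.commute)
  qed
  have 3: "\<bar>w b - w a\<bar> \<le> (- 2 * L / sqrt (0 + b)) - (- 2 * L / sqrt (0 + a))"
  proof (rule abs_increment_le_closed[OF ab(2)])
    fix x assume x: "x \<in> {a..b}"
    then have x0: "0 < 0 + x" using ab by auto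
    show "(w has_real_derivative p x / x) (at x)" by (rule w[OF x])
    show "((\<lambda>b. - 2 * L / sqrt (0 + b)) has_real_derivative L / ((0 + x) * sqrt (0 + x))) (at x)"
      by (rule weight_antiderivative[OF x0])
    show "\<bar>p x / x\<bar> \<le> L / ((0 + x) * sqrt (0 + x))" by (rule 2[OF x])
  qed
  show "\<bar>w b - w a\<bar> \<le> (M * 4 * K + 2 * \<bar>p b\<bar> * sqrt b) * (1 / sqrt a - 1 / sqrt b)"
  proof -
    note 3
    also have "(- 2 * L / sqrt (0 + b)) - (- 2 * L / sqrt (0 + a)) = 2 * L * (1 / sqrt a - 1 / sqrt b)"
      by (simp add: right_diff_distrib)
    also have "2 * L = M * 4 * K + 2 * \<bar>p b\<bar> * sqrt b" by (simp add: L_def)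
    finally show ?thesis .
  qed
qed

text \<open>
  Let \<open>\<xi>\<close> be the place between the zeros where \<open>|w|\<close> is largest.  There \<open>p = 0\<close>, so integrating
  twice backwards to \<open>y1\<close> bounds \<open>|w \<xi>|\<close> by itself times the stated quantity.  This is a
  Lyapunov inequality; the variable \<open>1 / sqrt y\<close> makes it uniform up to \<open>y = \<infinity>\<close>.
\<close>

lemma zeros_separated:
  fixes w p p' :: "real \<Rightarrow> real"
  assumes K: "0 < K" and y: "0 < y1" "y1 < y2"
    and w: "\<And>y. y \<in> {y1..y2} \<Longrightarrow> (w has_real_derivative p y / y) (at y)"
    and p: "\<And>y. y \<in> {y1..y2} \<Longrightarrow> (p has_real_derivative p' y) (at y)"
    and p': "\<And>y. y \<in> {y1..y2} \<Longrightarrow> \<bar>p' y\<bar> \<le> K / ((1 + y) * sqrt (1 + y)) * \<bar>w y\<bar>"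
    and zeros: "w y1 = 0" "w y2 = 0"
    and nz: "\<exists>y\<in>{y1..y2}. w y \<noteq> 0"
  shows "1 \<le> 4 * K * (1 / sqrt y1 - 1 / sqrt y2)"
proof -
  have cw: "continuous_on {y1..y2} w"
    by (intro continuous_at_imp_continuous_on ballI DERIV_isCont[OF w])
  obtain \<xi> where xi: "\<xi> \<in> {y1..y2}" "\<And>y. y \<in> {y1..y2} \<Longrightarrow> \<bar>w y\<bar> \<le> \<bar>w \<xi>\<bar>"
    using continuous_attains_sup[OF compact_Icc _ continuous_on_rabs[OF cw]] y
    by (metis atLeastAtMost_iff empty_iff less_imp_le order_refl)
  have M: "0 < \<bar>w \<xi>\<bar>" using nz xi by force
  then have xi': "y1 < \<xi>" "\<xi> < y2" using xi(1) zeros by (auto simp: less_le)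
  have "2 * w \<xi> * (p \<xi> / \<xi>) = 0"
  proof (rule DERIV_local_max[where f = "\<lambda>y. (w y)\<^sup>2"])
    show "((\<lambda>y. (w y)\<^sup>2) has_real_derivative 2 * w \<xi> * (p \<xi> / \<xi>)) (at \<xi>)"
      by (auto intro!: derivative_eq_intros w xi)
    show "0 < min (\<xi> - y1) (y2 - \<xi>)" using xi' by simp
    show "\<forall>y. \<bar>\<xi> - y\<bar> < min (\<xi> - y1) (y2 - \<xi>) \<longrightarrow> (w y)\<^sup>2 \<le> (w \<xi>)\<^sup>2"
      by (intro allI impI) (simp only: abs_le_square_iff[symmetric], rule xi(2), auto)
  qed
  then have pxi: "p \<xi> = 0" using M xi' y by auto
  have "\<bar>w \<xi> - w y1\<bar> \<le> (\<bar>w \<xi>\<bar> * 4 * K + 2 * \<bar>p \<xi>\<bar> * sqrt \<xi>) * (1 / sqrt y1 - 1 / sqrt \<xi>)"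
  proof (rule double_tail_bound[where p' = p'])
    fix y assume y': "y \<in> {y1..\<xi>}"
    then have "\<bar>p' y\<bar> \<le> K / ((1 + y) * sqrt (1 + y)) * \<bar>w y\<bar>" using p' xi' by auto
    also have "\<dots> \<le> K / ((1 + y) * sqrt (1 + y)) * \<bar>w \<xi>\<bar>"
      using y' xi' y K by (intro mult_left_mono xi(2)) auto
    finally show "\<bar>p' y\<bar> \<le> \<bar>w \<xi>\<bar> * (K / ((1 + y) * sqrt (1 + y)))" by (simp add: mult.commute)
  qed (use K y xi' w p in auto)
  then have "\<bar>w \<xi>\<bar> * 1 \<le> \<bar>w \<xi>\<bar> * (4 * K * (1 / sqrt y1 - 1 / sqrt \<xi>))"
    by (simp add: zeros pxi mult.assoc)
  then have "1 \<le> 4 * K * (1 / sqrt y1 - 1 / sqrt \<xi>)" using M by (simp only: mult_le_cancel_left_pos)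
  also have "\<dots> \<le> 4 * K * (1 / sqrt y1 - 1 / sqrt y2)"
    using xi' y K by (intro mult_left_mono diff_left_mono frac_le) auto
  finally show ?thesis .
qed

section \<open>Sturm comparison on the sphere\<close>

text \<open>
  In the polar angle \<open>t\<close> the equation is \<open>W'' + cot t W' + \<Psi> = 0\<close>.  The Liouville
  substitution \<open>B = sqrt (sin t) W\<close> removes the first-order term and adds the potential
  \<open>1/4 + 1/(4 sin\<^sup>2 t)\<close>.  If \<open>\<Psi> \<ge> (\<omega>\<^sup>2 - 1/4) W\<close>, then \<open>B\<close> oscillates faster than
  \<open>sin (\<omega> t)\<close>, so \<open>W\<close> cannot stay positive for a full half-period \<open>\<pi> / \<omega>\<close>.  For
  \<open>\<omega> = k + 1/2\<close> the constant \<open>\<omega>\<^sup>2 - 1/4\<close> is exactly \<open>k (k + 1)\<close>.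
\<close>

lemma sturm_positive_impossible:
  fixes W p \<Psi> :: "real \<Rightarrow> real"
  assumes w: "0 < \<omega>" and t: "0 < t0" "t0 + pi / \<omega> < pi"
    and W: "\<And>t. t \<in> {t0..t0 + pi / \<omega>} \<Longrightarrow> (W has_real_derivative 2 * p t / sin t) (at t)"
    and p: "\<And>t. t \<in> {t0..t0 + pi / \<omega>} \<Longrightarrow> (p has_real_derivative - (\<Psi> t * sin t / 2)) (at t)"
    and pos: "\<And>t. t \<in> {t0..t0 + pi / \<omega>} \<Longrightarrow> 0 < W t"
    and \<Psi>: "\<And>t. t \<in> {t0..t0 + pi / \<omega>} \<Longrightarrow> (\<omega>\<^sup>2 - 1 / 4) * W t \<le> \<Psi> t"
  shows False
proof -
  define t1 where "t1 = t0 + pi / \<omega>"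
  have t01: "t0 < t1" using w by (simp add: t1_def)
  \<comment> \<open>\<open>A\<close> and \<open>A'\<close> are the first two derivatives of \<open>B\<close>; \<open>J\<close> is the Wronskian of \<open>B\<close> and \<open>sin (\<omega> (t - t0))\<close>.\<close>
  define A where "A t = (cos t * W t / 2 + 2 * p t) / sqrt (sin t)" for t
  define B where "B t = sqrt (sin t) * W t" for t
  define A' where "A' t = sqrt (sin t) * (- W t / 2 - \<Psi> t - (cos t)\<^sup>2 * W t / (4 * (sin t)\<^sup>2))" for t
  define J where "J t = A t * sin (\<omega> * (t - t0)) - B t * (\<omega> * cos (\<omega> * (t - t0)))" for t
  have sin: "0 < sin t" if "t \<in> {t0..t1}" for t
    using that t by (intro sin_gt_zero) (auto simp: t1_def)
  have dS: "((\<lambda>t. sqrt (sin t)) has_real_derivative cos t / (2 * sqrt (sin t))) (at t)" if "t \<in> {t0..t1}" for t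
    using sin[OF that] by (auto intro!: derivative_eq_intros simp: field_simps)
  have sq: "sqrt (sin t) * sqrt (sin t) = sin t" if "t \<in> {t0..t1}" for t
    using sin[OF that] by simp
  have dB: "(B has_real_derivative A t) (at t)" if tt: "t \<in> {t0..t1}" for t
  proof -
    have "(B has_real_derivative cos t / (2 * sqrt (sin t)) * W t + 2 * p t / sin t * sqrt (sin t)) (at t)"
      unfolding B_def by (rule DERIV_mult[OF dS[OF tt] W]) (use tt in \<open>auto simp: t1_def\<close>)
    moreover have "2 * p t / sin t * sqrt (sin t) = 2 * p t / sqrt (sin t)"
      using sin[OF tt] by (simp add: real_div_sqrt field_simps)
    ultimately show ?thesis by (simp add: A_def add_divide_distrib)
  qed
  have dA: "(A has_real_derivative A' t) (at t)" if tt: "t \<in> {t0..t1}" for t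
  proof -
    have tt': "t \<in> {t0..t0 + pi / \<omega>}" using tt by (simp add: t1_def)
    define S where "S = sqrt (sin t)"
    have S: "0 < S" "sin t = S * S" using sin[OF tt] sq[OF tt] by (auto simp: S_def)
    define N where "N = cos t * W t / 2 + 2 * p t"
    define N' where "N' = (- sin t * W t + 2 * p t / sin t * cos t) / 2 + 2 * (- (\<Psi> t * sin t / 2))"
    have dN: "((\<lambda>t. cos t * W t / 2 + 2 * p t) has_real_derivative N') (at t)"
      unfolding N'_def
      by (rule DERIV_add[OF DERIV_cdivide[OF DERIV_mult[OF DERIV_cos W[OF tt']]] DERIV_cmult[OF p[OF tt']]])
    have "(A has_real_derivative (N' * S - N * (cos t / (2 * S))) / (S * S)) (at t)"
      unfolding A_def[abs_def] N_def S_def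
      by (rule DERIV_divide[OF dN dS[OF tt]]) (use sin[OF tt] in simp)
    moreover have "(N' * S - N * (cos t / (2 * S))) / (S * S) = A' t"
    proof -
      have alg: "(((- (S * S) * w + 2 * q / (S * S) * c) / 2 + 2 * (- (\<psi> * (S * S) / 2))) * S
          - (c * w / 2 + 2 * q) * (c / (2 * S))) / (S * S) = S * (- w / 2 - \<psi> - c\<^sup>2 * w / (4 * (S * S)\<^sup>2))"
        for w q c \<psi> :: real
        using S(1) by (simp add: field_simps power2_eq_square)
      show ?thesis
        using alg[of "W t" "p t" "cos t" "\<Psi> t"] unfolding A'_def N_def N'_def S(2)
        using S(1) by (simp add: real_sqrt_mult)
    qed
    ultimately show ?thesis by simp
  qed
  have dJ: "(J has_real_derivative sin (\<omega> * (t - t0)) * (A' t + \<omega>\<^sup>2 * B t)) (at t)" if tt: "t \<in> {t0..t1}" for t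
  proof -
    have ds: "((\<lambda>t. sin (\<omega> * (t - t0))) has_real_derivative \<omega> * cos (\<omega> * (t - t0))) (at t)"
      by (auto intro!: derivative_eq_intros)
    have dc: "((\<lambda>t. \<omega> * cos (\<omega> * (t - t0))) has_real_derivative \<omega> * (- (\<omega> * sin (\<omega> * (t - t0))))) (at t)"
      by (auto intro!: derivative_eq_intros)
    have "(J has_real_derivative (A' t * sin (\<omega> * (t - t0)) + \<omega> * cos (\<omega> * (t - t0)) * A t)
        - (A t * (\<omega> * cos (\<omega> * (t - t0))) + \<omega> * (- (\<omega> * sin (\<omega> * (t - t0)))) * B t)) (at t)"
      unfolding J_def[abs_def] by (rule DERIV_diff[OF DERIV_mult[OF dA[OF tt] ds] DERIV_mult[OF dB[OF tt] dc]])
    also have "(A' t * s + \<omega> * c * A t) - (A t * (\<omega> * c) + \<omega> * (- (\<omega> * s)) * B t)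
        = s * (A' t + \<omega>\<^sup>2 * B t)" for s c
      by (simp add: algebra_simps power2_eq_square)
    finally show ?thesis .
  qed
  have "J t1 < J t0"
  proof (rule DERIV_neg_imp_decreasing_open[OF t01])
    show "continuous_on {t0..t1} J"
      by (intro continuous_at_imp_continuous_on ballI DERIV_isCont[OF dJ])
    fix t assume tt: "t0 < t" "t < t1"
    then have tc: "t \<in> {t0..t1}" "t \<in> {t0..t0 + pi / \<omega>}" by (auto simp: t1_def)
    have "0 < \<omega> * (t - t0)" "\<omega> * (t - t0) < pi" using tt w by (auto simp: t1_def field_simps)
    then have 1: "0 < sin (\<omega> * (t - t0))" by (rule sin_gt_zero)
    have "A' t + \<omega>\<^sup>2 * B t = sqrt (sin t) * (\<omega>\<^sup>2 * W t - W t / 2 - \<Psi> t - (cos t)\<^sup>2 * W t / (4 * (sin t)\<^sup>2))"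
      by (simp add: A'_def B_def algebra_simps)
    also have "\<dots> < 0"
    proof (rule mult_pos_neg)
      have "0 \<le> (cos t)\<^sup>2 * W t / (4 * (sin t)\<^sup>2)" using pos[OF tc(2)] by simp
      then show "\<omega>\<^sup>2 * W t - W t / 2 - \<Psi> t - (cos t)\<^sup>2 * W t / (4 * (sin t)\<^sup>2) < 0"
        using \<Psi>[OF tc(2), unfolded left_diff_distrib] pos[OF tc(2)] by linarith
    qed (use sin[OF tc(1)] in simp)
    finally have "sin (\<omega> * (t - t0)) * (A' t + \<omega>\<^sup>2 * B t) < 0" using 1 by (rule mult_pos_neg[rotated])
    then show "\<exists>y. (J has_real_derivative y) (at t) \<and> y < 0" using dJ[OF tc(1)] by blast
  qed
  moreover have "J t0 \<le> 0" using w pos[of t0] sin[of t0] t01 by (simp add: J_def B_def t1_def)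
  moreover have "0 \<le> J t1"
  proof -
    have "\<omega> * (t1 - t0) = pi" using w by (simp add: t1_def)
    then have "J t1 = B t1 * \<omega>" by (simp add: J_def)
    then show ?thesis using w pos[of t1] sin[of t1] t01 by (simp add: B_def t1_def)
  qed
  ultimately show False by simp
qed

section \<open>Crossings of a shooting family\<close>

text \<open>
  The solutions \<open>v a\<close>, indexed by their value \<open>a\<close> at \<open>y = 0\<close>, with \<open>P a = y (v a)'\<close>.
  The decay \<open>(1 + s)\<^sup>-\<^sup>3\<^sup>/\<^sup>2\<close> rather than \<open>(1 + s)\<^sup>-\<^sup>2\<close> leaves room for the slowly growing Lipschitz
  constant of the power nonlinearity along logarithmically growing solutions.
\<close>

locale shooting =
  fixes \<phi> :: "real \<Rightarrow> real \<Rightarrow> real" and K :: real and v P :: "real \<Rightarrow> real \<Rightarrow> real"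
  assumes K: "0 < K"
    and bound: "\<And>s x. 0 \<le> s \<Longrightarrow> \<bar>\<phi> s x\<bar> \<le> K / ((1 + s) * sqrt (1 + s))"
    and lipschitz: "\<And>s x y. 0 \<le> s \<Longrightarrow>
          \<bar>\<phi> s x - \<phi> s y\<bar> \<le> K / ((1 + s) * sqrt (1 + s)) * \<bar>x - y\<bar>"
    and rest_one: "\<And>s. 0 \<le> s \<Longrightarrow> \<phi> s 1 = 0"
    and rest_nonpos: "\<And>s x. 0 \<le> s \<Longrightarrow> x \<le> 0 \<Longrightarrow> \<phi> s x = 0"
    and below_one: "\<And>s x. 0 \<le> s \<Longrightarrow> x \<le> 1 \<Longrightarrow> \<phi> s x \<le> 0"
    and v_cont: "\<And>a. continuous_on {0..} (v a)"
    and P_cont: "\<And>a. continuous_on {0..} (P a)"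
    and v_0: "\<And>a. v a 0 = a"
    and P_0: "\<And>a. P a 0 = 0"
    and v_deriv: "\<And>a y. 0 < y \<Longrightarrow> (v a has_real_derivative P a y / y) (at y)"
    and P_deriv: "\<And>a y. 0 < y \<Longrightarrow> (P a has_real_derivative - \<phi> y (v a y)) (at y)"
    and v_dependence: "\<And>a b y. 0 \<le> y \<Longrightarrow> \<bar>v a y - v b y\<bar> \<le> 2 * \<bar>a - b\<bar> * exp (2 * K * y)"
    and v_rest: "\<And>a y. (\<And>s. 0 \<le> s \<Longrightarrow> \<phi> s a = 0) \<Longrightarrow> 0 \<le> y \<Longrightarrow> v a y = a"
begin

lemma weight_le: "0 \<le> s \<Longrightarrow> K / ((1 + s) * sqrt (1 + s)) \<le> K"
proof -
  assume "0 \<le> s"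
  then have "1 * 1 \<le> (1 + s) * sqrt (1 + s)" by (intro mult_mono) auto
  then show ?thesis using K by (simp add: divide_le_eq mult_le_cancel_left1)
qed

lemma P_increment:
  assumes "0 \<le> r" "r \<le> y"
  shows "\<bar>P a y - P a r\<bar> \<le> 2 * K / sqrt (1 + r) - 2 * K / sqrt (1 + y)"
proof -
  have "\<bar>P a y - P a r\<bar> \<le> (- 2 * K / sqrt (1 + y)) - (- 2 * K / sqrt (1 + r))"
  proof (rule abs_increment_le[OF assms(2), where f' = "\<lambda>y. - \<phi> y (v a y)" and g = "\<lambda>y. - 2 * K / sqrt (1 + y)"
        and g' = "\<lambda>y. K / ((1 + y) * sqrt (1 + y))"])
    show "continuous_on {r..y} (P a)" by (rule continuous_on_subset[OF P_cont]) (use assms in auto)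
    show "continuous_on {r..y} (\<lambda>y. - 2 * K / sqrt (1 + y))"
      using assms by (intro continuous_intros) auto
    fix x assume "r < x" "x < y"
    then show "((\<lambda>y. - 2 * K / sqrt (1 + y)) has_real_derivative K / ((1 + x) * sqrt (1 + x))) (at x)"
      using assms by (intro weight_antiderivative) auto
  qed (use assms P_deriv bound in auto)
  then show ?thesis by simp
qed

lemma P_tail:
  assumes "0 \<le> r" "r \<le> y"
  shows "\<bar>P a y - P a r\<bar> \<le> 2 * K / sqrt (1 + r)"
proof -
  have "0 \<le> 2 * K / sqrt (1 + y)" using K assms by simp
  then show ?thesis using P_increment[OF assms, of a] by linarith
qed

lemma P_dependence:
  assumes "0 \<le> y"
  shows "\<bar>P a y - P b y\<bar> \<le> K * (2 * \<bar>a - b\<bar> * exp (2 * K * y)) * y"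
proof -
  define C where "C = K * (2 * \<bar>a - b\<bar> * exp (2 * K * y))"
  have "\<bar>(P a y - P b y) - (P a 0 - P b 0)\<bar> \<le> C * y - C * 0"
  proof (rule abs_increment_le[OF assms, where f' = "\<lambda>y. - \<phi> y (v a y) - - \<phi> y (v b y)" and g' = "\<lambda>_. C"])
    show "continuous_on {0..y} (\<lambda>y. P a y - P b y)"
      by (intro continuous_intros; rule continuous_on_subset[OF P_cont]) auto
    fix x assume x: "0 < x" "x < y"
    show "((\<lambda>y. P a y - P b y) has_real_derivative - \<phi> x (v a x) - - \<phi> x (v b x)) (at x)"
      by (intro DERIV_diff P_deriv x)
    show "((*) C has_real_derivative C) (at x)" by (auto intro!: derivative_eq_intros)
    have "\<bar>\<phi> x (v a x) - \<phi> x (v b x)\<bar> \<le> K / ((1 + x) * sqrt (1 + x)) * \<bar>v a x - v b x\<bar>"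
      using x by (intro lipschitz) auto
    also have "\<dots> \<le> K * (2 * \<bar>a - b\<bar> * exp (2 * K * x))"
      using x K weight_le[of x] v_dependence[of x a b] by (intro mult_mono) auto
    also have "\<dots> \<le> C" unfolding C_def using x K by (intro mult_left_mono) auto
    finally show "\<bar>- \<phi> x (v a x) - - \<phi> x (v b x)\<bar> \<le> C" by simp
  qed (auto intro: continuous_intros)
  then show ?thesis by (simp add: P_0 C_def)
qed

lemma v_tendsto: "0 \<le> y \<Longrightarrow> ((\<lambda>a. v a y) \<longlongrightarrow> v a0 y) (nhds a0)"
proof -
  assume y: "0 \<le> y"
  have "((\<lambda>a. 2 * \<bar>a - a0\<bar> * exp (2 * K * y)) \<longlongrightarrow> 2 * \<bar>a0 - a0\<bar> * exp (2 * K * y)) (nhds a0)"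
    by (intro tendsto_intros filterlim_ident)
  then have lim: "((\<lambda>a. 2 * \<bar>a - a0\<bar> * exp (2 * K * y)) \<longlongrightarrow> 0) (nhds a0)" by simp
  have "((\<lambda>a. v a y - v a0 y) \<longlongrightarrow> 0) (nhds a0)"
    by (rule Lim_null_comparison[OF always_eventually lim]) (use v_dependence[OF y] in auto)
  then show ?thesis by (rule LIM_zero_cancel)
qed

lemma P_tendsto: "0 \<le> y \<Longrightarrow> ((\<lambda>a. P a y) \<longlongrightarrow> P a0 y) (nhds a0)"
proof -
  assume y: "0 \<le> y"
  have "((\<lambda>a. K * (2 * \<bar>a - a0\<bar> * exp (2 * K * y)) * y) \<longlongrightarrow> K * (2 * \<bar>a0 - a0\<bar> * exp (2 * K * y)) * y) (nhds a0)"
    by (intro tendsto_intros filterlim_ident)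
  then have lim: "((\<lambda>a. K * (2 * \<bar>a - a0\<bar> * exp (2 * K * y)) * y) \<longlongrightarrow> 0) (nhds a0)" by simp
  have "((\<lambda>a. P a y - P a0 y) \<longlongrightarrow> 0) (nhds a0)"
    by (rule Lim_null_comparison[OF always_eventually lim]) (use P_dependence[OF y] in auto)
  then show ?thesis by (rule LIM_zero_cancel)
qed

lemma v_isCont: "0 < y \<Longrightarrow> isCont (v a) y"
  by (rule DERIV_isCont[OF v_deriv])

text \<open>
  A solution that meets the rest point \<open>c\<close> with speed zero equals \<open>c\<close> on \<open>(0, y]\<close> by uniqueness, and
  therefore starts at \<open>c\<close>.
\<close>

lemma rest_data_imp_constant:
  assumes rest: "\<And>s. 0 \<le> s \<Longrightarrow> \<phi> s c = 0" and y: "0 < y" "v a y = c" "P a y = 0"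
  shows "a = c"
proof -
  have eq: "v a x = c" if x: "0 < x" "x \<le> y" for x
  proof -
    have "v a x - c = 0 \<and> P a x = 0"
    proof (rule linear_ode_zero_data_imp_zero[where \<alpha> = x and \<beta> = y and K = K and d = "\<lambda>z. v a z - c" and x = y])
      fix z assume "z \<in> {x..y}"
      then have z: "0 < z" "0 \<le> z" using x by auto
      show "((\<lambda>z. v a z - c) has_real_derivative P a z / z) (at z)"
        using v_deriv[OF z(1), of a] by (auto intro!: derivative_eq_intros)
      show "(P a has_real_derivative - \<phi> z (v a z)) (at z)" by (rule P_deriv[OF z(1)])
      have "\<bar>\<phi> z (v a z) - \<phi> z c\<bar> \<le> K / ((1 + z) * sqrt (1 + z)) * \<bar>v a z - c\<bar>" by (rule lipschitz[OF z(2)])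
      also have "\<dots> \<le> K * \<bar>v a z - c\<bar>" using weight_le[OF z(2)] by (intro mult_right_mono) auto
      finally show "\<bar>- \<phi> z (v a z)\<bar> \<le> K * \<bar>v a z - c\<bar>" using rest[OF z(2)] by simp
    qed (use x y K in auto)
    then show ?thesis by simp
  qed
  have "(v a \<longlongrightarrow> v a 0) (at 0 within {0..})" using v_cont[of a] by (simp add: continuous_on_def)
  then have 1: "(v a \<longlongrightarrow> a) (at_right 0)" by (auto simp: v_0 intro: tendsto_within_subset)
  have "eventually (\<lambda>x. v a x = c) (at_right 0)"
    unfolding eventually_at_right_field using eq y(1) by (intro exI[of _ y]) auto
  then have "(v a \<longlongrightarrow> c) (at_right 0)" by (rule tendsto_eventually)
  with 1 show ?thesis by (rule tendsto_unique[rotated]) simp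
qed

definition crossings :: "real \<Rightarrow> real set" where
  "crossings a = {y. 0 < y \<and> v a y = 1}"

text \<open>
  At least \<open>j\<close> crossings.  The form with a finite subset avoids having to know that
  \<open>crossings a\<close> is finite.
\<close>

definition crosses :: "real \<Rightarrow> nat \<Rightarrow> bool" where
  "crosses a j \<longleftrightarrow> (\<exists>S. S \<subseteq> crossings a \<and> finite S \<and> card S = j)"

lemma crossing_transversal: "a \<noteq> 1 \<Longrightarrow> y \<in> crossings a \<Longrightarrow> P a y \<noteq> 0"
  using rest_data_imp_constant[of 1 y a] rest_one by (auto simp: crossings_def)

lemma crosses_mono: "crosses a j \<Longrightarrow> i \<le> j \<Longrightarrow> crosses a i"
  unfolding crosses_def by (meson finite_subset obtain_subset_with_card_n order_trans)

lemma crossings_separated: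
  assumes a: "a \<noteq> 1" and y: "y1 \<in> crossings a" "y2 \<in> crossings a" "y1 < y2"
  shows "1 \<le> 4 * K * (1 / sqrt y1 - 1 / sqrt y2)"
proof (rule zeros_separated[where w = "\<lambda>y. v a y - 1" and p = "P a" and p' = "\<lambda>y. - \<phi> y (v a y)"])
  have pos: "0 < y1" using y by (simp add: crossings_def)
  show "0 < y1" by fact
  fix y assume "y \<in> {y1..y2}"
  then have z: "0 < y" using pos by auto
  show "((\<lambda>z. v a z - 1) has_real_derivative P a y / y) (at y)"
    using v_deriv[OF z, of a] by (auto intro!: derivative_eq_intros)
  show "(P a has_real_derivative - \<phi> y (v a y)) (at y)" by (rule P_deriv[OF z])
  show "\<bar>- \<phi> y (v a y)\<bar> \<le> K / ((1 + y) * sqrt (1 + y)) * \<bar>v a y - 1\<bar>"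
    using lipschitz[of y "v a y" 1] rest_one[of y] z by simp
next
  have pos: "0 < y1" using y by (simp add: crossings_def)
  define m where "m = (y1 + y2) / 2"
  have m: "y1 < m" "m < y2" "0 < m" using y pos by (auto simp: m_def)
  show "\<exists>y\<in>{y1..y2}. v a y - 1 \<noteq> 0"
  proof (rule ccontr)
    assume "\<not> ?thesis"
    then have 1: "\<And>y. y \<in> {y1..y2} \<Longrightarrow> v a y = 1" by auto
    have "P a m / m = 0"
    proof (rule DERIV_local_const[OF v_deriv[OF m(3)]])
      show "0 < min (m - y1) (y2 - m)" using m by simp
      show "\<forall>y. \<bar>m - y\<bar> < min (m - y1) (y2 - m) \<longrightarrow> v a m = v a y"
      proof (intro allI impI)
        fix y assume "\<bar>m - y\<bar> < min (m - y1) (y2 - m)"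
        then have "y \<in> {y1..y2}" by (auto simp: abs_if split: if_splits)
        then show "v a m = v a y" using 1[of y] 1[of m] m by simp
      qed
    qed
    then show False using crossing_transversal[OF a, of m] m 1[of m] by (auto simp: crossings_def)
  qed
qed (use y K in \<open>auto simp: crossings_def\<close>)

text \<open>
  An interval of length \<open>1 / (4 K)\<close> in the variable \<open>1 / sqrt y\<close>, which is the separation guaranteed by
  \<open>crossings_separated\<close>: no solution other than the constant one has two crossings in one cell.
\<close>

definition cell :: "real \<Rightarrow> real set" where
  "cell z = {y \<in> {0<..}. \<bar>1 / sqrt y - 1 / sqrt z\<bar> < 1 / (8 * K)}"

lemma open_cell: "open (cell z)"
proof -
  have "continuous_on {0<..} (\<lambda>y. \<bar>1 / sqrt y - 1 / sqrt z\<bar>)" by (intro continuous_intros) auto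
  from continuous_on_open_vimage[OF open_greaterThan, THEN iffD1, OF this, rule_format, of "{..< 1 / (8 * K)}"]
  show ?thesis by (simp add: cell_def vimage_def Int_def conj_commute cong: conj_cong)
qed

lemma cell_self: "0 < z \<Longrightarrow> z \<in> cell z"
  using K by (simp add: cell_def)

lemma crossings_cell_unique:
  assumes a: "a \<noteq> 1" and x: "x \<in> crossings a" "y \<in> crossings a" "x \<in> cell z" "y \<in> cell z"
  shows "x = y"
proof -
  have False if "x' \<in> crossings a" "y' \<in> crossings a" "x' \<in> cell z" "y' \<in> cell z" "x' < y'" for x' y'
  proof -
    have "1 / sqrt x' - 1 / sqrt y' < 1 / (4 * K)" using that(3,4) by (simp add: cell_def abs_if split: if_splits)
    then have "4 * K * (1 / sqrt x' - 1 / sqrt y') < 1" using K by (simp add: field_simps)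
    then show False using crossings_separated[OF a that(1,2,5)] by simp
  qed
  then show ?thesis using x by (metis linorder_neqE)
qed

lemma cells_disjoint:
  assumes a: "a \<noteq> 1" and x: "x \<in> crossings a" "y \<in> crossings a" and z: "z \<in> cell x" "z \<in> cell y"
  shows "x = y"
proof -
  have False if "x' \<in> crossings a" "y' \<in> crossings a" "z \<in> cell x'" "z \<in> cell y'" "x' < y'" for x' y'
  proof -
    have "1 / sqrt x' - 1 / sqrt y' < 1 / (4 * K)" using that(3,4) by (simp add: cell_def abs_if split: if_splits)
    then have "4 * K * (1 / sqrt x' - 1 / sqrt y') < 1" using K by (simp add: field_simps)
    then show False using crossings_separated[OF a that(1,2,5)] by simp
  qed
  then show ?thesis using x z by (metis linorder_neqE)
qed

text \<open>
  On the compact set \<open>[0, Y]\<close> minus the cells of the crossings of \<open>v a0\<close>, the distance of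
  \<open>v a0\<close> from \<open>1\<close> has a positive minimum.  So every crossing of a nearby solution up to \<open>Y\<close>
  lies in one of these cells, and no two of them share a cell.
\<close>

lemma crossings_upto_stable:
  assumes a0: "a0 \<noteq> 1" and Y: "0 < Y"
    and few: "\<And>S. S \<subseteq> crossings a0 \<inter> {..Y} \<Longrightarrow> finite S \<Longrightarrow> card S = j \<Longrightarrow> False"
  shows "\<forall>\<^sub>F a in nhds a0. \<forall>S. S \<subseteq> crossings a \<inter> {..Y} \<longrightarrow> finite S \<longrightarrow> card S < j"
proof -
  define Z where "Z = crossings a0 \<inter> {..Y}"
  have finZ: "finite Z" using few infinite_arbitrarily_large[of Z j] unfolding Z_def by blast
  have cardZ: "card Z < j" using few finZ unfolding Z_def
    by (metis linorder_not_less obtain_subset_with_card_n)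
  define C where "C = {0..Y} - (\<Union>z\<in>Z. cell z)"
  have "compact C" unfolding C_def by (intro compact_diff) (auto intro: open_cell)
  have nz: "v a0 y \<noteq> 1" if "y \<in> C" for y
    using that a0 cell_self[of y] by (cases "y = 0") (auto simp: C_def Z_def crossings_def v_0)
  obtain \<eta> where \<eta>: "0 < \<eta>" "\<And>y. y \<in> C \<Longrightarrow> \<eta> \<le> \<bar>v a0 y - 1\<bar>"
  proof (cases "C = {}")
    case False
    have "continuous_on C (\<lambda>y. \<bar>v a0 y - 1\<bar>)"
      by (intro continuous_intros continuous_on_subset[OF v_cont]) (auto simp: C_def)
    from continuous_attains_inf[OF \<open>compact C\<close> False this] obtain x
      where "x \<in> C" "\<And>y. y \<in> C \<Longrightarrow> \<bar>v a0 x - 1\<bar> \<le> \<bar>v a0 y - 1\<bar>" by auto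
    then show ?thesis using nz[of x] by (intro that[of "\<bar>v a0 x - 1\<bar>"]) auto
  qed (use that[of 1] in auto)
  have "((\<lambda>a. 2 * \<bar>a - a0\<bar> * exp (2 * K * Y)) \<longlongrightarrow> 2 * \<bar>a0 - a0\<bar> * exp (2 * K * Y)) (nhds a0)"
    by (intro tendsto_intros filterlim_ident)
  then have "\<forall>\<^sub>F a in nhds a0. 2 * \<bar>a - a0\<bar> * exp (2 * K * Y) < \<eta>"
    using \<eta>(1) by (intro order_tendstoD(2)) auto
  then show ?thesis using t1_space_nhds[OF a0]
  proof eventually_elim
    case (elim a)
    have ex: "\<exists>z\<in>Z. y \<in> cell z" if y: "y \<in> crossings a \<inter> {..Y}" for y
    proof (rule ccontr)
      assume "\<not> ?thesis"
      then have "y \<in> C" using y by (auto simp: C_def crossings_def)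
      then have "\<eta> \<le> \<bar>v a0 y - v a y\<bar>" using \<eta>(2)[of y] y by (simp add: crossings_def)
      also have "\<dots> \<le> 2 * \<bar>a - a0\<bar> * exp (2 * K * y)"
        using v_dependence[of y a a0] y by (simp add: crossings_def abs_minus_commute)
      also have "\<dots> \<le> 2 * \<bar>a - a0\<bar> * exp (2 * K * Y)"
        using y K by (intro mult_left_mono) auto
      finally show False using elim by simp
    qed
    then obtain \<zeta> where z: "\<And>y. y \<in> crossings a \<inter> {..Y} \<Longrightarrow> \<zeta> y \<in> Z \<and> y \<in> cell (\<zeta> y)" by metis
    have "card S < j" if S: "S \<subseteq> crossings a \<inter> {..Y}" for S
    proof -
      have "inj_on \<zeta> S" using z S crossings_cell_unique[OF elim(2)] by (intro inj_onI) (metis IntD1 subsetD)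
      moreover have "\<zeta> ` S \<subseteq> Z" using z S by auto
      ultimately have "card S \<le> card Z" using finZ by (metis card_image card_mono)
      then show ?thesis using cardZ by simp
    qed
    then show ?case by blast
  qed
qed

text \<open>
  Crossings are transversal, so each one persists within its cell, and cells of different crossings
  are disjoint.
\<close>

lemma crosses_open:
  assumes a0: "a0 \<noteq> 1" and "crosses a0 j"
  shows "\<forall>\<^sub>F a in nhds a0. crosses a j"
proof -
  from assms obtain S where S: "S \<subseteq> crossings a0" "finite S" "card S = j" by (auto simp: crosses_def)
  have "\<forall>\<^sub>F a in nhds a0. \<exists>y\<in>cell z. y \<in> crossings a" if z: "z \<in> S" for z
  proof -
    have z0: "z \<in> crossings a0" "0 < z" "v a0 z = 1" using z S by (auto simp: crossings_def)
    obtain e where e: "0 < e" "ball z e \<subseteq> cell z"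
      using open_cell cell_self[OF z0(2)] openE by blast
    have P: "P a0 z / z \<noteq> 0" using crossing_transversal[OF a0 z0(1)] z0 by simp
    obtain l r where lr: "l < z" "z < r" "l \<in> ball z e" "r \<in> ball z e" "(v a0 l - 1) * (v a0 r - 1) < 0"
    proof (cases "0 < P a0 z / z")
      case True
      obtain d where d: "0 < d" "\<And>h. 0 < h \<Longrightarrow> h < d \<Longrightarrow> v a0 z < v a0 (z + h)"
        using DERIV_pos_inc_right[OF v_deriv[OF z0(2)] True] by auto
      obtain d' where d': "0 < d'" "\<And>h. 0 < h \<Longrightarrow> h < d' \<Longrightarrow> v a0 (z - h) < v a0 z"
        using DERIV_pos_inc_left[OF v_deriv[OF z0(2)] True] by auto
      define h where "h = min (min d d') e / 2"
      have h: "0 < h" "h < d" "h < d'" "h < e" using d d' e by (auto simp: h_def)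
      show ?thesis using that[of "z - h" "z + h"] h d(2)[of h] d'(2)[of h] z0
        by (auto simp: dist_real_def mult_less_0_iff)
    next
      case False
      then have neg: "P a0 z / z < 0" using P by linarith
      obtain d where d: "0 < d" "\<And>h. 0 < h \<Longrightarrow> h < d \<Longrightarrow> v a0 z > v a0 (z + h)"
        using DERIV_neg_dec_right[OF v_deriv[OF z0(2)] neg] by auto
      obtain d' where d': "0 < d'" "\<And>h. 0 < h \<Longrightarrow> h < d' \<Longrightarrow> v a0 (z - h) > v a0 z"
        using DERIV_neg_dec_left[OF v_deriv[OF z0(2)] neg] by auto
      define h where "h = min (min d d') e / 2"
      have h: "0 < h" "h < d" "h < d'" "h < e" using d d' e by (auto simp: h_def)
      show ?thesis using that[of "z - h" "z + h"] h d(2)[of h] d'(2)[of h] z0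
        by (auto simp: dist_real_def mult_less_0_iff)
    qed
    have "{l..r} \<subseteq> ball z e" using lr(3,4) by (auto simp: dist_real_def abs_if split: if_splits)
    then have sub: "{l..r} \<subseteq> cell z" using e by auto
    then have l0: "0 < l" using lr by (auto simp: cell_def subset_iff)
    have "((\<lambda>a. (v a l - 1) * (v a r - 1)) \<longlongrightarrow> (v a0 l - 1) * (v a0 r - 1)) (nhds a0)"
      using l0 lr by (intro tendsto_intros v_tendsto) auto
    then have "\<forall>\<^sub>F a in nhds a0. (v a l - 1) * (v a r - 1) < 0"
      using lr(5) by (rule order_tendstoD(2))
    then show ?thesis
    proof eventually_elim
      case (elim a)
      have ct: "\<forall>x. l \<le> x \<and> x \<le> r \<longrightarrow> isCont (v a) x" using l0 by (auto intro!: v_isCont)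
      have "\<exists>x. l \<le> x \<and> x \<le> r \<and> v a x = 1"
      proof (cases "v a l < 1")
        case True
        then show ?thesis using IVT[of "v a" l 1 r] elim ct lr by (auto simp: mult_less_0_iff)
      next
        case False
        then show ?thesis using IVT2[of "v a" r 1 l] elim ct lr by (auto simp: mult_less_0_iff)
      qed
      then obtain x where x: "x \<in> {l..r}" "v a x = 1" by auto
      then have "0 < x" "x \<in> cell z" using sub l0 by auto
      then show ?case using x(2) by (auto simp: crossings_def)
    qed
  qed
  then have "\<forall>\<^sub>F a in nhds a0. \<forall>z\<in>S. \<exists>y\<in>cell z. y \<in> crossings a"
    using S(2) by (simp add: eventually_ball_finite)
  then show ?thesis
  proof eventually_elim
    case (elim a)
    then obtain f where f: "\<And>z. z \<in> S \<Longrightarrow> f z \<in> cell z \<and> f z \<in> crossings a" by metis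
    have "inj_on f S" using f S cells_disjoint[OF a0] by (intro inj_onI) (metis subsetD)
    then show ?case unfolding crosses_def
      using f S by (intro exI[of _ "f ` S"]) (auto simp: card_image)
  qed
qed

text \<open>
  Beyond \<open>Y = 16 K\<^sup>2\<close> the variable \<open>1 / sqrt y\<close> ranges over an interval of length \<open>1 / (4 K)\<close>,
  which has room for one crossing only.  All others are controlled by \<open>crossings_upto_stable\<close>.
\<close>

lemma crosses_jump_le_one:
  assumes a0: "a0 \<noteq> 1" and nc: "\<not> crosses a0 j"
  shows "\<forall>\<^sub>F a in nhds a0. \<not> crosses a (Suc j)"
proof -
  define Y where "Y = 16 * K\<^sup>2"
  have Y: "0 < Y" using K by (simp add: Y_def)
  have "\<forall>\<^sub>F a in nhds a0. \<forall>S. S \<subseteq> crossings a \<inter> {..Y} \<longrightarrow> finite S \<longrightarrow> card S < j"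
    using nc by (intro crossings_upto_stable a0 Y) (auto simp: crosses_def)
  then show ?thesis using t1_space_nhds[OF a0]
  proof eventually_elim
    case (elim a)
    show ?case
    proof
      assume "crosses a (Suc j)"
      then obtain S where S: "S \<subseteq> crossings a" "finite S" "card S = Suc j" by (auto simp: crosses_def)
      have "card (S \<inter> {..Y}) < j"
        by (rule elim(1)[rule_format]) (use S in auto)
      moreover have "card (S \<inter> {..Y}) + card (S - {..Y}) = Suc j"
        using card_Int_Diff[OF S(2), of "{..Y}"] S(3) by simp
      ultimately have "\<not> card (S - {..Y}) \<le> Suc 0" by simp
      then obtain x' y' where "x' \<in> S - {..Y}" "y' \<in> S - {..Y}" "x' \<noteq> y'"
        using card_le_Suc0_iff_eq[of "S - {..Y}"] S(2) by auto
      then obtain x y where xy: "x \<in> S - {..Y}" "y \<in> S - {..Y}" "x < y"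
        by (meson linorder_neqE)
      then have x: "x \<in> crossings a" "y \<in> crossings a" "Y < x" using S by auto
      have "1 \<le> 4 * K * (1 / sqrt x - 1 / sqrt y)" by (rule crossings_separated[OF elim(2) x(1,2) xy(3)])
      also have "\<dots> < 4 * K * (1 / sqrt x)" using K x(3) xy(3) Y by (intro mult_strict_left_mono) auto
      also have "\<dots> \<le> 1"
      proof -
        have "sqrt Y = 4 * K" using K by (simp add: Y_def real_sqrt_mult)
        then have "4 * K \<le> sqrt x" using x(3) by (metis less_imp_le real_sqrt_le_iff)
        then show ?thesis using K x(3) Y by (simp add: divide_le_eq)
      qed
      finally show False by simp
    qed
  qed
qed

text \<open>
  If \<open>P a0\<close> does not tend to zero, then eventually \<open>|P a0|\<close> exceeds a positive constant, and \<open>v a0\<close>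
  grows logarithmically with a sign \<open>\<sigma>\<close>.  At a late time \<open>Y\<close> the solution is beyond \<open>1\<close> on
  the side of \<open>\<sigma>\<close> and moves away faster than the remaining weight can stop it.  This is an open condition on the
  initial value, so nearby solutions have no crossing after \<open>Y\<close> either.
\<close>

lemma crosses_locally_constant:
  assumes a0: "a0 \<noteq> 1" and nc: "\<not> crosses a0 j" and irreg: "\<not> (P a0 \<longlongrightarrow> 0) at_top"
  shows "\<forall>\<^sub>F a in nhds a0. \<not> crosses a j"
proof -
  from irreg obtain \<epsilon> where eps: "0 < \<epsilon>" "\<And>N. \<exists>y\<ge>N. \<epsilon> \<le> \<bar>P a0 y\<bar>"
    unfolding tendsto_iff eventually_at_top_linorder by (auto simp: not_less)
  have "((\<lambda>y. 2 * K / sqrt (1 + y)) \<longlongrightarrow> 0) at_top" by real_asymp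
  then have "\<forall>\<^sub>F y in at_top. 2 * K / sqrt (1 + y) < \<epsilon> / 4" using eps by (intro order_tendstoD(2)) auto
  then obtain N where N: "\<And>y. N \<le> y \<Longrightarrow> 2 * K / sqrt (1 + y) < \<epsilon> / 4" by (auto simp: eventually_at_top_linorder)
  obtain y0 where y0: "max N 1 \<le> y0" "\<epsilon> \<le> \<bar>P a0 y0\<bar>" using eps(2) by blast
  define \<sigma> where "\<sigma> = sgn (P a0 y0)"
  have sg: "\<sigma> = 1 \<or> \<sigma> = -1" "\<bar>\<sigma>\<bar> = 1" using y0 eps by (auto simp: \<sigma>_def sgn_if)
  have Pr: "\<epsilon> / 2 \<le> \<sigma> * P a0 r" if "y0 \<le> r" for r
    using P_tail[of y0 r a0] N[of y0] y0 that eps by (auto simp: \<sigma>_def sgn_if abs_if split: if_splits)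
  have grow: "\<sigma> * (v a0 r - v a0 y0) \<ge> \<epsilon> / 2 * (ln r - ln y0)" if r: "y0 \<le> r" for r
  proof -
    have "\<sigma> * v a0 y0 - \<epsilon> / 2 * ln y0 \<le> \<sigma> * v a0 r - \<epsilon> / 2 * ln r"
    proof (rule DERIV_nonneg_imp_nondecreasing[OF r, where f = "\<lambda>r. \<sigma> * v a0 r - \<epsilon> / 2 * ln r"])
      fix x assume x: "y0 \<le> x" "x \<le> r"
      then have x0: "0 < x" using y0 by auto
      have "((\<lambda>r. \<sigma> * v a0 r - \<epsilon> / 2 * ln r) has_real_derivative \<sigma> * (P a0 x / x) - \<epsilon> / 2 * (1 / x)) (at x)"
        using x0 by (intro DERIV_diff DERIV_cmult v_deriv) (auto intro!: derivative_eq_intros)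
      moreover have "0 \<le> \<sigma> * (P a0 x / x) - \<epsilon> / 2 * (1 / x)"
        using Pr[OF x(1)] x0 by (simp add: field_simps)
      ultimately show "\<exists>z. ((\<lambda>r. \<sigma> * v a0 r - \<epsilon> / 2 * ln r) has_real_derivative z) (at x) \<and> 0 \<le> z" by blast
    qed
    then show ?thesis by (simp add: algebra_simps diff_divide_distrib)
  qed
  have "filterlim (\<lambda>r. \<epsilon> / 2 * (ln r - ln y0)) at_top at_top" using eps(1) by real_asymp
  then have "\<forall>\<^sub>F r in at_top. \<bar>v a0 y0 - 1\<bar> < \<epsilon> / 2 * (ln r - ln y0)" by (simp add: filterlim_at_top_dense)
  then obtain Y where Y: "y0 \<le> Y" "\<bar>v a0 y0 - 1\<bar> < \<epsilon> / 2 * (ln Y - ln y0)"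
    by (metis (mono_tags, lifting) eventually_at_top_linorder linorder_linear)
  have Y0: "0 < Y" using Y y0 by auto
  have far: "0 < \<sigma> * (v a0 Y - 1)"
  proof -
    have "\<bar>v a0 y0 - 1\<bar> < \<sigma> * (v a0 Y - v a0 y0)" using grow[OF Y(1)] Y(2) by linarith
    then show ?thesis using sg(1) by auto
  qed
  have fast: "2 * K / sqrt (1 + Y) < \<sigma> * P a0 Y" using N[of Y] Pr[OF Y(1)] Y y0 eps by auto
  have "\<forall>\<^sub>F a in nhds a0. 0 < \<sigma> * (v a Y - 1)"
    by (rule order_tendstoD(1)[OF _ far]) (use Y0 in \<open>auto intro!: tendsto_intros v_tendsto\<close>)
  moreover have "\<forall>\<^sub>F a in nhds a0. 2 * K / sqrt (1 + Y) < \<sigma> * P a Y"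
    by (rule order_tendstoD(1)[OF _ fast]) (use Y0 in \<open>auto intro!: tendsto_intros P_tendsto\<close>)
  moreover have "\<forall>\<^sub>F a in nhds a0. \<forall>S. S \<subseteq> crossings a \<inter> {..Y} \<longrightarrow> finite S \<longrightarrow> card S < j"
    using nc by (intro crossings_upto_stable a0 Y0) (auto simp: crosses_def)
  ultimately show ?thesis
  proof eventually_elim
    case (elim a)
    have "y \<le> Y" if y: "y \<in> crossings a" for y
    proof (rule ccontr)
      assume "\<not> y \<le> Y"
      then have Yy: "Y \<le> y" by simp
      have "\<sigma> * v a Y \<le> \<sigma> * v a y"
      proof (rule DERIV_nonneg_imp_nondecreasing[OF Yy, where f = "\<lambda>r. \<sigma> * v a r"])
        fix x assume x: "Y \<le> x" "x \<le> y"
        have "0 \<le> \<sigma> * P a x" using P_tail[of Y x a] elim(2) x Y0 sg by auto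
        then have "0 \<le> \<sigma> * (P a x / x)" using x Y0 by (simp add: zero_le_divide_iff)
        moreover have "((\<lambda>r. \<sigma> * v a r) has_real_derivative \<sigma> * (P a x / x)) (at x)"
          by (rule DERIV_cmult[OF v_deriv]) (use x Y0 in auto)
        ultimately show "\<exists>z. ((\<lambda>r. \<sigma> * v a r) has_real_derivative z) (at x) \<and> 0 \<le> z" by blast
      qed
      then show False using elim(1) y by (auto simp: crossings_def algebra_simps)
    qed
    then have "crossings a \<inter> {..Y} = crossings a" by auto
    then show ?case using elim(3) unfolding crosses_def by (metis less_irrefl)
  qed
qed

lemma first_crossing:
  assumes a: "a < 1" and y: "y \<in> crossings a"
  obtains y1 where "y1 \<in> crossings a" "y1 \<le> y" "\<And>x. 0 \<le> x \<Longrightarrow> x < y1 \<Longrightarrow> v a x < 1"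
proof -
  have y0: "0 < y" "v a y = 1" using y by (auto simp: crossings_def)
  define Z where "Z = {x \<in> {0..y}. v a x = 1}"
  have "closed Z" unfolding Z_def
    by (intro continuous_closed_preimage_constant continuous_on_subset[OF v_cont]) auto
  moreover have "bounded Z" by (rule bounded_subset[of "{0..y}"]) (auto simp: Z_def)
  ultimately have "compact Z" by (simp add: compact_eq_bounded_closed)
  moreover have "Z \<noteq> {}" using y0 by (auto simp: Z_def)
  ultimately obtain y1 where y1: "y1 \<in> Z" "\<And>t. t \<in> Z \<Longrightarrow> y1 \<le> t" using compact_attains_inf[of Z] by blast
  have y1': "0 \<le> y1" "y1 \<le> y" "v a y1 = 1" using y1 by (auto simp: Z_def)
  then have pos: "0 < y1" using a v_0[of a] by (cases "y1 = 0") auto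
  show ?thesis
  proof (rule that[of y1])
    show "v a x < 1" if x: "0 \<le> x" "x < y1" for x
    proof (rule ccontr)
      assume "\<not> v a x < 1"
      moreover have "continuous_on {0..x} (v a)" by (rule continuous_on_subset[OF v_cont]) auto
      ultimately obtain t where "0 \<le> t" "t \<le> x" "v a t = 1"
        using IVT'[of "v a" 0 1 x] a x by (auto simp: v_0)
      then show False using y1(2)[of t] x y1' by (auto simp: Z_def)
    qed
  qed (use y1' pos in \<open>auto simp: crossings_def\<close>)
qed

text \<open>
  For small \<open>a\<close> the solution stays near \<open>0\<close> until a late time \<open>Y\<close>.  Before the first crossing
  \<open>y1\<close> the speed \<open>P\<close> increases, so \<open>1/2 < v a y1 - v a 1 \<le> P a y1 ln y1\<close>.  Thus the speed at
  \<open>y1\<close> is at least \<open>1 / (2 ln y1)\<close>, far more than the \<open>2 K / sqrt (1 + y1)\<close> by which it can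
  still change; the solution keeps increasing and never returns.
\<close>

lemma small_data_cross_once:
  obtains a where "0 < a" "a < 1" "\<not> crosses a 2"
proof -
  have "\<forall>\<^sub>F y in at_top. 2 * K / sqrt (1 + y) < 1 / (2 * ln y)" using K by real_asymp
  then obtain N where N: "\<And>y. N \<le> y \<Longrightarrow> 2 * K / sqrt (1 + y) < 1 / (2 * ln y)"
    by (auto simp: eventually_at_top_linorder)
  define Y where "Y = max N 2"
  \<comment> \<open>Compared with \<open>v 0 = 0\<close>, this gives \<open>v a \<le> 1/4\<close> up to \<open>Y\<close>.\<close>
  define a where "a = 1 / (8 * exp (2 * K * Y))"
  have e: "1 \<le> exp (2 * K * Y)" using K by (simp add: Y_def)
  have "1 < 8 * exp (2 * K * Y)" using e by linarith
  then have a: "0 < a" "a < 1" by (auto simp: a_def)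
  have v0: "v 0 y = 0" if "0 \<le> y" for y
    using v_rest[of 0 y] rest_nonpos that by auto
  have small: "v a y < 1/2" if y: "0 \<le> y" "y \<le> Y" for y
  proof -
    have "v a y \<le> 2 * a * exp (2 * K * y)" using v_dependence[OF y(1), of a 0] v0[OF y(1)] a by simp
    also have "\<dots> \<le> 2 * a * exp (2 * K * Y)" using y a K by (intro mult_left_mono) auto
    also have "\<dots> < 1/2" by (simp add: a_def)
    finally show ?thesis .
  qed
  have "\<not> crosses a 2"
  proof
    assume "crosses a 2"
    then obtain S where S: "S \<subseteq> crossings a" "card S = 2" by (auto simp: crosses_def)
    then obtain p q where "p \<in> crossings a" "q \<in> crossings a" "p \<noteq> q"
      by (auto simp: card_2_iff)
    then obtain z y where zy: "z \<in> crossings a" "y \<in> crossings a" "z < y" by (meson linorder_neqE)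
    obtain y1 where y1: "y1 \<in> crossings a" "y1 \<le> z" "\<And>x. 0 \<le> x \<Longrightarrow> x < y1 \<Longrightarrow> v a x < 1"
      by (rule first_crossing[OF a(2) zy(1)]) blast
    have y10: "0 < y1" "v a y1 = 1" using y1 by (auto simp: crossings_def)
    have yY: "Y < y1" using small[of y1] y10 by (cases "y1 \<le> Y") auto
    have Pmono: "P a r \<le> P a s" if r: "0 \<le> r" "r \<le> s" "s \<le> y1" for r s
    proof (rule DERIV_nonneg_imp_increasing_open[OF r(2), where f = "P a"])
      show "continuous_on {r..s} (P a)" by (rule continuous_on_subset[OF P_cont]) (use r in auto)
      fix x assume x: "r < x" "x < s"
      then have "- \<phi> x (v a x) \<ge> 0" using below_one[of x "v a x"] y1(3)[of x] r by simp
      then show "\<exists>y. (P a has_real_derivative y) (at x) \<and> 0 \<le> y" using P_deriv[of x a] x r by auto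
    qed
    have "1 - v a 1 \<le> P a y1 * ln y1"
    proof -
      have "\<bar>v a y1 - v a 1\<bar> \<le> P a y1 * ln y1 - P a y1 * ln 1"
      proof (rule abs_increment_le_closed)
        show "1 \<le> y1" using yY by (simp add: Y_def)
        fix x assume x: "x \<in> {1..y1}"
        then have x0: "0 < x" by auto
        show "(v a has_real_derivative P a x / x) (at x)" by (rule v_deriv[OF x0])
        show "((\<lambda>b. P a y1 * ln b) has_real_derivative P a y1 / x) (at x)"
          using x0 by (auto intro!: derivative_eq_intros simp: field_simps)
        have "0 \<le> P a x" "P a x \<le> P a y1" using Pmono[of 0 x] Pmono[of x y1] x by (auto simp: P_0)
        then show "\<bar>P a x / x\<bar> \<le> P a y1 / x" using x0 by (simp add: divide_right_mono)
      qed
      then show ?thesis using y10 by simp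
    qed
    moreover have "v a 1 < 1/2" using small[of 1] by (simp add: Y_def)
    ultimately have "1/2 < P a y1 * ln y1" by simp
    moreover have ln: "0 < ln y1" using yY by (simp add: Y_def)
    ultimately have "1 / (2 * ln y1) < P a y1" by (simp add: field_simps)
    then have big: "2 * K / sqrt (1 + y1) < P a y1" using N[of y1] yY by (simp add: Y_def)
    have "v a y1 < v a y"
    proof (rule DERIV_pos_imp_increasing[where f = "v a"])
      show "y1 < y" using y1(2) zy by simp
      fix x assume x: "y1 \<le> x" "x \<le> y"
      have "0 < P a x" using P_tail[of y1 x a] big x y10 by simp
      then have "0 < P a x / x" using x y10 by simp
      moreover have "(v a has_real_derivative P a x / x) (at x)" using x y10 by (intro v_deriv) auto
      ultimately show "\<exists>z. (v a has_real_derivative z) (at x) \<and> 0 < z" by blast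
    qed
    then show False using zy y10 by (simp add: crossings_def)
  qed
  then show ?thesis using a that by blast
qed

text \<open>
  Take the supremum \<open>s\<close> of the initial values with fewer than \<open>j\<close> crossings.  By openness
  \<open>s\<close> itself has fewer than \<open>j\<close>, while all values in \<open>(s, 1)\<close> have at least \<open>j\<close>.  Local
  constancy therefore fails at \<open>s\<close>, which forces \<open>P s \<rightarrow> 0\<close>, and since the number jumps by at
  most one, \<open>s\<close> has at least \<open>j - 1\<close> crossings.
\<close>

lemma exists_regular_at_jump:
  assumes near: "\<eta> < 1" "\<And>a. \<eta> < a \<Longrightarrow> a < 1 \<Longrightarrow> crosses a j" and j: "2 \<le> j"
  shows "\<exists>a. 0 < a \<and> a < 1 \<and> (P a \<longlongrightarrow> 0) at_top \<and> crosses a (j - 1) \<and> \<not> crosses a j"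
proof -
  define A where "A = {a. 0 < a \<and> a < 1 \<and> \<not> crosses a j}"
  obtain b where b: "0 < b" "b < 1" "\<not> crosses b 2" by (rule small_data_cross_once)
  then have bA: "b \<in> A" using crosses_mono[of b j 2] j by (auto simp: A_def)
  have up: "a \<le> max \<eta> 0" if "a \<in> A" for a
    using that near(2)[of a] by (cases "\<eta> < a") (auto simp: A_def)
  have bdd: "bdd_above A" using up by (auto simp: bdd_above_def)
  define s where "s = Sup A"
  have s: "b \<le> s" "s \<le> max \<eta> 0" using bA bdd up by (auto simp: s_def intro: cSup_upper cSup_least)
  then have s01: "0 < s" "s < 1" using b near by auto
  have near_s: "\<exists>a\<in>A. s - e < a \<and> a \<le> s" if "0 < e" for e
    using less_cSup_iff[of A "s - e"] bA bdd that by (auto simp: s_def intro: cSup_upper)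
  have above: "crosses a j" if "s < a" "a < 1" for a
  proof (rule ccontr)
    assume "\<not> crosses a j"
    then have "a \<in> A" using that s01 by (auto simp: A_def)
    then show False using bdd that by (auto simp: s_def dest: cSup_upper)
  qed
  have not_ev: "\<not> (\<forall>\<^sub>F a in nhds s. \<not> crosses a j)"
  proof
    assume "\<forall>\<^sub>F a in nhds s. \<not> crosses a j"
    then obtain d where d: "0 < d" "\<And>a. dist a s < d \<Longrightarrow> \<not> crosses a j" by (auto simp: eventually_nhds_metric)
    define a where "a = s + min d (1 - s) / 2"
    have "s < a" "a < 1" "dist a s < d" using d s01 by (auto simp: a_def dist_real_def min_def field_simps)
    then show False using above[of a] d(2)[of a] by blast
  qed
  have sn: "\<not> crosses s j"
  proof
    assume "crosses s j"
    then obtain d where d: "0 < d" "\<And>a. dist a s < d \<Longrightarrow> crosses a j"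
      using crosses_open[of s j] s01 by (auto simp: eventually_nhds_metric)
    obtain a where "a \<in> A" "s - d < a" "a \<le> s" using near_s[OF d(1)] by blast
    then show False using d(2)[of a] d(1) by (auto simp: A_def dist_real_def)
  qed
  have "(P s \<longlongrightarrow> 0) at_top"
    using crosses_locally_constant[of s j] sn s01 not_ev by blast
  moreover have "crosses s (j - 1)"
    using crosses_jump_le_one[of s "j - 1"] s01 not_ev j by auto
  ultimately show ?thesis using s01 sn by blast
qed

section \<open>Regular solutions are positive\<close>

text \<open>
  At a first zero the solution moves strictly downwards.  For nonpositive values there is no force,
  so from then on \<open>P\<close> is a negative constant and cannot tend to zero.
\<close>

lemma regular_imp_pos:
  assumes a: "0 < a" and reg: "(P a \<longlongrightarrow> 0) at_top" and y: "0 \<le> y"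
  shows "0 < v a y"
proof (rule ccontr)
  assume "\<not> 0 < v a y"
  then have vy: "v a y \<le> 0" by simp
  define Z where "Z = {x \<in> {0..y}. v a x = 0}"
  have "closed Z" unfolding Z_def
    by (intro continuous_closed_preimage_constant continuous_on_subset[OF v_cont]) auto
  moreover have "bounded Z" by (rule bounded_subset[of "{0..y}"]) (auto simp: Z_def)
  ultimately have "compact Z" by (simp add: compact_eq_bounded_closed)
  moreover have "Z \<noteq> {}"
  proof -
    have "continuous_on {0..y} (v a)" by (rule continuous_on_subset[OF v_cont]) auto
    then obtain x where "0 \<le> x" "x \<le> y" "v a x = 0"
      using IVT2'[of "v a" y 0 0] a vy y by (auto simp: v_0)
    then show ?thesis by (auto simp: Z_def)
  qed
  ultimately obtain y1 where y1: "y1 \<in> Z" "\<And>t. t \<in> Z \<Longrightarrow> y1 \<le> t" using compact_attains_inf[of Z] by blast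
  have y1': "0 \<le> y1" "y1 \<le> y" "v a y1 = 0" using y1 by (auto simp: Z_def)
  then have pos: "0 < y1" using a v_0[of a] by (cases "y1 = 0") auto
  have before: "0 < v a x" if x: "0 \<le> x" "x < y1" for x
  proof (rule ccontr)
    assume "\<not> 0 < v a x"
    moreover have "continuous_on {0..x} (v a)" by (rule continuous_on_subset[OF v_cont]) auto
    ultimately obtain t where "0 \<le> t" "t \<le> x" "v a t = 0"
      using IVT2'[of "v a" x 0 0] a x by (auto simp: v_0)
    then show False using y1(2)[of t] x y1' by (auto simp: Z_def)
  qed
  have "P a y1 \<noteq> 0"
    using rest_data_imp_constant[of 0 y1 a] rest_nonpos pos y1' a by auto
  moreover have "\<not> 0 < P a y1"
  proof
    assume "0 < P a y1"
    then have "0 < P a y1 / y1" using pos by simp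
    from DERIV_pos_inc_left[OF v_deriv[OF pos] this] obtain d where
      d: "0 < d" "\<And>h. 0 < h \<Longrightarrow> h < d \<Longrightarrow> v a (y1 - h) < v a y1" by auto
    define h where "h = min d y1 / 2"
    have "0 < h" "h < d" "h < y1" using d pos by (auto simp: h_def)
    then show False using d(2)[of h] before[of "y1 - h"] y1' by simp
  qed
  ultimately have neg: "P a y1 < 0" by simp
  \<comment> \<open>The free motion \<open>P a y1 ln (x / y1)\<close> stays nonpositive, so it solves the same equation with the same data at \<open>y1\<close>.\<close>
  have const: "P a z = P a y1" if z: "y1 \<le> z" for z
  proof -
    define l where "l x = P a y1 * ln (x / y1)" for x
    have "v a z - l z = 0 \<and> P a z - P a y1 = 0"
    proof (rule linear_ode_zero_data_imp_zero[where \<alpha> = y1 and \<beta> = z and K = K and x = y1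
        and d = "\<lambda>x. v a x - l x" and e = "\<lambda>x. P a x - P a y1"])
      fix x assume "x \<in> {y1..z}"
      then have x: "0 < x" "y1 \<le> x" using pos by auto
      show "((\<lambda>x. v a x - l x) has_real_derivative (P a x - P a y1) / x) (at x)"
        unfolding l_def using v_deriv[OF x(1), of a] x pos
        by (auto intro!: derivative_eq_intros simp: field_simps)
      show "((\<lambda>x. P a x - P a y1) has_real_derivative - \<phi> x (v a x)) (at x)"
        using P_deriv[OF x(1), of a] by (auto intro!: derivative_eq_intros)
      have "l x \<le> 0" unfolding l_def using neg x pos by (intro mult_nonpos_nonneg) auto
      then have "\<phi> x (l x) = 0" using rest_nonpos x by simp
      then have "\<bar>\<phi> x (v a x)\<bar> \<le> K / ((1 + x) * sqrt (1 + x)) * \<bar>v a x - l x\<bar>"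
        using lipschitz[of x "v a x" "l x"] x by simp
      also have "\<dots> \<le> K * \<bar>v a x - l x\<bar>" using weight_le[of x] x by (intro mult_right_mono) auto
      finally show "\<bar>- \<phi> x (v a x)\<bar> \<le> K * \<bar>v a x - l x\<bar>" by simp
    qed (use pos z K y1' in \<open>auto simp: l_def\<close>)
    then show ?thesis by simp
  qed
  have "(P a \<longlongrightarrow> P a y1) at_top"
    by (rule tendsto_eventually, rule eventually_mono[OF eventually_ge_at_top[of y1]], rule const)
  then have "P a y1 = 0" using tendsto_unique[OF _ _ reg] by simp
  then show False using neg by simp
qed

text \<open>
  If \<open>P a \<rightarrow> 0\<close>, then \<open>|P a|\<close> is bounded by the tail of the weight, which is integrable against
  \<open>dy / y\<close>; so \<open>v a\<close> converges.  If the limit were \<open>0\<close>, the estimate started from a late maximum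
  \<open>\<xi>\<close> of \<open>v a\<close> would give \<open>v a \<xi> \<le> v a \<xi> \<cdot> 4 K / sqrt \<xi> < v a \<xi>\<close>.
\<close>

lemma regular_imp_limit:
  assumes a: "0 < a" and reg: "(P a \<longlongrightarrow> 0) at_top"
  obtains \<beta> where "0 < \<beta>" "(v a \<longlongrightarrow> \<beta>) at_top"
proof -
  have tail: "\<bar>P a r\<bar> \<le> M * (2 * K / sqrt r)"
    if r: "0 < r" and M: "\<And>y. r \<le> y \<Longrightarrow> \<bar>\<phi> y (v a y)\<bar> \<le> M * (K / ((1 + y) * sqrt (1 + y)))" "0 \<le> M" for r M
  proof -
    have "((\<lambda>y. \<bar>P a y - P a r\<bar>) \<longlongrightarrow> \<bar>0 - P a r\<bar>) at_top" by (intro tendsto_intros reg)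
    moreover have "\<forall>\<^sub>F y in at_top. \<bar>P a y - P a r\<bar> \<le> M * (2 * K / sqrt r)"
      using eventually_ge_at_top[of r]
    proof eventually_elim
      case (elim y)
      show ?case
        by (rule double_tail_bound(1)[where w = "v a" and p' = "\<lambda>y. - \<phi> y (v a y)"])
           (use K M r elim in \<open>auto intro: v_deriv P_deriv\<close>)
    qed
    ultimately have "\<bar>0 - P a r\<bar> \<le> M * (2 * K / sqrt r)" by (rule tendsto_upperbound) simp
    then show ?thesis by simp
  qed
  have vinc: "\<bar>v a y - v a r\<bar> \<le> M * (4 * K / sqrt r) - M * (4 * K / sqrt y)"
    if r: "0 < r" "r \<le> y" and M: "\<And>y. r \<le> y \<Longrightarrow> \<bar>\<phi> y (v a y)\<bar> \<le> M * (K / ((1 + y) * sqrt (1 + y)))" "0 \<le> M" for r y M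
  proof -
    have "\<bar>v a y - v a r\<bar> \<le> - 2 * (M * 2 * K) / sqrt (0 + y) - - 2 * (M * 2 * K) / sqrt (0 + r)"
    proof (rule abs_increment_le_closed[OF r(2)])
      fix x assume x: "x \<in> {r..y}"
      then have x0: "0 < x" "0 < 0 + x" using r by auto
      show "(v a has_real_derivative P a x / x) (at x)" by (rule v_deriv[OF x0(1)])
      show "((\<lambda>y. - 2 * (M * 2 * K) / sqrt (0 + y)) has_real_derivative (M * 2 * K) / ((0 + x) * sqrt (0 + x))) (at x)"
        by (rule weight_antiderivative[OF x0(2)])
      have "\<bar>P a x\<bar> \<le> M * (2 * K / sqrt x)" using tail[OF x0(1), of M] M x by auto
      then have "\<bar>P a x\<bar> / x \<le> M * (2 * K / sqrt x) / x" using x0 by (intro divide_right_mono) auto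
      then show "\<bar>P a x / x\<bar> \<le> (M * 2 * K) / ((0 + x) * sqrt (0 + x))" using x0 by (simp add: mult_ac)
    qed
    then show ?thesis by (simp add: mult_ac)
  qed
  have bd: "\<bar>\<phi> y (v a y)\<bar> \<le> 1 * (K / ((1 + y) * sqrt (1 + y)))" if "1 \<le> y" for y
    using bound[of y "v a y"] that by simp
  \<comment> \<open>A correction that vanishes at infinity and makes \<open>v a\<close> monotone.\<close>
  define m where "m y = v a y - 4 * K / sqrt y" for y
  have mono: "m r \<le> m y" if "1 \<le> r" "r \<le> y" for r y
    using vinc[of r y 1] bd that by (simp add: m_def)
  have m_le: "m y \<le> v a 1 + 4 * K" if "1 \<le> y" for y
  proof -
    have "0 \<le> 4 * K / sqrt y" using K that by simp
    then show ?thesis using vinc[of 1 y 1] bd that by (simp add: m_def)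
  qed
  define \<beta> where "\<beta> = Sup (m ` {1..})"
  have bdd: "bdd_above (m ` {1..})" using m_le by (auto simp: bdd_above_def)
  have "(m \<longlongrightarrow> \<beta>) at_top"
  proof (rule order_tendstoI)
    fix c assume "c < \<beta>"
    then obtain r where r: "1 \<le> r" "c < m r" using less_cSup_iff[of "m ` {1..}" c] bdd by (auto simp: \<beta>_def)
    then show "\<forall>\<^sub>F x in at_top. c < m x"
      unfolding eventually_at_top_linorder using mono by (intro exI[of _ r]) (auto intro: less_le_trans)
  next
    fix c assume c: "\<beta> < c"
    have "m x \<le> \<beta>" if "1 \<le> x" for x unfolding \<beta>_def by (rule cSup_upper[OF _ bdd]) (use that in auto)
    then show "\<forall>\<^sub>F x in at_top. m x < c"
      unfolding eventually_at_top_linorder using c by (intro exI[of _ 1]) (auto intro: le_less_trans)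
  qed
  moreover have "((\<lambda>y. 4 * K / sqrt y) \<longlongrightarrow> 0) at_top" by real_asymp
  ultimately have "((\<lambda>y. m y + 4 * K / sqrt y) \<longlongrightarrow> \<beta> + 0) at_top" by (rule tendsto_add)
  then have lim: "(v a \<longlongrightarrow> \<beta>) at_top" by (simp add: m_def)
  have pos: "0 < v a y" if "0 \<le> y" for y using regular_imp_pos[OF a reg that] .
  have "0 \<le> \<beta>"
    by (rule tendsto_lowerbound[OF lim]) (use pos in \<open>auto simp: eventually_at_top_linorder intro!: exI[of _ 0] less_imp_le\<close>)
  moreover have "\<beta> \<noteq> 0"
  proof
    assume "\<beta> = 0"
    then have lim0: "(v a \<longlongrightarrow> 0) at_top" using lim by simp
    \<comment> \<open>From \<open>r\<close> on, \<open>4 K / sqrt \<xi> < 1\<close>.\<close>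
    define r where "r = 16 * K\<^sup>2 + 1"
    have r: "0 < r" using K by (simp add: r_def add_pos_pos)
    have sqr: "4 * K < sqrt r"
      by (rule real_less_rsqrt) (simp add: r_def power_mult_distrib)
    have "\<forall>\<^sub>F y in at_top. v a y < v a r" using lim0 pos[of r] r by (intro order_tendstoD(2)) auto
    then obtain R where R: "\<And>y. R \<le> y \<Longrightarrow> v a y < v a r" by (auto simp: eventually_at_top_linorder)
    have "continuous_on {r..max r R} (v a)" by (rule continuous_on_subset[OF v_cont]) (use r in auto)
    from continuous_attains_sup[OF compact_Icc _ this] obtain \<xi> where
      xi: "\<xi> \<in> {r..max r R}" "\<And>y. y \<in> {r..max r R} \<Longrightarrow> v a y \<le> v a \<xi>" by auto
    have xmax: "v a y \<le> v a \<xi>" if "r \<le> y" for y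
      using xi(2)[of y] xi(2)[of r] R[of y] that by (cases "y \<le> max r R") (auto simp: max_def split: if_splits)
    have xr: "r \<le> \<xi>" using xi by simp
    then have xp: "0 < \<xi>" "0 < v a \<xi>" using r pos[of \<xi>] by auto
    have M: "\<bar>\<phi> y (v a y)\<bar> \<le> v a \<xi> * (K / ((1 + y) * sqrt (1 + y)))" if y: "\<xi> \<le> y" for y
    proof -
      have y0: "0 \<le> y" using y xp by simp
      have "\<bar>\<phi> y (v a y)\<bar> \<le> K / ((1 + y) * sqrt (1 + y)) * \<bar>v a y\<bar>"
        using lipschitz[OF y0, of "v a y" 0] rest_nonpos[OF y0, of 0] by simp
      also have "\<dots> \<le> K / ((1 + y) * sqrt (1 + y)) * v a \<xi>"
        using xmax[of y] y xr pos[OF y0] y0 K by (intro mult_left_mono) auto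
      finally show ?thesis by (simp add: mult.commute)
    qed
    have "((\<lambda>y. \<bar>v a y - v a \<xi>\<bar>) \<longlongrightarrow> \<bar>0 - v a \<xi>\<bar>) at_top" by (intro tendsto_intros lim0)
    moreover have "\<forall>\<^sub>F y in at_top. \<bar>v a y - v a \<xi>\<bar> \<le> v a \<xi> * (4 * K / sqrt \<xi>)"
      using eventually_ge_at_top[of \<xi>]
    proof eventually_elim
      case (elim y)
      have "\<bar>v a y - v a \<xi>\<bar> \<le> v a \<xi> * (4 * K / sqrt \<xi>) - v a \<xi> * (4 * K / sqrt y)"
        by (rule vinc[OF xp(1) elim]) (use M xp in auto)
      moreover have "0 \<le> v a \<xi> * (4 * K / sqrt y)" using xp K elim by simp
      ultimately show ?case by linarith
    qed
    ultimately have "\<bar>0 - v a \<xi>\<bar> \<le> v a \<xi> * (4 * K / sqrt \<xi>)" by (rule tendsto_upperbound) simp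
    then have "v a \<xi> * 1 \<le> v a \<xi> * (4 * K / sqrt \<xi>)" using xp by simp
    then have "1 \<le> 4 * K / sqrt \<xi>" using xp(2) by (simp only: mult_le_cancel_left_pos)
    then have "sqrt \<xi> \<le> 4 * K" using xp by (simp add: le_divide_eq)
    moreover have "sqrt r \<le> sqrt \<xi>" using xr by simp
    ultimately show False using sqr by simp
  qed
  ultimately show ?thesis using that[of \<beta>] lim by simp
qed

section \<open>Solutions starting near one\<close>

text \<open>
  Put \<open>y = tan\<^sup>2 (t / 2)\<close>, where \<open>t \<in> (0, \<pi>)\<close> is the polar angle.  Then \<open>(0, \<pi>)\<close> splits into
  \<open>k\<close> intervals of length \<open>\<pi> / k\<close>, and each contains a closed half-period of the slightly smaller
  length \<open>\<pi> / (k + 1/2)\<close>.  If \<open>a\<close> is close to \<open>1\<close>, then \<open>v a\<close> stays within \<open>\<delta>\<close> of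
  \<open>1\<close> on the compact range of all these half-periods, and
  \<open>sturm_positive_impossible\<close>, applied to \<open>v a - 1\<close> and its negative, gives a crossing in each.
\<close>

lemma near_one_crosses:
  fixes k :: nat
  assumes k: "1 \<le> k" and \<delta>: "0 < \<delta>"
    and spring: "\<And>s x. 0 \<le> s \<Longrightarrow> \<bar>x - 1\<bar> \<le> \<delta> \<Longrightarrow>
          real k * (real k + 1) * (x - 1)\<^sup>2 / (1 + s)\<^sup>2 \<le> \<phi> s x * (x - 1)"
  shows "\<exists>\<eta><1. \<forall>a. \<eta> < a \<longrightarrow> a < 1 \<longrightarrow> crosses a k"
proof -
  define \<omega> where "\<omega> = real k + 1 / 2"
  define L where "L = pi / \<omega>"
  have w: "0 < \<omega>" by (simp add: \<omega>_def add_nonneg_pos)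
  have w2: "\<omega>\<^sup>2 - 1 / 4 = real k * (real k + 1)" by (simp add: \<omega>_def power2_eq_square algebra_simps)
  have k0: "0 < real k" using k by simp
  have L: "0 < L" "L < pi / k"
    using k0 by (auto simp: L_def \<omega>_def intro!: divide_strict_left_mono add_nonneg_pos)
  \<comment> \<open>The \<open>i\<close>-th half-period \<open>[T i, T i + L]\<close> is centred in \<open>[i \<pi> / k, (i + 1) \<pi> / k]\<close>.\<close>
  define T where "T i = (real i + 1 / 2) * (pi / k) - L / 2" for i
  have T: "real i * (pi / k) < T i" "T i + L < (real i + 1) * (pi / k)" for i
  proof -
    define c where "c = pi / k"
    show "real i * (pi / k) < T i" "T i + L < (real i + 1) * (pi / k)"
      using L unfolding T_def c_def[symmetric] by (auto simp: algebra_simps)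
  qed
  have T0: "0 < T i" for i
    by (rule le_less_trans[OF _ T(1)]) simp
  define tm where "tm = T (k - 1) + L"
  have tm: "tm < pi"
  proof -
    have "tm < (real (k - 1) + 1) * (pi / k)" using T(2) by (simp add: tm_def)
    also have "real (k - 1) + 1 = k" using k by simp
    finally show ?thesis using k0 by simp
  qed
  have Ttm: "T i + L \<le> tm" if "i < k" for i
  proof -
    have "real i \<le> real (k - 1)" using that by simp
    then have "(real i + 1 / 2) * (pi / k) \<le> (real (k - 1) + 1 / 2) * (pi / k)" by (intro mult_right_mono) auto
    then show ?thesis by (simp add: tm_def T_def)
  qed
  define y where "y t = (tan (t / 2))\<^sup>2" for t :: real
  have tanpos: "0 < tan (t / 2)" if "0 < t" "t < pi" for t :: real
    using that by (intro tan_gt_zero) auto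
  have ymono: "y s < y t" if "0 < s" "s < t" "t < pi" for s t
    unfolding y_def using that tanpos[of s] by (intro power_strict_mono tan_monotone) auto
  have ypos: "0 < y t" if "0 < t" "t < pi" for t using tanpos[OF that] by (simp add: y_def)
  define Y where "Y = y tm"
  \<comment> \<open>Makes \<open>2 |a - 1| exp (2 K Y)\<close> at most \<open>\<delta>\<close>, which keeps \<open>v a\<close> within \<open>\<delta>\<close> of \<open>v 1 = 1\<close> up to \<open>Y\<close>.\<close>
  define \<eta> where "\<eta> = 1 - \<delta> / (2 * exp (2 * K * Y))"
  have "crosses a k" if a: "\<eta> < a" "a < 1" for a
  proof -
    have close: "\<bar>v a x - 1\<bar> \<le> \<delta>" if x: "0 \<le> x" "x \<le> Y" for x
    proof -
      have "v 1 x = 1" using v_rest[of 1 x] rest_one x by auto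
      then have "\<bar>v a x - 1\<bar> \<le> 2 * \<bar>a - 1\<bar> * exp (2 * K * x)" using v_dependence[OF x(1), of a 1] by simp
      also have "\<dots> \<le> 2 * \<bar>a - 1\<bar> * exp (2 * K * Y)" using x K by (intro mult_left_mono) auto
      also have "\<dots> \<le> 2 * (\<delta> / (2 * exp (2 * K * Y))) * exp (2 * K * Y)"
        using a unfolding \<eta>_def by (intro mult_right_mono) auto
      finally show ?thesis by simp
    qed
    have "\<exists>t\<in>{T i..T i + L}. v a (y t) = 1" if i: "i < k" for i
    proof (rule ccontr)
      assume "\<not> ?thesis"
      then have nz: "v a (y t) \<noteq> 1" if "t \<in> {T i..T i + L}" for t using that by auto
      have rng: "0 < t" "t < pi" "0 < y t" "y t \<le> Y" if "t \<in> {T i..T i + L}" for t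
      proof -
        show t: "0 < t" "t < pi" using that T0[of i] Ttm[OF i] tm by auto
        show "0 < y t" using ypos[OF t] .
        show "y t \<le> Y" using ymono[of t tm] t that Ttm[OF i] tm unfolding Y_def
          by (cases "t = tm") auto
      qed
      define \<tau> where "\<tau> t = tan (t / 2)" for t :: real
      have sin: "sin t = 2 * \<tau> t / (1 + (\<tau> t)\<^sup>2)" if "0 < t" "t < pi" for t
      proof -
        have c: "0 < cos (t / 2)" using that by (intro cos_gt_zero_pi) auto
        have "sin t = 2 * sin (t / 2) * cos (t / 2)" using sin_double[of "t / 2"] by simp
        moreover have "1 + (\<tau> t)\<^sup>2 = 1 / (cos (t / 2))\<^sup>2"
          using tan_sec[of "t / 2"] c by (simp add: \<tau>_def field_simps)
        ultimately show ?thesis using c by (simp add: \<tau>_def tan_def field_simps power2_eq_square)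
      qed
      have dy: "(y has_real_derivative \<tau> t * (1 + (\<tau> t)\<^sup>2)) (at t)" if "0 < t" "t < pi" for t
      proof -
        have c: "cos (t / 2) \<noteq> 0" using cos_gt_zero_pi[of "t / 2"] that by auto
        have "((\<lambda>t. tan (t / 2)) has_real_derivative inverse ((cos (t / 2))\<^sup>2) * (1 / 2)) (at t)"
          using c by (auto intro!: derivative_eq_intros)
        then have "(y has_real_derivative 2 * tan (t / 2) * (inverse ((cos (t / 2))\<^sup>2) * (1 / 2))) (at t)"
          unfolding y_def using c by (auto intro!: derivative_eq_intros)
        moreover have "inverse ((cos (t / 2))\<^sup>2) = 1 + (\<tau> t)\<^sup>2"
          using tan_sec[of "t / 2"] c by (simp add: \<tau>_def power_inverse)
        ultimately show ?thesis by (simp add: \<tau>_def)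
      qed
      have cont: "continuous_on {T i..T i + L} (\<lambda>t. v a (y t))"
        by (intro continuous_at_imp_continuous_on ballI isCont_o2[OF DERIV_isCont[OF dy] v_isCont] rng)
      obtain \<sigma> :: real where \<sigma>: "\<bar>\<sigma>\<bar> = 1" "\<And>t. t \<in> {T i..T i + L} \<Longrightarrow> 0 < \<sigma> * (v a (y t) - 1)"
      proof (cases "v a (y (T i)) < 1")
        case True
        have "v a (y t) < 1" if tt: "t \<in> {T i..T i + L}" for t
        proof (rule ccontr)
          assume not: "\<not> ?thesis"
          have "continuous_on {T i..t} (\<lambda>t. v a (y t))"
            by (rule continuous_on_subset[OF cont]) (use tt in auto)
          with not obtain s where "T i \<le> s" "s \<le> t" "v a (y s) = 1"
            using IVT'[of "\<lambda>t. v a (y t)" "T i" 1 t] True tt by auto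
          then show False using nz[of s] tt by auto
        qed
        then show ?thesis by (intro that[of "-1"]) auto
      next
        case False
        have "1 < v a (y t)" if tt: "t \<in> {T i..T i + L}" for t
        proof (rule ccontr)
          assume not: "\<not> ?thesis"
          have "continuous_on {T i..t} (\<lambda>t. v a (y t))"
            by (rule continuous_on_subset[OF cont]) (use tt in auto)
          with not obtain s where "T i \<le> s" "s \<le> t" "v a (y s) = 1"
            using IVT2'[of "\<lambda>t. v a (y t)" t 1 "T i"] False tt by auto
          then show False using nz[of s] tt by auto
        qed
        then show ?thesis by (intro that[of 1]) auto
      qed
      have \<sigma>2: "\<sigma> * \<sigma> = 1" using \<sigma>(1) by (metis abs_mult_self_eq mult_1)
      show False
      proof (rule sturm_positive_impossible[OF w, where ?t0.0 = "T i" and W = "\<lambda>t. \<sigma> * (v a (y t) - 1)"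
          and p = "\<lambda>t. \<sigma> * P a (y t)" and \<Psi> = "\<lambda>t. \<sigma> * \<phi> (y t) (v a (y t)) * (1 + y t)\<^sup>2"], unfold L_def[symmetric])
        show "0 < T i" "T i + L < pi" using T0 Ttm[OF i] tm by auto
        fix t assume tt: "t \<in> {T i..T i + L}"
        note r = rng[OF tt]
        have \<tau>: "0 < \<tau> t" using tanpos[OF r(1,2)] by (simp add: \<tau>_def)
        have yt: "y t = (\<tau> t)\<^sup>2" by (simp add: y_def \<tau>_def)
        have den: "1 + (\<tau> t)\<^sup>2 \<noteq> 0" by (smt (verit) zero_le_power2)
        have "((\<lambda>t. v a (y t)) has_real_derivative P a (y t) / y t * (\<tau> t * (1 + (\<tau> t)\<^sup>2))) (at t)"
          by (rule DERIV_chain2[OF v_deriv[OF r(3)] dy[OF r(1,2)]])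
        then have "((\<lambda>t. \<sigma> * (v a (y t) - 1)) has_real_derivative \<sigma> * (P a (y t) / y t * (\<tau> t * (1 + (\<tau> t)\<^sup>2)))) (at t)"
          by (auto intro!: derivative_eq_intros)
        also have "\<sigma> * (P a (y t) / y t * (\<tau> t * (1 + (\<tau> t)\<^sup>2))) = 2 * (\<sigma> * P a (y t)) / sin t"
          unfolding sin[OF r(1,2)] yt using \<tau> den by (simp add: field_simps power2_eq_square)
        finally show "((\<lambda>t. \<sigma> * (v a (y t) - 1)) has_real_derivative 2 * (\<sigma> * P a (y t)) / sin t) (at t)" .
        have "((\<lambda>t. P a (y t)) has_real_derivative - \<phi> (y t) (v a (y t)) * (\<tau> t * (1 + (\<tau> t)\<^sup>2))) (at t)"
          by (rule DERIV_chain2[OF P_deriv[OF r(3)] dy[OF r(1,2)]])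
        then have "((\<lambda>t. \<sigma> * P a (y t)) has_real_derivative \<sigma> * (- \<phi> (y t) (v a (y t)) * (\<tau> t * (1 + (\<tau> t)\<^sup>2)))) (at t)"
          by (rule DERIV_cmult)
        also have "\<sigma> * (- \<phi> (y t) (v a (y t)) * (\<tau> t * (1 + (\<tau> t)\<^sup>2))) =
            - (\<sigma> * \<phi> (y t) (v a (y t)) * (1 + y t)\<^sup>2 * sin t / 2)"
          unfolding sin[OF r(1,2)] yt[symmetric] using r(3) by (simp add: field_simps power2_eq_square)
        finally show "((\<lambda>t. \<sigma> * P a (y t)) has_real_derivative
            - (\<sigma> * \<phi> (y t) (v a (y t)) * (1 + y t)\<^sup>2 * sin t / 2)) (at t)" .
        show pos: "0 < \<sigma> * (v a (y t) - 1)" by (rule \<sigma>(2)[OF tt])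
        define w where "w = v a (y t) - 1"
        have "real k * (real k + 1) * w\<^sup>2 / (1 + y t)\<^sup>2 \<le> \<phi> (y t) (v a (y t)) * w"
          unfolding w_def using close[of "y t"] r by (intro spring) auto
        then have "real k * (real k + 1) * w\<^sup>2 \<le> \<phi> (y t) (v a (y t)) * w * (1 + y t)\<^sup>2"
          using r(3) by (simp add: pos_divide_le_eq)
        also have "\<phi> (y t) (v a (y t)) * w * (1 + y t)\<^sup>2 = (\<sigma> * \<sigma>) * (\<phi> (y t) (v a (y t)) * w * (1 + y t)\<^sup>2)"
          using \<sigma>2 by simp
        also have "\<dots> = (\<sigma> * w) * (\<sigma> * \<phi> (y t) (v a (y t)) * (1 + y t)\<^sup>2)" by (simp add: mult_ac)
        also have "real k * (real k + 1) * w\<^sup>2 = (\<sigma> * \<sigma>) * (real k * (real k + 1) * w\<^sup>2)" using \<sigma>2 by simp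
        also have "\<dots> = (\<sigma> * w) * (real k * (real k + 1) * (\<sigma> * w))" by (simp add: power2_eq_square mult_ac)
        finally show "(\<omega>\<^sup>2 - 1 / 4) * (\<sigma> * (v a (y t) - 1)) \<le> \<sigma> * \<phi> (y t) (v a (y t)) * (1 + y t)\<^sup>2"
          unfolding w2 using pos by (simp only: w_def[symmetric] mult_le_cancel_left_pos)
      qed
    qed
    then obtain t where t: "\<And>i. i < k \<Longrightarrow> t i \<in> {T i..T i + L} \<and> v a (y (t i)) = 1" by metis
    have tr: "0 < t i" "t i < pi" if "i < k" for i
      using t[OF that] T0[of i] Ttm[OF that] tm by auto
    have tl: "t i < t j" if "i < j" "j < k" for i j
    proof -
      have "t i \<le> T i + L" "T j \<le> t j" using t[of i] t[of j] that by auto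
      moreover have "(real i + 1) * (pi / k) \<le> real j * (pi / k)" using that by (intro mult_right_mono) auto
      ultimately show ?thesis using T(2)[of i] T(1)[of j] by linarith
    qed
    have "inj_on (\<lambda>i. y (t i)) {..<k}"
    proof (rule linorder_inj_onI)
      fix i j assume "i < j" "i \<in> {..<k}" "j \<in> {..<k}"
      then show "y (t i) \<noteq> y (t j)" using ymono[of "t i" "t j"] tl[of i j] tr by force
    qed auto
    then have "card ((\<lambda>i. y (t i)) ` {..<k}) = k" by (simp add: card_image)
    moreover have "(\<lambda>i. y (t i)) ` {..<k} \<subseteq> crossings a"
      using t tr ypos by (auto simp: crossings_def)
    ultimately show ?thesis unfolding crosses_def by blast
  qed
  moreover have "\<eta> < 1" using \<delta> by (simp add: \<eta>_def)
  ultimately show ?thesis by blast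
qed

end

section \<open>From profiles to functions on the sphere\<close>

text \<open>
  Both limits are l'Hospital quotients.  In the second one the numerator
  \<open>- (s (1 - s) F(V) + (1 - 2 s) Q)\<close> over \<open>(s (1 - s))\<^sup>2\<close> is used: its derivative collapses to
  \<open>Q (2 - F'(V))\<close>, so the quotient of derivatives is controlled by the first limit.
\<close>

lemma pole_limits:
  fixes V Q F F' :: "real \<Rightarrow> real"
  assumes V: "\<And>s. 0 < s \<Longrightarrow> s < 1 \<Longrightarrow> (V has_real_derivative Q s / (s * (1 - s))) (at s)"
    and Q: "\<And>s. 0 < s \<Longrightarrow> s < 1 \<Longrightarrow> (Q has_real_derivative - F (V s)) (at s)"
    and pos: "\<And>s. 0 < s \<Longrightarrow> s < 1 \<Longrightarrow> 0 < V s"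
    and F: "\<And>x. 0 < x \<Longrightarrow> (F has_real_derivative F' x) (at x)"
    and F': "\<And>x. 0 < x \<Longrightarrow> isCont F' x"
    and Q0: "(Q \<longlongrightarrow> 0) (at_right 0)" and V0: "(V \<longlongrightarrow> \<beta>) (at_right 0)" and \<beta>: "0 < \<beta>"
  shows "((\<lambda>s. Q s / (s * (1 - s))) \<longlongrightarrow> - F \<beta>) (at_right 0)"
    and "((\<lambda>s. - (F (V s) + (1 - 2 * s) * (Q s / (s * (1 - s)))) / (s * (1 - s)))
           \<longlongrightarrow> - F \<beta> * (2 - F' \<beta>) / 2) (at_right 0)"
proof -
  have ev: "\<forall>\<^sub>F s in at_right 0. 0 < s \<and> s < (1/2 :: real)"
    unfolding eventually_at_right_field by (intro exI[of _ "1/2"]) auto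
  have FV: "((\<lambda>s. F (V s)) \<longlongrightarrow> F \<beta>) (at_right 0)"
    by (rule isCont_tendsto_compose[OF DERIV_isCont[OF F[OF \<beta>]] V0])
  have F'V: "((\<lambda>s. F' (V s)) \<longlongrightarrow> F' \<beta>) (at_right 0)"
    by (rule isCont_tendsto_compose[OF F'[OF \<beta>] V0])
  show 1: "((\<lambda>s. Q s / (s * (1 - s))) \<longlongrightarrow> - F \<beta>) (at_right 0)"
  proof (rule lhopital_right_0[where f' = "\<lambda>s. - F (V s)" and g' = "\<lambda>s. 1 - 2 * s"])
    show "((\<lambda>s::real. s * (1 - s)) \<longlongrightarrow> 0) (at_right 0)" by (auto intro!: tendsto_eq_intros)
    show "\<forall>\<^sub>F s in at_right (0::real). s * (1 - s) \<noteq> 0" "\<forall>\<^sub>F s in at_right (0::real). 1 - 2 * s \<noteq> 0"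
      using ev by (auto elim!: eventually_mono)
    show "\<forall>\<^sub>F s in at_right 0. (Q has_real_derivative - F (V s)) (at s)"
      using ev by (auto elim!: eventually_mono intro: Q)
    show "\<forall>\<^sub>F s in at_right 0. ((\<lambda>s. s * (1 - s)) has_real_derivative 1 - 2 * s) (at s)"
      by (intro always_eventually allI) (auto intro!: derivative_eq_intros)
    show "((\<lambda>s. - F (V s) / (1 - 2 * s)) \<longlongrightarrow> - F \<beta>) (at_right 0)"
      by (auto intro!: tendsto_eq_intros FV)
  qed (rule Q0)
  have "((\<lambda>s. - (s * (1 - s) * F (V s) + (1 - 2 * s) * Q s) / (s * (1 - s))\<^sup>2)
           \<longlongrightarrow> - F \<beta> * (2 - F' \<beta>) / 2) (at_right 0)"
  proof (rule lhopital_right_0[where f' = "\<lambda>s. Q s * (2 - F' (V s))" and g' = "\<lambda>s. 2 * (s * (1 - s)) * (1 - 2 * s)"])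
    show "((\<lambda>s. - (s * (1 - s) * F (V s) + (1 - 2 * s) * Q s)) \<longlongrightarrow> 0) (at_right 0)"
      by (auto intro!: tendsto_eq_intros FV Q0)
    show "((\<lambda>s::real. (s * (1 - s))\<^sup>2) \<longlongrightarrow> 0) (at_right 0)" by (auto intro!: tendsto_eq_intros)
    show "\<forall>\<^sub>F s in at_right (0::real). (s * (1 - s))\<^sup>2 \<noteq> 0"
        "\<forall>\<^sub>F s in at_right (0::real). 2 * (s * (1 - s)) * (1 - 2 * s) \<noteq> 0"
      using ev by (auto elim!: eventually_mono)
    show "\<forall>\<^sub>F s in at_right 0. ((\<lambda>s. (s * (1 - s))\<^sup>2) has_real_derivative 2 * (s * (1 - s)) * (1 - 2 * s)) (at s)"
      by (intro always_eventually allI) (auto intro!: derivative_eq_intros)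
    show "\<forall>\<^sub>F s in at_right 0. ((\<lambda>s. - (s * (1 - s) * F (V s) + (1 - 2 * s) * Q s)) has_real_derivative
        Q s * (2 - F' (V s))) (at s)"
      using ev
    proof eventually_elim
      case (elim s)
      then have s: "0 < s" "s < 1" by auto
      have dF: "((\<lambda>s. F (V s)) has_real_derivative F' (V s) * (Q s / (s * (1 - s)))) (at s)"
        by (rule DERIV_chain2[OF F[OF pos[OF s]] V[OF s]])
      have d: "((\<lambda>s. s * (1 - s)) has_real_derivative (1 - 2 * s)) (at s)" "((\<lambda>s. 1 - 2 * s) has_real_derivative - 2) (at s)"
        by (auto intro!: derivative_eq_intros)
      have "((\<lambda>s. - (s * (1 - s) * F (V s) + (1 - 2 * s) * Q s)) has_real_derivative
          - (((1 - 2 * s) * F (V s) + F' (V s) * (Q s / (s * (1 - s))) * (s * (1 - s))) + (- 2 * Q s + - F (V s) * (1 - 2 * s)))) (at s)"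
        by (intro DERIV_minus DERIV_add DERIV_mult dF d Q[OF s])
      moreover have "F' (V s) * (Q s / (s * (1 - s))) * (s * (1 - s)) = F' (V s) * Q s" using s by simp
      ultimately show ?case by (simp add: algebra_simps)
    qed
    have "((\<lambda>s. (Q s / (s * (1 - s))) * (2 - F' (V s)) / (2 * (1 - 2 * s))) \<longlongrightarrow> - F \<beta> * (2 - F' \<beta>) / 2) (at_right 0)"
    proof -
      have "((\<lambda>s. (Q s / (s * (1 - s))) * (2 - F' (V s)) / (2 * (1 - 2 * s))) \<longlongrightarrow> - F \<beta> * (2 - F' \<beta>) / (2 * (1 - 2 * 0))) (at_right 0)"
        by (intro tendsto_intros 1 F'V) auto
      then show ?thesis by simp
    qed
    then show "((\<lambda>s. Q s * (2 - F' (V s)) / (2 * (s * (1 - s)) * (1 - 2 * s))) \<longlongrightarrow> - F \<beta> * (2 - F' \<beta>) / 2) (at_right 0)"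
    proof (rule Lim_transform_eventually)
      have "x / m * c / (2 * n) = x * c / (2 * m * n)" for x m c n :: real by simp
      then show "\<forall>\<^sub>F s in at_right 0. (Q s / (s * (1 - s))) * (2 - F' (V s)) / (2 * (1 - 2 * s)) =
          Q s * (2 - F' (V s)) / (2 * (s * (1 - s)) * (1 - 2 * s))"
        by (intro always_eventually allI)
    qed
  qed
  then show "((\<lambda>s. - (F (V s) + (1 - 2 * s) * (Q s / (s * (1 - s)))) / (s * (1 - s)))
           \<longlongrightarrow> - F \<beta> * (2 - F' \<beta>) / 2) (at_right 0)"
  proof (rule Lim_transform_eventually)
    show "\<forall>\<^sub>F s in at_right 0. - (s * (1 - s) * F (V s) + (1 - 2 * s) * Q s) / (s * (1 - s))\<^sup>2 =
        - (F (V s) + (1 - 2 * s) * (Q s / (s * (1 - s)))) / (s * (1 - s))"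
      using ev
    proof eventually_elim
      case (elim s)
      define m where "m = s * (1 - s)"
      have "m \<noteq> 0" using elim by (simp add: m_def)
      then have "- (m * x + y * z) / m\<^sup>2 = - (x + y * (z / m)) / m" for x y z
        by (simp add: field_simps power2_eq_square)
      then show ?case unfolding m_def .
    qed
  qed
qed

lemma filterlim_reflect: "filterlim (\<lambda>s. 1 - s) (at_right 0) (at_left (1::real))"
  by real_asymp

lemma filterlim_reflect': "filterlim (\<lambda>s. 1 - s) (at_left (1::real)) (at_right 0)"
  by real_asymp

text \<open>
  Solving the equation for \<open>V''\<close> on \<open>(0, 1)\<close> and inserting the limits at both ends, where \<open>s = 1\<close> is
  reduced to \<open>s = 0\<close> by the reflection \<open>s \<mapsto> 1 - s\<close>, gives a continuous function on \<open>[0, 1]\<close>.  Extend it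
  by constants to the line and integrate twice: the result is of class C2 beyond both ends and agrees
  with \<open>V\<close> on \<open>(0, 1)\<close>.
\<close>

lemma singular_profile_is_C2:
  fixes V Q F F' :: "real \<Rightarrow> real"
  assumes V: "\<And>s. 0 < s \<Longrightarrow> s < 1 \<Longrightarrow> (V has_real_derivative Q s / (s * (1 - s))) (at s)"
    and Q: "\<And>s. 0 < s \<Longrightarrow> s < 1 \<Longrightarrow> (Q has_real_derivative - F (V s)) (at s)"
    and pos: "\<And>s. 0 < s \<Longrightarrow> s < 1 \<Longrightarrow> 0 < V s"
    and F: "\<And>x. 0 < x \<Longrightarrow> (F has_real_derivative F' x) (at x)"
    and F': "\<And>x. 0 < x \<Longrightarrow> isCont F' x"
    and Q0: "(Q \<longlongrightarrow> 0) (at_right 0)" and V0: "(V \<longlongrightarrow> \<beta>0) (at_right 0)" and b0: "0 < \<beta>0"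
    and Q1: "(Q \<longlongrightarrow> 0) (at_left 1)" and V1: "(V \<longlongrightarrow> \<beta>1) (at_left 1)" and b1: "0 < \<beta>1"
  obtains g g' g'' :: "real \<Rightarrow> real" where
    "\<And>s. - 1 < s \<Longrightarrow> s < 2 \<Longrightarrow> (g has_real_derivative g' s) (at s)"
    "\<And>s. - 1 < s \<Longrightarrow> s < 2 \<Longrightarrow> (g' has_real_derivative g'' s) (at s)"
    "continuous_on UNIV g''" "g 0 = \<beta>0"
    "\<And>s. 0 \<le> s \<Longrightarrow> s \<le> 1 \<Longrightarrow> 0 < g s"
    "\<And>s. 0 \<le> s \<Longrightarrow> s \<le> 1 \<Longrightarrow> s * (1 - s) * g'' s + (1 - 2 * s) * g' s + F (g s) = 0"
proof -
  \<comment> \<open>\<open>D\<close> and \<open>r\<close> are the first two derivatives of \<open>V\<close>, the second one read off from the equation.\<close>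
  define D where "D s = Q s / (s * (1 - s))" for s
  define r where "r s = - (F (V s) + (1 - 2 * s) * D s) / (s * (1 - s))" for s
  have V: "(V has_real_derivative D s) (at s)" if "0 < s" "s < 1" for s
    using V[OF that] by (simp add: D_def)
  have FV: "((\<lambda>s. F (V s)) has_real_derivative F' (V s) * D s) (at s)" if s: "0 < s" "s < 1" for s
    by (rule DERIV_chain2[OF F[OF pos[OF s]] V[OF s]])
  have D: "(D has_real_derivative r s) (at s)" if s: "0 < s" "s < 1" for s
  proof -
    define m where "m = s * (1 - s)"
    have m: "m \<noteq> 0" using s by (simp add: m_def)
    have d: "((\<lambda>s. s * (1 - s)) has_real_derivative (1 - 2 * s)) (at s)"
      by (auto intro!: derivative_eq_intros)
    have "(D has_real_derivative (- F (V s) * (s * (1 - s)) - Q s * (1 - 2 * s)) / ((s * (1 - s)) * (s * (1 - s)))) (at s)"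
      unfolding D_def[abs_def] by (rule DERIV_divide[OF Q[OF s] d]) (use s in auto)
    also have "(- F (V s) * (s * (1 - s)) - Q s * (1 - 2 * s)) / ((s * (1 - s)) * (s * (1 - s))) = r s"
      unfolding r_def D_def m_def[symmetric] using m by (simp add: field_simps)
    finally show ?thesis .
  qed
  obtain l0 where l0: "(r \<longlongrightarrow> l0) (at_right 0)"
    using pole_limits(2)[OF assms(1-8)] unfolding r_def D_def by blast
  obtain l1 where l1: "(r \<longlongrightarrow> l1) (at_left 1)"
  proof -
    have "((\<lambda>s. - (F (V (1 - s)) + (1 - 2 * s) * ((- Q (1 - s)) / (s * (1 - s)))) / (s * (1 - s)))
           \<longlongrightarrow> - F \<beta>1 * (2 - F' \<beta>1) / 2) (at_right 0)"
    proof (rule pole_limits(2)[where V = "\<lambda>s. V (1 - s)" and Q = "\<lambda>s. - Q (1 - s)"])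
      fix s :: real assume s: "0 < s" "s < 1"
      then have s': "0 < 1 - s" "1 - s < 1" by auto
      have d: "((\<lambda>s. 1 - s) has_real_derivative - 1) (at s)" by (auto intro!: derivative_eq_intros)
      show "((\<lambda>s. V (1 - s)) has_real_derivative - Q (1 - s) / (s * (1 - s))) (at s)"
        using DERIV_chain2[OF V[OF s'] d] by (simp add: D_def mult.commute)
      show "((\<lambda>s. - Q (1 - s)) has_real_derivative - F (V (1 - s))) (at s)"
        using DERIV_minus[OF DERIV_chain2[OF Q[OF s'] d]] by simp
      show "0 < V (1 - s)" by (rule pos[OF s'])
    next
      show "((\<lambda>s. - Q (1 - s)) \<longlongrightarrow> 0) (at_right 0)"
        using tendsto_minus[OF filterlim_compose[OF Q1 filterlim_reflect']] by simp
      show "((\<lambda>s. V (1 - s)) \<longlongrightarrow> \<beta>1) (at_right 0)"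
        by (rule filterlim_compose[OF V1 filterlim_reflect'])
    qed (use F F' b1 in auto)
    from filterlim_compose[OF this filterlim_reflect]
    have "((\<lambda>s. - (F (V s) + (1 - 2 * (1 - s)) * ((- Q s) / ((1 - s) * s))) / ((1 - s) * s))
        \<longlongrightarrow> - F \<beta>1 * (2 - F' \<beta>1) / 2) (at_left 1)" by simp
    moreover have "- (F (V s) + (1 - 2 * (1 - s)) * ((- Q s) / ((1 - s) * s))) / ((1 - s) * s) = r s" for s
    proof -
      have "1 - 2 * (1 - s) = - (1 - 2 * s)" by simp
      then show ?thesis by (simp only: r_def D_def mult.commute[of "1 - s" s] minus_mult_minus minus_divide_left[symmetric])
    qed
    ultimately show ?thesis using that by simp
  qed
  define R where "R s = (if s = 0 then l0 else if s = 1 then l1 else r s)" for s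
  have cR: "continuous_on {0..1} R"
  proof (rule continuous_on_IccI)
    show "(R \<longlongrightarrow> R 0) (at_right 0)"
      unfolding R_def using l0
      by (auto elim!: Lim_transform_eventually simp: eventually_at_right_field intro!: exI[of _ 1])
    show "(R \<longlongrightarrow> R 1) (at_left 1)"
      unfolding R_def using l1
      by (auto elim!: Lim_transform_eventually simp: eventually_at_left_field intro!: exI[of _ 0])
    fix s :: real assume s: "0 < s" "s < 1"
    have "isCont r s"
      unfolding r_def using s
      by (intro continuous_intros DERIV_isCont[OF FV[OF s]] DERIV_isCont[OF D[OF s]]) auto
    then have "(r \<longlongrightarrow> r s) (at s)" by (simp add: isCont_def)
    moreover have "\<forall>\<^sub>F x in at s. x \<in> {0<..<1}" using s by (intro eventually_at_in_open') auto
    ultimately have "(R \<longlongrightarrow> r s) (at s)"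
      by (auto elim!: Lim_transform_eventually eventually_mono simp: R_def)
    then show "(R \<longlongrightarrow> R s) (at s)" using s by (simp add: R_def)
  qed simp
  define g'' where "g'' s = R (max 0 (min 1 s))" for s
  have cg'': "continuous_on UNIV g''"
    unfolding g''_def by (rule continuous_on_compose2[OF cR]) (auto intro!: continuous_intros)
  have antideriv: "((\<lambda>s. integral {-1..s} h) has_real_derivative h s) (at s)"
    if "continuous_on {-1..2} h" "- 1 < s" "s < 2" for h :: "real \<Rightarrow> real" and s
  proof -
    have "((\<lambda>s. integral {-1..s} h) has_real_derivative h s) (at s within {-1..2})"
      by (rule integral_has_real_derivative) (use that in auto)
    moreover have "at s within {-1..2} = at s" using that by (intro at_within_interior) auto
    ultimately show ?thesis by simp
  qed
  define g' where "g' s = D (1/2) + (integral {-1..s} g'' - integral {-1..1/2} g'')" for s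
  have g': "(g' has_real_derivative g'' s) (at s)" if "- 1 < s" "s < 2" for s
  proof -
    have "continuous_on {-1..2} g''" by (rule continuous_on_subset[OF cg'']) auto
    from antideriv[OF this that] show ?thesis unfolding g'_def[abs_def] by (auto intro!: derivative_eq_intros)
  qed
  have cg': "continuous_on {-1..2} g'"
    unfolding g'_def
    by (intro continuous_intros indefinite_integral_continuous_1 integrable_continuous_real continuous_on_subset[OF cg'']) auto
  define g where "g s = V (1/2) + (integral {-1..s} g' - integral {-1..1/2} g')" for s
  have g: "(g has_real_derivative g' s) (at s)" if "- 1 < s" "s < 2" for s
    using antideriv[OF cg' that] unfolding g_def[abs_def] by (auto intro!: derivative_eq_intros)
  have same: "f s = h s"
    if fh: "\<And>s. 0 < s \<Longrightarrow> s < 1 \<Longrightarrow> (f has_real_derivative e s) (at s)"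
       "\<And>s. 0 < s \<Longrightarrow> s < 1 \<Longrightarrow> (h has_real_derivative e s) (at s)" "f (1/2) = h (1/2)"
      and s: "0 < s" "s < 1" for f h e :: "real \<Rightarrow> real" and s
  proof -
    have "\<exists>c. \<forall>x\<in>{0<..<1}. f x - h x = c"
    proof (rule has_field_derivative_zero_constant)
      fix x :: real assume "x \<in> {0<..<1}"
      then have x: "0 < x" "x < 1" by auto
      show "((\<lambda>x. f x - h x) has_field_derivative 0) (at x within {0<..<1})"
        using DERIV_diff[OF fh(1)[OF x] fh(2)[OF x]] by (simp add: has_field_derivative_at_within)
    qed simp
    then obtain c where c: "\<And>x. x \<in> {0<..<1} \<Longrightarrow> f x - h x = c" by blast
    then have "f (1/2) - h (1/2) = c" by (intro c) auto
    then show ?thesis using c[of s] s fh(3) by simp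
  qed
  have g''r: "g'' s = r s" if "0 < s" "s < 1" for s
    using that by (simp add: g''_def R_def)
  have g'D: "g' s = D s" if s: "0 < s" "s < 1" for s
  proof (rule same[OF _ _ _ s])
    show "(g' has_real_derivative r s) (at s)" if "0 < s" "s < 1" for s using g'[of s] g''r[OF that] that by simp
  qed (use D in \<open>auto simp: g'_def\<close>)
  have gV: "g s = V s" if s: "0 < s" "s < 1" for s
  proof (rule same[OF _ _ _ s])
    show "(g has_real_derivative D s) (at s)" if "0 < s" "s < 1" for s using g[of s] g'D[OF that] that by simp
  qed (use V in \<open>auto simp: g_def\<close>)
  have g0: "g 0 = \<beta>0"
  proof (rule tendsto_unique[of "at_right 0" g])
    show "(g \<longlongrightarrow> g 0) (at_right 0)" using DERIV_isCont[OF g[of 0]] by (auto simp: isCont_def intro: tendsto_within_subset)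
    show "(g \<longlongrightarrow> \<beta>0) (at_right 0)"
      using V0 by (rule Lim_transform_eventually) (use gV in \<open>auto simp: eventually_at_right_field intro!: exI[of _ 1]\<close>)
  qed simp
  have g1: "g 1 = \<beta>1"
  proof (rule tendsto_unique[of "at_left 1" g])
    show "(g \<longlongrightarrow> g 1) (at_left 1)" using DERIV_isCont[OF g[of 1]] by (auto simp: isCont_def intro: tendsto_within_subset)
    show "(g \<longlongrightarrow> \<beta>1) (at_left 1)"
      using V1 by (rule Lim_transform_eventually) (use gV in \<open>auto simp: eventually_at_left_field intro!: exI[of _ 0]\<close>)
  qed simp
  have gpos: "0 < g s" if "0 \<le> s" "s \<le> 1" for s
    using that pos[of s] gV[of s] g0 g1 b0 b1 by (cases "s = 0"; cases "s = 1") auto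
  have ode: "s * (1 - s) * g'' s + (1 - 2 * s) * g' s + F (g s) = 0" if s: "s \<in> {0..1}" for s
  proof -
    have "continuous_on {0..1} (\<lambda>s. F (g s))"
      by (intro continuous_at_imp_continuous_on ballI isCont_o2[OF DERIV_isCont[OF g] DERIV_isCont[OF F]] gpos) auto
    moreover have "continuous_on {0..1} g'" by (rule continuous_on_subset[OF cg']) auto
    moreover have "continuous_on {0..1} g''" by (rule continuous_on_subset[OF cg'']) auto
    ultimately have c: "continuous_on (closure {0<..<1}) (\<lambda>s. s * (1 - s) * g'' s + (1 - 2 * s) * g' s + F (g s))"
      by (auto intro!: continuous_intros)
    show ?thesis
    proof (rule continuous_constant_on_closure[OF c])
      fix x :: real assume "x \<in> {0<..<1}"
      then have x: "0 < x" "x < 1" by auto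
      then show "x * (1 - x) * g'' x + (1 - 2 * x) * g' x + F (g x) = 0"
        using g''r[OF x] g'D[OF x] gV[OF x] by (simp add: r_def)
    qed (use s in simp)
  qed
  show ?thesis by (rule that[OF g g' cg'' g0 gpos]) (use ode in auto)
qed

lemma latitude_range:
  fixes z :: "complex \<times> complex"
  assumes "z \<in> sphere 0 1"
  shows "0 \<le> snd z \<bullet> snd z" "snd z \<bullet> snd z \<le> 1"
proof -
  have "fst z \<bullet> fst z + snd z \<bullet> snd z = 1"
    using assms by (metis inner_prod_def dot_square_norm dist_0_norm mem_sphere one_power2)
  moreover have "0 \<le> fst z \<bullet> fst z" by (rule inner_ge_zero)
  ultimately show "snd z \<bullet> snd z \<le> 1" by linarith
qed (rule inner_ge_zero)

text \<open>
  The bilinear form \<open>(h, k) \<mapsto> h2 \<bullet> k2\<close> as a bounded linear map into the dual.  All derivatives of a function of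
  \<open>|z2|\<^sup>2\<close> are built from it.
\<close>

definition second_factor_form :: "(complex \<times> complex) \<Rightarrow>\<^sub>L (complex \<times> complex) \<Rightarrow>\<^sub>L real" where
  "second_factor_form = Blinfun (\<lambda>h. blinfun_inner_right (0, snd h))"

lemma second_factor_form_apply: "second_factor_form h k = snd h \<bullet> snd k"
proof -
  have "bounded_linear (\<lambda>h::complex \<times> complex. blinfun_inner_right ((0, snd h)::complex \<times> complex))"
    by (intro bounded_linear_compose[OF bounded_linear_blinfun_inner_right] bounded_linear_Pair
        bounded_linear_zero bounded_linear_snd)
  then show ?thesis
    by (simp add: second_factor_form_def bounded_linear_Blinfun_apply inner_prod_def)
qed

text \<open>
  The function \<open>g(|z2|\<^sup>2)\<close> is its own extension to a neighbourhood of the sphere; its ambient Hessian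
  \<open>H h = (0, 2 g' h2 + 4 g'' (z2 \<bullet> h2) z2)\<close> is traced over the tangent space.
\<close>

lemma sphere_laplacian_profile:
  fixes g g' g'' :: "real \<Rightarrow> real" and x :: "complex \<times> complex"
  assumes g: "\<And>s. - 1 < s \<Longrightarrow> s < 2 \<Longrightarrow> (g has_real_derivative g' s) (at s)"
    and g': "\<And>s. - 1 < s \<Longrightarrow> s < 2 \<Longrightarrow> (g' has_real_derivative g'' s) (at s)"
    and x: "norm x = 1"
  defines "s \<equiv> snd x \<bullet> snd x"
  shows "sphere_laplacian (\<lambda>z. g (snd z \<bullet> snd z)) x = 4 * (s * (1 - s) * g'' s + (1 - 2 * s) * g' s)"
proof -
  define W where "W = {z :: complex \<times> complex. snd z \<bullet> snd z < 2}"
  have W: "open W" unfolding W_def by (intro open_Collect_less continuous_intros)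
  have rng: "- 1 < snd z \<bullet> snd z" for z :: "complex \<times> complex"
    by (rule less_le_trans[of _ 0]) auto
  have sub: "sphere 0 1 \<subseteq> W"
    using latitude_range by (force simp: W_def)
  define G where "G z = (0 :: complex, (2 * g' (snd z \<bullet> snd z)) *\<^sub>R snd z)" for z :: "complex \<times> complex"
  define H where "H h = (0 :: complex, (2 * g' s) *\<^sub>R snd h + (4 * g'' s * (snd x \<bullet> snd h)) *\<^sub>R snd x)"
    for h :: "complex \<times> complex"
  have dr: "((\<lambda>z. snd z \<bullet> snd z) has_derivative (\<lambda>h. 2 * (snd y \<bullet> snd h))) (at y)" for y :: "complex \<times> complex"
    by (auto intro!: derivative_eq_intros simp: inner_commute)
  have dg: "((\<lambda>z. g (snd z \<bullet> snd z)) has_derivative (\<lambda>h. G y \<bullet> h)) (at y)" if "y \<in> W" for y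
    using has_derivative_compose[OF dr g[OF rng, unfolded has_field_derivative_def]] that
    by (simp add: W_def G_def inner_prod_def mult.left_commute mult.assoc)
  have xW: "x \<in> W" using sub x by auto
  have dG: "(G has_derivative H) (at x)"
  proof -
    have s2: "s < 2" using xW by (simp add: W_def s_def)
    have "((\<lambda>z. g' (snd z \<bullet> snd z)) has_derivative (\<lambda>h. g'' s * (2 * (snd x \<bullet> snd h)))) (at x)"
      using has_derivative_compose[OF dr g'[OF rng s2[unfolded s_def], unfolded has_field_derivative_def]]
      by (simp add: s_def)
    then show ?thesis
      unfolding G_def[abs_def] H_def[abs_def]
      by (auto intro!: derivative_eq_intros simp: s_def algebra_simps)
  qed
  have eq: "sphere_laplacian (\<lambda>z. g (snd z \<bullet> snd z)) x =
      (\<Sum>b\<in>Basis. H (tangent_proj x b) \<bullet> tangent_proj x b) - (real DIM(complex \<times> complex) - 1) * (G x \<bullet> x)"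
    by (rule sphere_laplacian_eq[OF x W sub _ dg dG]) auto
  obtain a b c d where abcd: "x = (Complex a b, Complex c d)" by (metis complex_surj surj_pair)
  have s: "s = c * c + d * d" by (simp add: s_def abcd inner_complex_def)
  have unit: "a * a + b * b + (c * c + d * d) = 1"
    using x by (simp add: abcd norm_eq_1 inner_prod_def inner_complex_def)
  have "(\<Sum>b\<in>Basis. H (tangent_proj x b) \<bullet> tangent_proj x b)
      = 2 * g' s * (2 - s) + 4 * g'' s * (s * (1 - s))"
  proof -
    define \<alpha> \<beta> where "\<alpha> = 2 * g' s" and "\<beta> = 4 * g'' s"
    have Hb: "H (p, q) \<bullet> (p', q') = \<alpha> * (q \<bullet> q') + \<beta> * (snd x \<bullet> q) * (snd x \<bullet> q')" for p q p' q'
      by (simp add: H_def inner_prod_def inner_add_left \<alpha>_def \<beta>_def)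
    have bas: "(Basis :: (complex \<times> complex) set) = {(1, 0), (\<i>, 0), (0, 1), (0, \<i>)}"
      by (auto simp: Basis_prod_def Basis_complex_def)
    have "(\<Sum>b\<in>Basis. H (tangent_proj x b) \<bullet> tangent_proj x b) =
        (\<alpha> * (a * a * s) + \<beta> * (a * s) * (a * s)) + (\<alpha> * (b * b * s) + \<beta> * (b * s) * (b * s))
      + (\<alpha> * (1 - 2 * c * c + c * c * s) + \<beta> * (c - c * s) * (c - c * s))
      + (\<alpha> * (1 - 2 * d * d + d * d * s) + \<beta> * (d - d * s) * (d - d * s))"
      unfolding bas by (simp add: tangent_proj_def abcd Hb inner_complex_def s algebra_simps)
    also have "\<dots> = \<alpha> * (2 - 2 * (c * c + d * d) + (a * a + b * b + (c * c + d * d)) * s)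
      + \<beta> * ((a * a + b * b) * s * s + (c * c + d * d) * (1 - s) * (1 - s))"
      by (simp add: algebra_simps)
    also have "\<dots> = \<alpha> * (2 - s) + \<beta> * ((1 - s) * s * s + s * (1 - s) * (1 - s))"
      using unit by (simp add: s[symmetric] eq_diff_eq[symmetric])
    finally show ?thesis by (simp add: \<alpha>_def \<beta>_def algebra_simps)
  qed
  moreover have "G x \<bullet> x = 2 * g' s * s" by (simp add: G_def inner_prod_def s_def)
  ultimately show ?thesis unfolding eq by (simp add: algebra_simps)
qed

lemma C2_on_sphere_profile:
  fixes g g' g'' :: "real \<Rightarrow> real"
  assumes g: "\<And>s. - 1 < s \<Longrightarrow> s < 2 \<Longrightarrow> (g has_real_derivative g' s) (at s)"
    and g': "\<And>s. - 1 < s \<Longrightarrow> s < 2 \<Longrightarrow> (g' has_real_derivative g'' s) (at s)"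
    and g'': "continuous_on UNIV g''"
  shows "C2_on_sphere (\<lambda>z :: complex \<times> complex. g (snd z \<bullet> snd z))"
proof -
  let ?\<rho> = "\<lambda>z :: complex \<times> complex. snd z \<bullet> snd z"
  define W where "W = {z. ?\<rho> z < 2}"
  have W: "open W" unfolding W_def by (intro open_Collect_less continuous_intros)
  have rng: "- 1 < ?\<rho> z" for z
    by (rule less_le_trans[of _ 0]) auto
  have sub: "sphere 0 1 \<subseteq> W"
    using latitude_range by (force simp: W_def)
  have dr: "(?\<rho> has_derivative (\<lambda>h. 2 * (snd y \<bullet> snd h))) (at y)" for y
    by (auto intro!: derivative_eq_intros simp: inner_commute)
  let ?C = second_factor_form
  define f' where "f' z = (2 * g' (?\<rho> z)) *\<^sub>R ?C z" for z
  define f'' where "f'' z = (4 * g'' (?\<rho> z)) *\<^sub>R (blinfun_scaleR_left (?C z) o\<^sub>L ?C z) + (2 * g' (?\<rho> z)) *\<^sub>R ?C" for z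
  have "C2_on_open (\<lambda>z. g (?\<rho> z)) W"
    unfolding C2_on_open_def
  proof (intro conjI exI[of _ f'] exI[of _ f''] ballI W)
    fix z assume z: "z \<in> W"
    then have z2: "?\<rho> z < 2" by (simp add: W_def)
    show "((\<lambda>z. g (?\<rho> z)) has_derivative blinfun_apply (f' z)) (at z)"
      using has_derivative_compose[OF dr g[OF rng z2, unfolded has_field_derivative_def]]
      by (rule has_derivative_eq_rhs) (auto simp: f'_def fun_eq_iff scaleR_blinfun.rep_eq second_factor_form_apply)
    have "((\<lambda>z. g' (?\<rho> z)) has_derivative (\<lambda>h. g'' (?\<rho> z) * (2 * (snd z \<bullet> snd h)))) (at z)"
      using has_derivative_compose[OF dr g'[OF rng z2, unfolded has_field_derivative_def]] by simp
    then show "(f' has_derivative blinfun_apply (f'' z)) (at z)"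
      unfolding f'_def[abs_def]
      by (auto intro!: derivative_eq_intros bounded_linear_imp_has_derivative blinfun.bounded_linear_right
          simp: f''_def fun_eq_iff blinfun.bilinear_simps second_factor_form_apply)
  next
    have cg': "continuous_on {-1<..<2} g'"
      by (intro continuous_at_imp_continuous_on ballI DERIV_isCont[OF g']) auto
    show "continuous_on W f''"
      unfolding f''_def
      by (intro continuous_intros continuous_on_compose2[OF g''] continuous_on_compose2[OF cg']
          bounded_linear.continuous_on[OF bounded_linear_blinfun_scaleR_left])
        (use rng in \<open>auto simp: W_def\<close>)
  qed
  then show ?thesis unfolding C2_on_sphere_def using sub by blast
qed

text \<open>
  The extension of \<open>g\<close> to \<open>(- 1, 2)\<close> is what makes \<open>g(|z2|\<^sup>2)\<close> a function of class C2 on an open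
  neighbourhood of the sphere.
\<close>

lemma profile_solution:
  fixes g g' g'' :: "real \<Rightarrow> real"
  assumes g: "\<And>s. - 1 < s \<Longrightarrow> s < 2 \<Longrightarrow> (g has_real_derivative g' s) (at s)"
    and g': "\<And>s. - 1 < s \<Longrightarrow> s < 2 \<Longrightarrow> (g' has_real_derivative g'' s) (at s)"
    and g'': "continuous_on UNIV g''"
    and pos: "\<And>s. 0 \<le> s \<Longrightarrow> s \<le> 1 \<Longrightarrow> 0 < g s"
    and ode: "\<And>s. 0 \<le> s \<Longrightarrow> s \<le> 1 \<Longrightarrow>
      s * (1 - s) * g'' s + (1 - 2 * s) * g' s + lam / 4 * (g s powr q - g s) = 0"
  shows "positive_solution q lam (\<lambda>z. g (snd z \<bullet> snd z))"
    and "torus_invariant (\<lambda>z. g (snd z \<bullet> snd z))"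
proof -
  show "positive_solution q lam (\<lambda>z. g (snd z \<bullet> snd z))"
    unfolding positive_solution_def
  proof (intro conjI ballI)
    show "C2_on_sphere (\<lambda>z::complex \<times> complex. g (snd z \<bullet> snd z))"
      by (rule C2_on_sphere_profile[OF g g' g''])
    fix x :: "complex \<times> complex" assume x: "x \<in> S3"
    show "0 < g (snd x \<bullet> snd x)" using pos latitude_range[OF x] by auto
    have "sphere_laplacian (\<lambda>z. g (snd z \<bullet> snd z)) x = 4 * (snd x \<bullet> snd x * (1 - snd x \<bullet> snd x) * g'' (snd x \<bullet> snd x)
        + (1 - 2 * (snd x \<bullet> snd x)) * g' (snd x \<bullet> snd x))"
      by (rule sphere_laplacian_profile[OF g g']) (use x in auto)
    then show "- sphere_laplacian (\<lambda>z. g (snd z \<bullet> snd z)) x + lam * g (snd x \<bullet> snd x) =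
        lam * (g (snd x \<bullet> snd x) powr q)"
      using ode[OF latitude_range[OF x]] by (simp add: algebra_simps)
  qed
  show "torus_invariant (\<lambda>z. g (snd z \<bullet> snd z))"
    by (simp add: torus_invariant_def dot_square_norm norm_mult)
qed

section \<open>The equation with a power nonlinearity\<close>

text \<open>
  On \<open>[0, B]\<close> the derivative of \<open>x\<^sup>q - x\<close> lies between \<open>- 1\<close> and \<open>q B\<^sup>q\<^sup>-\<^sup>1\<close>.
\<close>

lemma truncated_nonlinearity_bounds:
  fixes q B :: real
  assumes q: "1 < q" and B: "1 \<le> B"
  defines "f \<equiv> \<lambda>x. min (max x 0) B powr q - min (max x 0) B"
  shows "\<bar>f x - f y\<bar> \<le> q * B powr q * \<bar>x - y\<bar>" "\<bar>f x\<bar> \<le> q * B powr q"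
proof -
  define h where "h x = x powr q - x" for x :: real
  have Bq: "1 \<le> B powr q" "1 \<le> B powr (q - 1)" using B q by (auto intro: ge_one_powr_ge_zero)
  have BB: "B powr q = B * B powr (q - 1)" using B by (simp add: powr_diff)
  have le: "\<bar>h b - h a\<bar> \<le> q * B powr (q - 1) * (b - a)" if ab: "0 \<le> a" "a \<le> b" "b \<le> B" for a b
  proof -
    have "\<bar>h b - h a\<bar> \<le> q * B powr (q - 1) * b - q * B powr (q - 1) * a"
    proof (rule abs_increment_le[OF ab(2), where f' = "\<lambda>x. q * x powr (q - 1) - 1" and g' = "\<lambda>_. q * B powr (q - 1)"])
      show "continuous_on {a..b} h"
        unfolding h_def using ab q by (intro continuous_on_diff continuous_on_powr' continuous_intros) auto
      fix x assume x: "a < x" "x < b"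
      then have x0: "0 < x" using ab by simp
      show "(h has_real_derivative q * x powr (q - 1) - 1) (at x)"
        unfolding h_def using x0 by (auto intro!: derivative_eq_intros)
      have "x powr (q - 1) \<le> B powr (q - 1)" using x x0 ab q by (intro powr_mono2) auto
      then have "q * x powr (q - 1) \<le> q * B powr (q - 1)" using q by (intro mult_left_mono) auto
      moreover have "0 \<le> q * x powr (q - 1)" using q by simp
      moreover have "1 * 1 \<le> q * B powr (q - 1)" using q Bq by (intro mult_mono) auto
      ultimately show "\<bar>q * x powr (q - 1) - 1\<bar> \<le> q * B powr (q - 1)" by (simp add: abs_le_iff)
    qed (auto intro!: continuous_intros derivative_eq_intros)
    then show ?thesis by (simp add: right_diff_distrib)
  qed
  define c where "c x = min (max x 0) B" for x
  have c: "0 \<le> c x" "c x \<le> B" for x using B by (auto simp: c_def)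
  have fh: "f x = h (c x)" for x by (simp add: f_def h_def c_def)
  have sym: "\<bar>h (c x) - h (c y)\<bar> \<le> q * B powr (q - 1) * \<bar>c x - c y\<bar>" for x y
    using le[of "c x" "c y"] le[of "c y" "c x"] c by (cases "c x \<le> c y") (auto simp: abs_minus_commute)
  have qB: "0 \<le> q * B powr (q - 1)" using q by simp
  have "\<bar>c x - c y\<bar> \<le> \<bar>x - y\<bar>" by (auto simp: c_def min_def max_def)
  then have "\<bar>f x - f y\<bar> \<le> q * B powr (q - 1) * \<bar>x - y\<bar>"
    unfolding fh using sym[of x y] qB by (meson mult_left_mono order_trans)
  also have "\<dots> \<le> q * B powr q * \<bar>x - y\<bar>"
    unfolding BB using q B Bq by (intro mult_right_mono mult_left_mono) auto
  finally show "\<bar>f x - f y\<bar> \<le> q * B powr q * \<bar>x - y\<bar>" .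
  have "\<bar>f x\<bar> = \<bar>h (c x) - h (c 1)\<bar>" using B by (simp add: fh h_def c_def)
  also have "\<dots> \<le> q * B powr (q - 1) * \<bar>c x - c 1\<bar>" by (rule sym)
  also have "\<dots> \<le> q * B powr (q - 1) * B"
  proof (rule mult_left_mono[OF _ qB])
    have "c 1 = 1" using B by (simp add: c_def)
    then show "\<bar>c x - c 1\<bar> \<le> B" using c[of x] B by (auto simp: abs_le_iff)
  qed
  finally show "\<bar>f x\<bar> \<le> q * B powr q" by (simp add: BB mult_ac)
qed

text \<open>
  The barrier is \<open>B s = B0 (1 + s) powr (1 / (2 q))\<close>.  Its exponent is small enough that the Lipschitz
  constant \<open>q (B s)\<^sup>q\<close> grows only like \<open>sqrt (1 + s)\<close>, which the weight \<open>(1 + s)\<^sup>-\<^sup>2\<close> absorbs.  It is also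
  large enough never to be reached when \<open>a \<le> 1\<close>: since \<open>x\<^sup>q - x \<ge> - 1\<close>, every solution satisfies
  \<open>y v' = P \<le> \<Lambda> y / (1 + y)\<close>, hence \<open>v \<le> 1 + \<Lambda> ln (1 + y) \<le> B y\<close>.  So positive regular
  members of the shooting family solve the original equation.
  The solution with index \<open>j\<close> has exactly \<open>j - 1\<close> crossings, so its value at the circle \<open>z2 = 0\<close>
  determines \<open>j\<close>.
\<close>

lemma distinct_solutions_below_one_at_pole:
  fixes q lam :: real and k :: nat
  assumes q: "1 < q" and k: "1 \<le> k" and lam: "4 * real k * (real k + 1) / (q - 1) < lam"
  shows "\<exists>u. \<forall>j\<in>{2..k}. positive_solution q lam (u j) \<and> torus_invariant (u j) \<and>
            u j (1, 0) < 1 \<and> (\<forall>i\<in>{2..k}. u i (1, 0) = u j (1, 0) \<longrightarrow> i = j)"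
proof -
  define \<Lambda> where "\<Lambda> = lam / 4"
  have L: "real k * (real k + 1) < \<Lambda> * (q - 1)" using lam q by (simp add: \<Lambda>_def field_simps)
  have "0 < \<Lambda> * (q - 1)" by (rule le_less_trans[OF _ L]) simp
  then have L0: "0 < \<Lambda>" using q by (simp add: zero_less_mult_iff)
  define B0 where "B0 = 1 + \<Lambda> * (2 * q)"
  have B0: "1 < B0" using L0 q by (simp add: B0_def)
  define B where "B s = B0 * (1 + s) powr (1 / (2 * q))" for s :: real
  have Bge: "B0 \<le> B s" "1 < B s" if "0 \<le> s" for s
  proof -
    have "1 \<le> (1 + s) powr (1 / (2 * q))" using that q by (intro ge_one_powr_ge_zero) auto
    then show "B0 \<le> B s" using B0 by (simp add: B_def mult_le_cancel_left1)
    then show "1 < B s" using B0 by simp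
  qed
  define K where "K = \<Lambda> * q * B0 powr q"
  have K: "0 < K" using L0 q B0 by (simp add: K_def)
  have BK: "\<Lambda> * (q * B s powr q) / (1 + s)\<^sup>2 = K / ((1 + s) * sqrt (1 + s))" if s: "0 \<le> s" for s
  proof -
    have "B s powr q = B0 powr q * ((1 + s) powr (1 / (2 * q))) powr q"
      using B0 by (simp add: B_def powr_mult)
    also have "((1 + s) powr (1 / (2 * q))) powr q = sqrt (1 + s)"
      using q s by (simp add: powr_powr powr_half_sqrt)
    finally have "\<Lambda> * (q * B s powr q) / (1 + s)\<^sup>2 = K * (sqrt (1 + s) / (1 + s)) / (1 + s)"
      by (simp add: K_def power2_eq_square)
    also have "sqrt (1 + s) / (1 + s) = 1 / sqrt (1 + s)" using s by (simp add: frac_eq_eq)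
    finally show ?thesis by (simp add: mult.commute)
  qed
  define f where "f s x = min (max x 0) (B s) powr q - min (max x 0) (B s)" for s x
  define \<phi> where "\<phi> s x = \<Lambda> * f s x / (1 + s)\<^sup>2" for s x
  have bound: "\<bar>\<phi> s x\<bar> \<le> K / ((1 + s) * sqrt (1 + s))" if s: "0 \<le> s" for s x
  proof -
    have "\<bar>\<phi> s x\<bar> = \<Lambda> * \<bar>f s x\<bar> / (1 + s)\<^sup>2" using L0 by (simp add: \<phi>_def abs_mult)
    also have "\<dots> \<le> \<Lambda> * (q * B s powr q) / (1 + s)\<^sup>2"
      using truncated_nonlinearity_bounds(2)[OF q less_imp_le[OF Bge(2)[OF s]], of x] L0
      unfolding f_def by (intro divide_right_mono mult_left_mono) auto
    finally show ?thesis by (simp only: BK[OF s])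
  qed
  have lip: "\<bar>\<phi> s x - \<phi> s y\<bar> \<le> K / ((1 + s) * sqrt (1 + s)) * \<bar>x - y\<bar>" if s: "0 \<le> s" for s x y
  proof -
    have "\<phi> s x - \<phi> s y = \<Lambda> * (f s x - f s y) / (1 + s)\<^sup>2" by (simp add: \<phi>_def right_diff_distrib diff_divide_distrib)
    then have "\<bar>\<phi> s x - \<phi> s y\<bar> = \<Lambda> * \<bar>f s x - f s y\<bar> / (1 + s)\<^sup>2" using L0 by (simp add: abs_mult)
    also have "\<dots> \<le> \<Lambda> * (q * B s powr q * \<bar>x - y\<bar>) / (1 + s)\<^sup>2"
      using truncated_nonlinearity_bounds(1)[OF q less_imp_le[OF Bge(2)[OF s]], of x y] L0
      unfolding f_def by (intro divide_right_mono mult_left_mono) auto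
    also have "\<dots> = \<Lambda> * (q * B s powr q) / (1 + s)\<^sup>2 * \<bar>x - y\<bar>" by simp
    finally show ?thesis by (simp only: BK[OF s])
  qed
  have wK: "K / ((1 + s) * sqrt (1 + s)) \<le> K" if "0 \<le> s" for s
  proof -
    have "1 * 1 \<le> (1 + s) * sqrt (1 + s)" using that by (intro mult_mono) auto
    then show ?thesis using K by (simp add: divide_le_eq mult_le_cancel_left1)
  qed
  have cont: "continuous_on ({0..} \<times> UNIV) (\<lambda>(s, x). \<phi> s x)"
  proof -
    have cB: "continuous_on ({0..} \<times> UNIV) (\<lambda>p :: real \<times> real. min (max (snd p) 0) (B (fst p)))"
      unfolding B_def by (intro continuous_intros) auto
    have "continuous_on ({0..} \<times> UNIV) (\<lambda>p :: real \<times> real. f (fst p) (snd p))"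
      unfolding f_def using q Bge(2)
      by (intro continuous_on_diff continuous_on_powr' cB continuous_intros)
         (force simp: min_def max_def)+
    then show ?thesis
      unfolding \<phi>_def case_prod_beta by (intro continuous_intros) auto
  qed
  have b1: "\<bar>\<phi> s x\<bar> \<le> K" if "0 \<le> s" for s x
    using bound[OF that, of x] wK[OF that] by linarith
  have l1: "\<bar>\<phi> s x - \<phi> s y\<bar> \<le> K * \<bar>x - y\<bar>" if "0 \<le> s" for s x y
    using lip[OF that, of x y] mult_right_mono[OF wK[OF that], of "\<bar>x - y\<bar>"] by simp
  obtain v where v: "\<And>a. continuous_on {0..} (v a)"
    "\<And>a y. 0 \<le> y \<Longrightarrow>
       v a y = a - integral {0..y} (\<lambda>r. integral {0..1} (\<lambda>\<tau>. \<phi> (\<tau> * r) (v a (\<tau> * r))))"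
    "\<And>a b y. 0 \<le> y \<Longrightarrow> \<bar>v a y - v b y\<bar> \<le> 2 * \<bar>a - b\<bar> * exp (2 * K * y)"
    "\<And>a y. (\<And>s. 0 \<le> s \<Longrightarrow> \<phi> s a = 0) \<Longrightarrow> 0 \<le> y \<Longrightarrow> v a y = a"
    using singular_ivp_family[OF K cont b1 l1] by blast
  define P where "P a y = - integral {0..y} (\<lambda>s. \<phi> s (v a s))" for a y
  note sys = singular_ivp_first_order_system[OF cont v(1) v(2) P_def]
  have f_one: "f s 1 = 0" if "0 \<le> s" for s using Bge(2)[OF that] by (simp add: f_def)
  have f_nonpos: "f s x = 0" if "0 \<le> s" "x \<le> 0" for s x using Bge(2)[OF that(1)] that q by (simp add: f_def)
  have powr_le: "x powr q \<le> x" if "0 \<le> x" "x \<le> 1" for x :: real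
    using powr_mono'[of 1 q x] that q by (cases "x = 0") auto
  interpret shooting \<phi> K v P
  proof
    show "\<phi> s 1 = 0" if "0 \<le> s" for s using f_one[OF that] by (simp add: \<phi>_def)
    show "\<phi> s x = 0" if "0 \<le> s" "x \<le> 0" for s x using f_nonpos[OF that] by (simp add: \<phi>_def)
    show "\<phi> s x \<le> 0" if "0 \<le> s" "x \<le> 1" for s x
    proof -
      have "f s x \<le> 0" using Bge(2)[OF that(1)] that powr_le[of "max x 0"] by (auto simp: f_def min_def)
      then show ?thesis using L0 by (simp add: \<phi>_def divide_nonpos_nonneg mult_nonneg_nonpos)
    qed
    show "v a 0 = a" for a using v(2)[of 0 a] by simp
    show "P a 0 = 0" for a by (simp add: P_def)
  qed (use K bound lip v sys in auto)
  have f_ge: "- 1 \<le> f s x" if "0 \<le> s" for s x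
  proof -
    define c where "c = min (max x 0) (B s)"
    have c: "0 \<le> c" using Bge(2)[OF that] by (simp add: c_def)
    show ?thesis
    proof (cases "c \<le> 1")
      case True
      then show ?thesis unfolding f_def c_def[symmetric] using powr_ge_zero[of c q] by linarith
    next
      case False
      then have "c powr 1 \<le> c powr q" using q by (intro powr_mono) auto
      then show ?thesis unfolding f_def c_def[symmetric] using False by simp
    qed
  qed
  have v_le_B: "v a y \<le> B y" if a: "a \<le> 1" and y: "0 \<le> y" for a y
  proof -
    have Py: "P a s \<le> \<Lambda> * (1 - 1 / (1 + s))" if s: "0 \<le> s" for s
    proof -
      have "P a s - \<Lambda> * (1 - 1 / (1 + s)) \<le> P a 0 - \<Lambda> * (1 - 1 / (1 + 0))"
      proof (rule DERIV_nonpos_imp_decreasing_open[OF s, where f = "\<lambda>s. P a s - \<Lambda> * (1 - 1 / (1 + s))"])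
        fix x assume x: "0 < x" "x < s"
        have "((\<lambda>s. P a s - \<Lambda> * (1 - 1 / (1 + s))) has_real_derivative
            - \<phi> x (v a x) - \<Lambda> * (1 / (1 + x)\<^sup>2)) (at x)"
          using x by (auto intro!: derivative_eq_intros P_deriv simp: power2_eq_square)
        moreover have "- \<phi> x (v a x) - \<Lambda> * (1 / (1 + x)\<^sup>2) = - (\<Lambda> * (f x (v a x) + 1) / (1 + x)\<^sup>2)"
          by (simp add: \<phi>_def add_divide_distrib distrib_left)
        moreover have "0 \<le> \<Lambda> * (f x (v a x) + 1) / (1 + x)\<^sup>2"
          using f_ge[of x "v a x"] x L0 by (intro divide_nonneg_nonneg mult_nonneg_nonneg) auto
        ultimately show "\<exists>z. ((\<lambda>s. P a s - \<Lambda> * (1 - 1 / (1 + s))) has_real_derivative z) (at x) \<and> z \<le> 0"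
          by (metis neg_le_0_iff_le)
      next
        show "continuous_on {0..s} (\<lambda>s. P a s - \<Lambda> * (1 - 1 / (1 + s)))"
          by (intro continuous_intros continuous_on_subset[OF P_cont]) auto
      qed
      then show ?thesis by (simp add: P_0)
    qed
    have "v a y - \<Lambda> * ln (1 + y) \<le> v a 0 - \<Lambda> * ln (1 + 0)"
    proof (rule DERIV_nonpos_imp_decreasing_open[OF y, where f = "\<lambda>s. v a s - \<Lambda> * ln (1 + s)"])
      fix x assume x: "0 < x" "x < y"
      have "((\<lambda>s. v a s - \<Lambda> * ln (1 + s)) has_real_derivative P a x / x - \<Lambda> * (1 / (1 + x))) (at x)"
        using x by (auto intro!: derivative_eq_intros v_deriv)
      moreover have "P a x / x - \<Lambda> * (1 / (1 + x)) \<le> 0"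
      proof -
        have "P a x / x \<le> \<Lambda> * (1 - 1 / (1 + x)) / x" using Py[of x] x by (intro divide_right_mono) auto
        also have "1 - 1 / (1 + x) = x / (1 + x)" using x by (simp add: diff_divide_eq_iff)
        also have "\<Lambda> * (x / (1 + x)) / x = \<Lambda> * (1 / (1 + x))" using x by simp
        finally show ?thesis by simp
      qed
      ultimately show "\<exists>z. ((\<lambda>s. v a s - \<Lambda> * ln (1 + s)) has_real_derivative z) (at x) \<and> z \<le> 0" by blast
    next
      show "continuous_on {0..y} (\<lambda>s. v a s - \<Lambda> * ln (1 + s))"
        by (intro continuous_intros continuous_on_subset[OF v_cont]) auto
    qed
    then have "v a y \<le> 1 + \<Lambda> * ln (1 + y)" using a by (simp add: v_0)
    also have "\<dots> \<le> B y"
    proof -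
      define E where "E = (1 + y) powr (1 / (2 * q))"
      have "ln (1 + y) \<le> E / (1 / (2 * q))" unfolding E_def using y q by (intro ln_powr_bound) auto
      then have "\<Lambda> * ln (1 + y) \<le> \<Lambda> * (2 * q) * E" using L0 by (simp add: mult_left_mono mult.assoc mult.commute)
      moreover have "1 \<le> E" unfolding E_def using y q by (intro ge_one_powr_ge_zero) auto
      ultimately show ?thesis by (simp add: B_def E_def[symmetric] B0_def distrib_right)
    qed
    finally show ?thesis .
  qed
  define F where "F x = \<Lambda> * (x powr q - x)" for x
  define F' where "F' x = \<Lambda> * (q * x powr (q - 1) - 1)" for x
  have dF: "(F has_real_derivative F' x) (at x)" if "0 < x" for x
    unfolding F_def F'_def using that by (auto intro!: derivative_eq_intros)
  have cF': "isCont F' x" if "0 < x" for x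
    unfolding F'_def using that by (intro continuous_intros) auto
  obtain \<eta> where \<eta>: "\<eta> < 1" "\<And>a. \<eta> < a \<Longrightarrow> a < 1 \<Longrightarrow> crosses a k"
  proof -
    have F1: "(F has_real_derivative F' 1) (at 1)" by (rule dF) simp
    have "F' 1 = \<Lambda> * (q - 1)" by (simp add: F'_def)
    then have "real k * (real k + 1) < F' 1" using L by simp
    moreover have "((\<lambda>x. (F x - F 1) / (x - 1)) \<longlongrightarrow> F' 1) (at 1)"
      using F1 by (simp add: has_field_derivative_iff)
    ultimately have "\<forall>\<^sub>F x in at 1. real k * (real k + 1) < (F x - F 1) / (x - 1)"
      by (intro order_tendstoD(1)) auto
    then obtain d where d: "0 < d" "\<And>x. x \<noteq> 1 \<Longrightarrow> dist x 1 < d \<Longrightarrow> real k * (real k + 1) < (F x - F 1) / (x - 1)"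
      by (auto simp: eventually_at)
    \<comment> \<open>\<open>\<delta> \<le> B0 - 1\<close> keeps \<open>1 + \<delta>\<close> below the barrier, and \<open>\<delta> < 1\<close> keeps \<open>1 - \<delta>\<close> positive.\<close>
    define \<delta> where "\<delta> = min (d / 2) (min (1/2) (B0 - 1))"
    have \<delta>: "0 < \<delta>" "\<delta> < d" "\<delta> < 1" "\<delta> \<le> B0 - 1" using d B0 by (auto simp: \<delta>_def)
    have "\<exists>\<eta><1. \<forall>a. \<eta> < a \<longrightarrow> a < 1 \<longrightarrow> crosses a k"
    proof (rule near_one_crosses[OF k \<delta>(1)])
      fix s x :: real assume s: "0 \<le> s" and x: "\<bar>x - 1\<bar> \<le> \<delta>"
      have "x \<le> B s" "0 < x" using x \<delta> Bge(1)[OF s] by (auto simp: abs_le_iff)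
      then have \<phi>: "\<phi> s x = F x / (1 + s)\<^sup>2" by (simp add: \<phi>_def f_def F_def)
      have "real k * (real k + 1) * (x - 1)\<^sup>2 \<le> F x * (x - 1)"
      proof (cases "x = 1")
        case False
        then have "real k * (real k + 1) < F x / (x - 1)"
          using d(2)[of x] x \<delta> by (simp add: dist_real_def F_def)
        then have "real k * (real k + 1) * (x - 1)\<^sup>2 \<le> F x / (x - 1) * (x - 1)\<^sup>2"
          by (intro mult_right_mono) auto
        then show ?thesis using False by (simp add: power2_eq_square)
      qed simp
      then have "real k * (real k + 1) * (x - 1)\<^sup>2 / (1 + s)\<^sup>2 \<le> F x * (x - 1) / (1 + s)\<^sup>2"
        by (intro divide_right_mono) auto
      then show "real k * (real k + 1) * (x - 1)\<^sup>2 / (1 + s)\<^sup>2 \<le> \<phi> s x * (x - 1)"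
        by (simp add: \<phi>)
    qed
    then show ?thesis using that by blast
  qed
  have sol: "\<exists>u. positive_solution q lam u \<and> torus_invariant u \<and> u (1, 0) = a"
    if a: "0 < a" "a < 1" and reg: "(P a \<longlongrightarrow> 0) at_top" for a
  proof -
    obtain \<beta> where \<beta>: "0 < \<beta>" "(v a \<longlongrightarrow> \<beta>) at_top" by (rule regular_imp_limit[OF a(1) reg])
    have pos: "0 < v a y" if "0 \<le> y" for y by (rule regular_imp_pos[OF a(1) reg that])
    define Y where "Y s = s / (1 - s)" for s :: real
    have Y: "0 < Y s" "1 + Y s = 1 / (1 - s)" if "0 < s" "s < 1" for s
      using that by (auto simp: Y_def field_simps)
    have dY: "(Y has_real_derivative 1 / (1 - s)\<^sup>2) (at s)" if "0 < s" "s < 1" for s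
      unfolding Y_def using that by (auto intro!: derivative_eq_intros simp: power2_eq_square)
    have Y0: "filterlim Y (at_right 0) (at_right 0)" unfolding Y_def by real_asymp
    have Y1: "filterlim Y at_top (at_left 1)" unfolding Y_def by real_asymp
    have lim0: "(h \<longlongrightarrow> h 0) (at_right 0)" if "continuous_on {0..} h" for h :: "real \<Rightarrow> real"
      using that by (auto simp: continuous_on_def intro: tendsto_within_subset[of _ _ 0 "{0..}"])
    obtain g g' g'' where g:
      "\<And>s. - 1 < s \<Longrightarrow> s < 2 \<Longrightarrow> (g has_real_derivative g' s) (at s)"
      "\<And>s. - 1 < s \<Longrightarrow> s < 2 \<Longrightarrow> (g' has_real_derivative g'' s) (at s)"
      "continuous_on UNIV g''" "g 0 = a"
      "\<And>s. 0 \<le> s \<Longrightarrow> s \<le> 1 \<Longrightarrow> 0 < g s"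
      "\<And>s. 0 \<le> s \<Longrightarrow> s \<le> 1 \<Longrightarrow> s * (1 - s) * g'' s + (1 - 2 * s) * g' s + F (g s) = 0"
    proof (rule singular_profile_is_C2[where V = "\<lambda>s. v a (Y s)" and Q = "\<lambda>s. P a (Y s)" and F = F and F' = F'
          and ?\<beta>0.0 = a and ?\<beta>1.0 = \<beta>])
      fix s :: real assume s: "0 < s" "s < 1"
      have "((\<lambda>s. v a (Y s)) has_real_derivative P a (Y s) / Y s * (1 / (1 - s)\<^sup>2)) (at s)"
        by (rule DERIV_chain2[OF v_deriv[OF Y(1)[OF s]] dY[OF s]])
      also have "P a (Y s) / Y s * (1 / (1 - s)\<^sup>2) = P a (Y s) / (s * (1 - s))"
        using s by (simp add: Y_def power2_eq_square)
      finally show "((\<lambda>s. v a (Y s)) has_real_derivative P a (Y s) / (s * (1 - s))) (at s)" .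
      have "((\<lambda>s. P a (Y s)) has_real_derivative - \<phi> (Y s) (v a (Y s)) * (1 / (1 - s)\<^sup>2)) (at s)"
        by (rule DERIV_chain2[OF P_deriv[OF Y(1)[OF s]] dY[OF s]])
      also have "\<phi> (Y s) (v a (Y s)) = F (v a (Y s)) * (1 - s)\<^sup>2"
        using v_le_B[of a "Y s"] pos[of "Y s"] a Y[OF s] s
        by (simp add: \<phi>_def f_def F_def power_divide)
      also have "- (F (v a (Y s)) * (1 - s)\<^sup>2) * (1 / (1 - s)\<^sup>2) = - F (v a (Y s))" using s by simp
      finally show "((\<lambda>s. P a (Y s)) has_real_derivative - F (v a (Y s))) (at s)" .
      show "0 < v a (Y s)" using pos Y(1)[OF s] by simp
    next
      show "((\<lambda>s. P a (Y s)) \<longlongrightarrow> 0) (at_right 0)"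
        using filterlim_compose[OF lim0[OF P_cont[of a]] Y0] by (simp add: P_0)
      show "((\<lambda>s. v a (Y s)) \<longlongrightarrow> a) (at_right 0)"
        using filterlim_compose[OF lim0[OF v_cont[of a]] Y0] by (simp add: v_0)
      show "((\<lambda>s. P a (Y s)) \<longlongrightarrow> 0) (at_left 1)" by (rule filterlim_compose[OF reg Y1])
      show "((\<lambda>s. v a (Y s)) \<longlongrightarrow> \<beta>) (at_left 1)" by (rule filterlim_compose[OF \<beta>(2) Y1])
    qed (use dF cF' a \<beta> in auto)
    have "positive_solution q lam (\<lambda>z. g (snd z \<bullet> snd z))" "torus_invariant (\<lambda>z. g (snd z \<bullet> snd z))"
      using profile_solution[OF g(1-3,5), of lam q] g(6) by (auto simp: F_def \<Lambda>_def)
    then show ?thesis using g(4) by (intro exI[of _ "\<lambda>z. g (snd z \<bullet> snd z)"]) simp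
  qed
  have "\<exists>u. positive_solution q lam u \<and> torus_invariant u \<and> 0 < u (1, 0) \<and> u (1, 0) < 1 \<and>
      crosses (u (1, 0)) (j - 1) \<and> \<not> crosses (u (1, 0)) j"
    if j: "j \<in> {2..k}" for j
  proof -
    have "\<exists>a. 0 < a \<and> a < 1 \<and> (P a \<longlongrightarrow> 0) at_top \<and> crosses a (j - 1) \<and> \<not> crosses a j"
      by (rule exists_regular_at_jump[OF \<eta>(1)]) (use \<eta>(2) j crosses_mono in auto)
    then show ?thesis using sol by metis
  qed
  then obtain u where u: "\<And>j. j \<in> {2..k} \<Longrightarrow> positive_solution q lam (u j) \<and> torus_invariant (u j) \<and>
      0 < u j (1, 0) \<and> u j (1, 0) < 1 \<and> crosses (u j (1, 0)) (j - 1) \<and> \<not> crosses (u j (1, 0)) j"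
    using bchoice[of "{2..k}" "\<lambda>j u. positive_solution q lam u \<and> torus_invariant u \<and> 0 < u (1, 0) \<and>
      u (1, 0) < 1 \<and> crosses (u (1, 0)) (j - 1) \<and> \<not> crosses (u (1, 0)) j"] by blast
  have inj: "i = j" if "i \<in> {2..k}" "j \<in> {2..k}" "u i (1, 0) = u j (1, 0)" for i j
  proof -
    have "\<not> i \<le> j - 1" "\<not> j \<le> i - 1"
      using u[OF that(1)] u[OF that(2)] that(3) crosses_mono by metis+
    then show ?thesis using that by auto
  qed
  show ?thesis using u inj by (intro exI[of _ u]) auto
qed

lemma constant_one_solution:
  "positive_solution q lam (\<lambda>_. 1)" "torus_invariant (\<lambda>_. 1)"
  using profile_solution[of "\<lambda>_. 1" "\<lambda>_. 0" "\<lambda>_. 0" lam q] by auto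

theorem corollary1p4:
  fixes q lam :: real and k :: nat
  assumes "q > 1" and "k \<ge> 1"
    and "lam \<in> {4 * real k * (real k + 1) / (q - 1)
                <.. 4 * (real k + 1) * (real k + 2) / (q - 1)}"
  shows "\<exists>U :: nat \<Rightarrow> complex \<times> complex \<Rightarrow> real.
           (\<forall>i<k. positive_solution q lam (U i) \<and> torus_invariant (U i)) \<and>
           (\<forall>i<k. \<forall>j<k. i \<noteq> j \<longrightarrow> (\<exists>x\<in>S3. U i x \<noteq> U j x))"
proof -
  have "4 * real k * (real k + 1) / (q - 1) < lam" using assms(3) by simp
  from distinct_solutions_below_one_at_pole[OF assms(1,2) this] obtain u where u:
    "\<And>j. j \<in> {2..k} \<Longrightarrow> positive_solution q lam (u j) \<and> torus_invariant (u j) \<and> u j (1, 0) < 1"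
    "\<And>i j. i \<in> {2..k} \<Longrightarrow> j \<in> {2..k} \<Longrightarrow> u i (1, 0) = u j (1, 0) \<Longrightarrow> i = j"
    by blast
  \<comment> \<open>The nonconstant solutions are indexed from \<open>2\<close> to \<open>k\<close>.\<close>
  define U where "U i = (if i = 0 then (\<lambda>_. 1) else u (Suc i))" for i :: nat
  have sol: "positive_solution q lam (U i) \<and> torus_invariant (U i)" if "i < k" for i
    using u(1)[of "Suc i"] constant_one_solution that by (auto simp: U_def)
  have pole: "((1, 0) :: complex \<times> complex) \<in> S3" by (simp add: norm_Pair)
  have "U i (1, 0) \<noteq> U j (1, 0)" if "i < k" "j < k" "i \<noteq> j" for i j
    using u(1)[of "Suc i"] u(1)[of "Suc j"] u(2)[of "Suc i" "Suc j"] that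
    by (cases "i = 0"; cases "j = 0") (auto simp: U_def)
  then show ?thesis using sol pole by blast
qed

end
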